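(* Let $\mathbf z_1,\dots,\mathbf z_n$ be a random sample from the distribution of a random vector $\mathbf z\in\mathbb R^p$ with mutually independent components having mean $0$ and variance $1$. Notation is as in the context. (i) Suppose $\mathbf z$ has finite sixth moments and at most one of $\gamma_1,\dots,\gamma_p$ is zero. Then for $\alpha=1$ there is a sequence of symmetric projection pursuit solutions $\hat{\mathbf W}\to_P\mathbf I_p$ such that the limiting distribution of $\sqrt n\,\mathrm{vec}(\hat{\mathbf W}-\mathbf I_p)$ is multivariate normal with mean vector $\mathbf 0$ and asymptotic variances $$ASV(\hat w_{kk})=\frac{\kappa_k+2}{4},\qquad ASV(\hat w_{kl})=\frac{\zeta_{11}}{(\gamma_k^2+\gamma_l^2)^2},\quad k\ne l,$$ where $\zeta_{11}=\gamma_k^2(\nu_k-\gamma_k^2)+\gamma_l^2(\nu_l-\gamma_l^2)+\gamma_l^4$. (ii) Suppose $\mathbf z$ has finite eighth moments and at most one of $\kappa_1,\dots,\kappa_p$ is zero. Then for $\alpha=0$ there is a sequence of symmetric projection pursuit solutions $\hat{\mathbf W}\to_P\mathbf I_p$ such that the limiting distribution of $\sqrt n\,\mathrm{vec}(\hat{\mathbf W}-\mathbf I_p)$ is multivariate normal with mean vector $\mathbf 0$ and asymptotic variances $$ASV(\hat w_{kk})=\frac{\kappa_k+2}{4},\qquad ASV(\hat w_{kl})=\frac{\zeta_{22}}{(\kappa_k^2+\kappa_l^2)^2},\quad k\ne l,$$ where $\zeta_{22}=\kappa_k^2(\omega_k-\beta_k^2)+\kappa_l^2(\omega_l-\beta_l^2)+\kappa_l^4$.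 (iii) Suppose $\mathbf z$ has finite eighth moments and $\gamma_k=\kappa_k=0$ for at most one $k$. Then there is a sequence of symmetric projection pursuit solutions $\hat{\mathbf W}\to_P\mathbf I_p$ based on both skewness and kurtosis such that the limiting distribution of $\sqrt n\,\mathrm{vec}(\hat{\mathbf W}-\mathbf I_p)$ is multivariate normal with mean vector $\mathbf 0$ and asymptotic variances $$ASV(\hat w_{kk})=\frac{\kappa_k+2}{4},\qquad ASV(\hat w_{kl})=\frac{9\alpha^2\zeta_{11}+16(1-\alpha)^2\zeta_{22}+24\alpha(1-\alpha)\zeta_{12}}{(3\alpha(\gamma_k^2+\gamma_l^2)+4(1-\alpha)(\kappa_k^2+\kappa_l^2))^2},\quad k\neq l,$$ where $\alpha\in[0,1]$ is the weight given to skewness, $\zeta_{11},\zeta_{22}$ are as in (i), (ii), and $\zeta_{12}=\gamma_k\kappa_k(\eta_k-\gamma_k\beta_k)+\gamma_l\kappa_l(\eta_l-\gamma_l\beta_l)+\gamma_l^2\kappa_l^2$.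
   Context: Moments, with $z_k$ the $k$th component of $\mathbf z$: $\gamma_k=E(z_k^3)$, $\beta_k=E(z_k^4)$, $\kappa_k=\beta_k-3$, $\omega_k=E(z_k^6)-E(z_k^3)^2$, $\nu_k=E(z_k^4)-1$, $\eta_k=E(z_k^5)-E(z_k^3)$. $ASV(\hat w_{kl})$ denotes the variance of the $(k,l)$ coordinate of the limiting distribution of $\sqrt n(\hat{\mathbf W}-\mathbf I_p)$ as $n\to\infty$. Symmetric projection pursuit estimate with weight $\alpha\in[0,1]$: let $\bar{\mathbf z}=\frac1n\sum_i\mathbf z_i$, $\hat{\boldsymbol\Sigma}=\frac1n\sum_i(\mathbf z_i-\bar{\mathbf z})(\mathbf z_i-\bar{\mathbf z})^T$ and $\mathbf y_i=\hat{\boldsymbol\Sigma}^{-1/2}(\mathbf z_i-\bar{\mathbf z})$ (symmetric positive definite root; $\hat{\boldsymbol\Sigma}$ is nonsingular with probability tending to one). A symmetric projection pursuit solution is $\hat{\mathbf W}=(\hat w_{kl})=\hat{\mathbf U}\hat{\boldsymbol\Sigma}^{-1/2}$, where $\hat{\mathbf U}$ maximizes over orthogonal matrices $\mathbf U=(\mathbf u_1,\dots,\mathbf u_p)^T$ the function $$\alpha\sum_{k=1}^p\Big(\frac1n\sum_{i=1}^n(\mathbf u_k^T\mathbf y_i)^3\Big)^2+(1-\alpha)\sum_{k=1}^p\Big(\frac1n\sum_{i=1}^n(\mathbf u_k^T\mathbf y_i)^4-3\Big)^2 .$$ (The maximizer is at best unique up to permutation and sign changes of the rows.)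
   Formalization: In (iii), at α=1 it is also assumed that at most one γ_k is zero, and at α=0 that at most one κ_k is zero; otherwise the denominator in ASV(ŵ_kl) vanishes for some pair k≠l and the formula is undefined. *)

theory Defs
  imports "HOL-Probability.Probability"
begin

definition moment :: "'a measure \<Rightarrow> ('a \<Rightarrow> real ^ 'p) \<Rightarrow> nat \<Rightarrow> 'p \<Rightarrow> real" where
  "moment N z r k = (\<integral>\<omega>. (z \<omega> $ k) ^ r \<partial>N)"

definition finite_moments :: "'a measure \<Rightarrow> ('a \<Rightarrow> real ^ 'p) \<Rightarrow> nat \<Rightarrow> bool" where
  "finite_moments N z r \<longleftrightarrow> (\<forall>k. integrable N (\<lambda>\<omega>. \<bar>z \<omega> $ k\<bar> ^ r))"

definition mgamma :: "'a measure \<Rightarrow> ('a \<Rightarrow> real ^ 'p) \<Rightarrow> 'p \<Rightarrow> real" where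
  "mgamma N z k = moment N z 3 k"

definition mbeta :: "'a measure \<Rightarrow> ('a \<Rightarrow> real ^ 'p) \<Rightarrow> 'p \<Rightarrow> real" where
  "mbeta N z k = moment N z 4 k"

definition mkappa :: "'a measure \<Rightarrow> ('a \<Rightarrow> real ^ 'p) \<Rightarrow> 'p \<Rightarrow> real" where
  "mkappa N z k = mbeta N z k - 3"

definition momega :: "'a measure \<Rightarrow> ('a \<Rightarrow> real ^ 'p) \<Rightarrow> 'p \<Rightarrow> real" where
  "momega N z k = moment N z 6 k - (moment N z 3 k)\<^sup>2"

definition mnu :: "'a measure \<Rightarrow> ('a \<Rightarrow> real ^ 'p) \<Rightarrow> 'p \<Rightarrow> real" where
  "mnu N z k = moment N z 4 k - 1"

definition meta :: "'a measure \<Rightarrow> ('a \<Rightarrow> real ^ 'p) \<Rightarrow> 'p \<Rightarrow> real" where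
  "meta N z k = moment N z 5 k - moment N z 3 k"

definition zeta11 :: "'a measure \<Rightarrow> ('a \<Rightarrow> real ^ 'p) \<Rightarrow> 'p \<Rightarrow> 'p \<Rightarrow> real" where
  "zeta11 N z k l =
     (mgamma N z k)\<^sup>2 * (mnu N z k - (mgamma N z k)\<^sup>2)
   + (mgamma N z l)\<^sup>2 * (mnu N z l - (mgamma N z l)\<^sup>2)
   + (mgamma N z l) ^ 4"

definition zeta22 :: "'a measure \<Rightarrow> ('a \<Rightarrow> real ^ 'p) \<Rightarrow> 'p \<Rightarrow> 'p \<Rightarrow> real" where
  "zeta22 N z k l =
     (mkappa N z k)\<^sup>2 * (momega N z k - (mbeta N z k)\<^sup>2)
   + (mkappa N z l)\<^sup>2 * (momega N z l - (mbeta N z l)\<^sup>2)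
   + (mkappa N z l) ^ 4"

definition zeta12 :: "'a measure \<Rightarrow> ('a \<Rightarrow> real ^ 'p) \<Rightarrow> 'p \<Rightarrow> 'p \<Rightarrow> real" where
  "zeta12 N z k l =
     mgamma N z k * mkappa N z k * (meta N z k - mgamma N z k * mbeta N z k)
   + mgamma N z l * mkappa N z l * (meta N z l - mgamma N z l * mbeta N z l)
   + (mgamma N z l)\<^sup>2 * (mkappa N z l)\<^sup>2"

definition sample_mean :: "nat \<Rightarrow> (nat \<Rightarrow> real ^ 'p) \<Rightarrow> real ^ 'p" where
  "sample_mean n x = (1 / real n) *\<^sub>R (\<Sum>i<n. x i)"

definition sample_cov :: "nat \<Rightarrow> (nat \<Rightarrow> real ^ 'p) \<Rightarrow> real ^ 'p ^ 'p" where
  "sample_cov n x = (\<chi> k l. (1 / real n) *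
     (\<Sum>i<n. (x i - sample_mean n x) $ k * (x i - sample_mean n x) $ l))"

definition sym_pos_def :: "real ^ 'p ^ 'p \<Rightarrow> bool" where
  "sym_pos_def A \<longleftrightarrow> transpose A = A \<and> (\<forall>x. x \<noteq> 0 \<longrightarrow> 0 < x \<bullet> (A *v x))"

text \<open>
  The symmetric positive definite square root of the inverse. It exists and is unique
  if the argument is symmetric positive definite, which is the case for every
  nonsingular sample covariance matrix; the value is unspecified otherwise.
\<close>
definition inv_sqrt :: "real ^ 'p ^ 'p \<Rightarrow> real ^ 'p ^ 'p" where
  "inv_sqrt S = (THE R. sym_pos_def R \<and> R ** R = matrix_inv S)"

definition whitened :: "nat \<Rightarrow> (nat \<Rightarrow> real ^ 'p) \<Rightarrow> nat \<Rightarrow> real ^ 'p" where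
  "whitened n x i = inv_sqrt (sample_cov n x) *v (x i - sample_mean n x)"

text \<open>The vector \<open>U $ k\<close> is the \<open>k\<close>th row of \<open>U\<close>.\<close>
definition spp_objective ::
    "real \<Rightarrow> nat \<Rightarrow> (nat \<Rightarrow> real ^ 'p) \<Rightarrow> real ^ 'p ^ 'p \<Rightarrow> real" where
  "spp_objective \<alpha> n y U =
     \<alpha> * (\<Sum>k\<in>UNIV. ((1 / real n) * (\<Sum>i<n. (U $ k \<bullet> y i) ^ 3))\<^sup>2)
   + (1 - \<alpha>) * (\<Sum>k\<in>UNIV. ((1 / real n) * (\<Sum>i<n. (U $ k \<bullet> y i) ^ 4) - 3)\<^sup>2)"

definition spp_solution ::
    "real \<Rightarrow> nat \<Rightarrow> (nat \<Rightarrow> real ^ 'p) \<Rightarrow> real ^ 'p ^ 'p \<Rightarrow> bool" where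
  "spp_solution \<alpha> n x W \<longleftrightarrow>
     (\<exists>U. is_arg_max (spp_objective \<alpha> n (whitened n x)) orthogonal_matrix U
        \<and> W = U ** inv_sqrt (sample_cov n x))"

definition converges_in_prob ::
    "'b measure \<Rightarrow> (nat \<Rightarrow> 'b \<Rightarrow> 'c::metric_space) \<Rightarrow> 'c \<Rightarrow> bool" where
  "converges_in_prob M X c \<longleftrightarrow>
     (\<forall>\<epsilon>>0. (\<lambda>n. measure M {\<omega> \<in> space M. dist (X n \<omega>) c > \<epsilon>}) \<longlonglongrightarrow> 0)"

definition converges_in_distribution ::
    "'b measure \<Rightarrow> (nat \<Rightarrow> 'b \<Rightarrow> 'c::euclidean_space) \<Rightarrow> 'c measure \<Rightarrow> bool" where
  "converges_in_distribution M X L \<longleftrightarrow>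
     (\<forall>f :: 'c \<Rightarrow> real. continuous_on UNIV f \<and> bounded (range f) \<longrightarrow>
        (\<lambda>n. \<integral>\<omega>. f (X n \<omega>) \<partial>M) \<longlonglongrightarrow> (\<integral>x. f x \<partial>L))"

definition normal_law :: "real \<Rightarrow> real \<Rightarrow> real measure" where
  "normal_law m \<sigma> =
     (if \<sigma> = 0 then return borel m else density lborel (normal_density m \<sigma>))"

text \<open>
  Multivariate normality: every linear functional is univariate normal. Degenerate laws
  are allowed, since the limiting covariance matrix below may be singular.
\<close>
definition multivariate_normal :: "'c::euclidean_space \<Rightarrow> 'c measure \<Rightarrow> bool" where
  "multivariate_normal m L \<longleftrightarrow> sets L = sets borel \<and>
     (\<forall>a. \<exists>\<sigma>\<ge>0. distr L borel (\<lambda>x. a \<bullet> x) = normal_law (a \<bullet> m) \<sigma>)"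

definition vectorize :: "real ^ 'p ^ 'p \<Rightarrow> real ^ ('p \<times> 'p)" where
  "vectorize A = (\<chi> kl. A $ fst kl $ snd kl)"

text \<open>
  Where the sample covariance matrix is singular, no solution is defined and \<open>W n\<close> is
  arbitrary; this happens with probability tending to zero.
\<close>
definition spp_asymptotic_normality ::
    "'b measure \<Rightarrow> (nat \<Rightarrow> 'b \<Rightarrow> real ^ 'p) \<Rightarrow> real \<Rightarrow> ('p \<Rightarrow> 'p \<Rightarrow> real) \<Rightarrow> bool" where
  "spp_asymptotic_normality M Z \<alpha> asv \<longleftrightarrow>
     (\<exists>(W :: nat \<Rightarrow> 'b \<Rightarrow> real ^ 'p ^ 'p) (L :: (real ^ ('p \<times> 'p)) measure).
        (\<forall>n. W n \<in> borel_measurable M)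
      \<and> (\<forall>n. \<forall>\<omega>\<in>space M. invertible (sample_cov n (\<lambda>i. Z i \<omega>)) \<longrightarrow>
            spp_solution \<alpha> n (\<lambda>i. Z i \<omega>) (W n \<omega>))
      \<and> converges_in_prob M W (mat 1)
      \<and> converges_in_distribution M
          (\<lambda>n \<omega>. sqrt (real n) *\<^sub>R vectorize (W n \<omega> - mat 1)) L
      \<and> multivariate_normal 0 L
      \<and> (\<forall>k l. prob_space.variance L (\<lambda>x. x $ (k, l)) = asv k l))"

end

theory Submission
  imports Defs
begin

text \<open>
  A solution closest to the identity is a fixed Borel function of the vector of raw sample
  moments of order at most four. At the population moments the maximizers of the objective are
  exactly the signed permutation matrices, by Cauchy-Schwarz, so by compactness and by invariance
  under signed permutations this function is continuous there with value the identity. Near the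
  population moments it satisfies polynomial equations: whitening, and vanishing derivative along
  rotations in each coordinate plane. Their linearization is invertible, so the function is
  differentiable at the population moments. The limit law then follows from the delta
  method, and the variances are those of the explicit linear terms.

  The multivariate central limit theorem is reduced to one dimension through the test functions
  \<open>cos (a \<bullet> x + b)\<close>. A multivariate normal law with given covariance is a linear
  image of independent standard normal variables.
\<close>

section \<open>Positive definite square roots\<close>

text \<open>Maximizers are unique only up to signed permutations, so no smooth solution branch is
  given in advance. Continuity of the chosen maximizer comes first; a function that is continuous at
  a point and solves equations differentiable there has the derivative dictated by their
  linearization, so no implicit function theorem is involved. Whitening gives p(p+1)/2 equations and
  the rotations p(p-1)/2, one per matrix entry in total. Once linearized they couple only the
  entries (k,l) and (l,k), and a suitable combination decouples them. For k \<noteq> l the linear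
  term is a constant multiple of \<open>p(z_k) z_l - q(z_l) z_k\<close> with cubic p and q. Here p
  is A x^2 + B x^3, with A proportional to \<gamma>_k and B to \<kappa>_k, minus its regression on 1
  and x. Hence p(z_k) z_k has mean zero and the two summands are uncorrelated. The polynomial q is
  the analogous residual for l plus a multiple of x; the square of that multiple produces the last
  term of each zeta and the asymmetry in k and l.\<close>

text \<open>Cholesky factorization by induction on the index set: the index \<open>x\<close> is
  split off and the induction hypothesis is applied to the Schur complement
  \<open>S i j - q i * q j\<close>. A zero pivot is harmless, because semidefiniteness then forces
  the whole column to vanish.\<close>

lemma gram_exists_on:
  fixes S :: "'i \<Rightarrow> 'i \<Rightarrow> real"
  assumes "finite I"
    and "\<And>i j. i \<in> I \<Longrightarrow> j \<in> I \<Longrightarrow> S i j = S j i"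
    and "\<And>c. 0 \<le> (\<Sum>i\<in>I. \<Sum>j\<in>I. c i * c j * S i j)"
  shows "\<exists>v :: 'i \<Rightarrow> 'i \<Rightarrow> real. \<forall>i\<in>I. \<forall>j\<in>I. (\<Sum>m\<in>I. v i m * v j m) = S i j"
  using assms
proof (induction I arbitrary: S rule: finite_induct)
  case empty
  then show ?case by simp
next
  case (insert x I)
  have form: "(\<Sum>i\<in>insert x I. \<Sum>j\<in>insert x I. c i * c j * S i j)
      = (\<Sum>i\<in>I. \<Sum>j\<in>I. c i * c j * S i j) + 2 * c x * (\<Sum>i\<in>I. c i * S i x) + (c x)\<^sup>2 * S x x" for c
  proof -
    have "(\<Sum>j\<in>I. c x * c j * S x j) = c x * (\<Sum>i\<in>I. c i * S i x)"
      unfolding sum_distrib_left using insert.prems(1) by (intro sum.cong) auto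
    moreover have "(\<Sum>i\<in>I. c i * c x * S i x) = c x * (\<Sum>i\<in>I. c i * S i x)"
      unfolding sum_distrib_left by (intro sum.cong) auto
    ultimately show ?thesis
      using insert.hyps by (simp add: sum.distrib power2_eq_square)
  qed
  have Sxx: "0 \<le> S x x"
  proof -
    let ?c = "\<lambda>i. if i = x then 1 else (0::real)"
    have "(\<Sum>i\<in>I. \<Sum>j\<in>I. ?c i * ?c j * S i j) = 0" "(\<Sum>i\<in>I. ?c i * S i x) = 0"
      using insert.hyps by (auto intro!: sum.neutral)
    then show ?thesis
      using insert.prems(2)[of ?c] unfolding form by simp
  qed
  define q where "q i = S i x / sqrt (S x x)" for i
  have q: "S i x = q i * sqrt (S x x)" if "i \<in> I" for i
  proof (cases "S x x = 0")
    case True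
    have "0 \<le> S i i + 2 * t * S i x" for t
    proof -
      let ?c = "\<lambda>j. if j = x then t else if j = i then 1 else (0::real)"
      have "(\<Sum>a\<in>I. \<Sum>b\<in>I. ?c a * ?c b * S a b) = (\<Sum>a\<in>I. if a = i then \<Sum>b\<in>I. if b = i then S i i else 0 else 0)"
      proof (intro sum.cong refl)
        fix a assume "a \<in> I"
        have "?c b = (if b = i then 1 else 0)" if "b \<in> I" for b
          using that insert.hyps by auto
        with \<open>a \<in> I\<close> show "(\<Sum>b\<in>I. ?c a * ?c b * S a b) = (if a = i then \<Sum>b\<in>I. if b = i then S i i else 0 else 0)"
          by (auto intro!: sum.cong sum.neutral)
      qed
      also have "\<dots> = S i i" using that insert.hyps by simp
      finally have 1: "(\<Sum>a\<in>I. \<Sum>b\<in>I. ?c a * ?c b * S a b) = S i i" .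
      have "(\<Sum>a\<in>I. ?c a * S a x) = (\<Sum>a\<in>I. if a = i then S i x else 0)"
        using insert.hyps by (intro sum.cong refl) auto
      also have "\<dots> = S i x" using that insert.hyps by simp
      finally show ?thesis
        using insert.prems(2)[of ?c] 1 unfolding form by (simp add: True)
    qed
    \<comment> \<open>If \<open>S i x\<close> were nonzero, this \<open>t\<close> would turn the
      nonnegative expression into -1.\<close>
    from this[of "- (S i i + 1) / (2 * S i x)"] have "S i x = 0"
      by (cases "S i x = 0") (auto simp: field_simps)
    then show ?thesis by (simp add: True)
  next
    case False
    then show ?thesis by (simp add: q_def)
  qed
  have "\<exists>v :: 'i \<Rightarrow> 'i \<Rightarrow> real. \<forall>i\<in>I. \<forall>j\<in>I. (\<Sum>m\<in>I. v i m * v j m) = S i j - q i * q j"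
  proof (rule insert.IH)
    fix c :: "'i \<Rightarrow> real"
    define t where "t = (\<Sum>i\<in>I. c i * q i)"
    have "(\<Sum>i\<in>I. c i * S i x) = sqrt (S x x) * t"
      unfolding t_def sum_distrib_left by (intro sum.cong) (auto simp: q)
    moreover have "(\<Sum>i\<in>I. \<Sum>j\<in>I. c i * c j * (S i j - q i * q j)) = (\<Sum>i\<in>I. \<Sum>j\<in>I. c i * c j * S i j) - t * t"
      unfolding t_def sum_product by (simp add: algebra_simps sum_subtractf)
    moreover have "t * t \<le> (\<Sum>i\<in>I. \<Sum>j\<in>I. c i * c j * S i j)"
    proof -
      \<comment> \<open>For a positive pivot this coordinate at \<open>x\<close> minimizes the
        quadratic form with the others held fixed; the minimum is the form of the Schur
        complement.\<close>
      let ?c = "c(x := - t / sqrt (S x x))"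
      have "0 \<le> (\<Sum>i\<in>I. \<Sum>j\<in>I. c i * c j * S i j) + 2 * ?c x * (\<Sum>i\<in>I. c i * S i x) + (?c x)\<^sup>2 * S x x"
      proof -
        have "(\<Sum>i\<in>I. \<Sum>j\<in>I. ?c i * ?c j * S i j) = (\<Sum>i\<in>I. \<Sum>j\<in>I. c i * c j * S i j)"
          using insert.hyps by (intro sum.cong refl) auto
        moreover have "(\<Sum>i\<in>I. ?c i * S i x) = (\<Sum>i\<in>I. c i * S i x)"
          using insert.hyps by (intro sum.cong refl) auto
        ultimately show ?thesis
          using insert.prems(2)[of ?c] unfolding form by simp
      qed
      then have "0 \<le> (\<Sum>i\<in>I. \<Sum>j\<in>I. c i * c j * S i j) + 2 * ?c x * (sqrt (S x x) * t) + (?c x)\<^sup>2 * S x x"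
        using calculation(1) by simp
      moreover have "t = 0" if "S x x = 0"
        unfolding t_def q_def using that by simp
      ultimately show ?thesis
        using Sxx by (cases "S x x = 0") (auto simp: power2_eq_square)
    qed
    ultimately show "0 \<le> (\<Sum>i\<in>I. \<Sum>j\<in>I. c i * c j * (S i j - q i * q j))" by simp
  qed (use insert.prems(1) in auto)
  then obtain v :: "'i \<Rightarrow> 'i \<Rightarrow> real"
    where v: "\<And>i j. i \<in> I \<Longrightarrow> j \<in> I \<Longrightarrow> (\<Sum>m\<in>I. v i m * v j m) = S i j - q i * q j" by blast
  define w where "w i m = (if i = x then (if m = x then sqrt (S x x) else 0) else if m = x then q i else v i m)"
    for i m
  have [simp]: "x \<notin> I" "finite I" using insert.hyps by auto
  have ne: "i \<noteq> x" if "i \<in> I" for i using that by auto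
  have "(\<Sum>m\<in>insert x I. w i m * w j m) = S i j" if ij: "i \<in> insert x I" "j \<in> insert x I" for i j
  proof -
    have sum_I: "(\<Sum>m\<in>I. w i m * w j m) = (if i = x \<or> j = x then 0 else (\<Sum>m\<in>I. v i m * v j m))"
      by (auto simp: w_def ne intro!: sum.cong sum.neutral)
    have "S x j = S j x" using ij insert.prems(1)[of x j] by simp
    have sum_insert: "(\<Sum>m\<in>insert x I. w i m * w j m) = w i x * w j x + (\<Sum>m\<in>I. w i m * w j m)"
      by simp
    consider "i = x" "j = x" | "i = x" "j \<in> I" | "i \<in> I" "j = x" | "i \<in> I" "j \<in> I"
      using ij by blast
    then show ?thesis
    proof cases
      case 1
      then show ?thesis unfolding sum_insert sum_I using Sxx by (simp add: w_def)
    next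
      case 2
      then show ?thesis unfolding sum_insert sum_I
        using q[of j] \<open>S x j = S j x\<close> ne[of j] by (simp add: w_def)
    next
      case 3
      then show ?thesis unfolding sum_insert sum_I
        using q[of i] ne[of i] by (simp add: w_def)
    next
      case 4
      then show ?thesis unfolding sum_insert sum_I
        using ne[of i] ne[of j] v[of i j] by (simp add: w_def)
    qed
  qed
  then show ?case by blast
qed

definition psd :: "real ^ 'n ^ 'n \<Rightarrow> bool" where
  "psd A \<longleftrightarrow> transpose A = A \<and> (\<forall>x. 0 \<le> x \<bullet> (A *v x))"

lemma quad_form_sum:
  fixes A :: "real ^ 'n ^ 'n"
  shows "x \<bullet> (A *v x) = (\<Sum>i\<in>UNIV. \<Sum>j\<in>UNIV. x $ i * x $ j * A $ i $ j)"
  by (simp add: inner_vec_def matrix_vector_mult_def sum_distrib_left mult_ac)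

lemma psd_gram:
  fixes S :: "real ^ 'n ^ 'n"
  assumes "psd S"
  obtains C :: "real ^ 'n ^ 'n" where "transpose C ** C = S"
proof -
  have "0 \<le> (\<Sum>i\<in>UNIV. \<Sum>j\<in>UNIV. c i * c j * S $ i $ j)" for c
  proof -
    have "0 \<le> (\<chi> i. c i) \<bullet> (S *v (\<chi> i. c i))" using assms by (simp add: psd_def)
    then show ?thesis by (simp add: quad_form_sum)
  qed
  moreover have "S $ i $ j = S $ j $ i" for i j
  proof -
    have "S $ i $ j = transpose S $ j $ i" by (simp add: transpose_def)
    then show ?thesis using assms by (simp add: psd_def)
  qed
  ultimately obtain v :: "'n \<Rightarrow> 'n \<Rightarrow> real" where v: "\<And>i j. (\<Sum>m\<in>UNIV. v i m * v j m) = S $ i $ j"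
    using gram_exists_on[of UNIV "\<lambda>i j. S $ i $ j"] by auto
  have "transpose (\<chi> m i. v i m) ** (\<chi> m i. v i m) = S"
    by (simp add: vec_eq_iff matrix_matrix_mult_def transpose_def v)
  then show ?thesis by (rule that)
qed

text \<open>For a Gram factor \<open>C\<close> the form is the squared length of
  \<open>C *v x\<close>.\<close>

lemma psd_kernel:
  fixes S :: "real ^ 'n ^ 'n"
  assumes "psd S" "x \<bullet> (S *v x) = 0"
  shows "S *v x = 0"
proof -
  obtain C :: "real ^ 'n ^ 'n" where C: "transpose C ** C = S" by (rule psd_gram[OF assms(1)]) blast
  have "x \<bullet> (S *v x) = (C *v x) \<bullet> (C *v x)"
    unfolding C[symmetric] by (metis dot_lmul_matrix matrix_vector_mul_assoc vector_transpose_matrix transpose_transpose)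
  then have "C *v x = 0" using assms(2) by simp
  then show ?thesis
    unfolding C[symmetric] by (metis matrix_vector_mul_assoc matrix_vector_mult_0_right)
qed

lemma sym_pos_def_iff: "sym_pos_def A \<longleftrightarrow> psd A \<and> invertible A"
proof
  assume A: "sym_pos_def A"
  then have "psd A"
    unfolding sym_pos_def_def psd_def by (metis inner_zero_left less_eq_real_def)
  moreover have "A *v x = 0 \<Longrightarrow> x = 0" for x
    using A unfolding sym_pos_def_def by (metis inner_zero_right less_irrefl)
  then have "invertible A"
    using matrix_left_invertible_ker invertible_left_inverse by blast
  ultimately show "psd A \<and> invertible A" by simp
next
  assume A: "psd A \<and> invertible A"
  then have "x \<bullet> (A *v x) \<noteq> 0" if "x \<noteq> 0" for x
    using psd_kernel[of A x] that matrix_left_invertible_ker[of A] invertible_left_inverse[of A] by auto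
  then show "sym_pos_def A"
    using A unfolding sym_pos_def_def psd_def by (metis order_le_less)
qed

section \<open>Orthogonal matrices, plane rotations, reflections and the polar factor\<close>

lemma orthogonal_matrix_rows:
  fixes U :: "real ^ 'n ^ 'n"
  shows "orthogonal_matrix U \<longleftrightarrow> (\<forall>i j. U $ i \<bullet> U $ j = (if i = j then 1 else 0))"
  unfolding orthogonal_matrix_orthonormal_rows
  by (auto simp: row_def orthogonal_def norm_eq_1 vec_nth_inverse)

lemma orthogonal_matrix_columns:
  fixes U :: "real ^ 'n ^ 'n"
  shows "orthogonal_matrix U \<Longrightarrow> (\<Sum>k\<in>UNIV. U $ k $ i * U $ k $ j) = (if i = j then 1 else 0)"
  unfolding orthogonal_matrix
  by (auto simp: matrix_matrix_mult_def transpose_def mat_def vec_eq_iff)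

lemma compact_orthogonal_matrices: "compact (Collect (orthogonal_matrix :: real ^ 'n ^ 'n \<Rightarrow> bool))"
proof -
  have "Collect (orthogonal_matrix :: real ^ 'n ^ 'n \<Rightarrow> bool)
      = (\<Inter>i. \<Inter>j. {U. U $ i \<bullet> U $ j = (if i = j then 1 else 0)})"
    by (auto simp: orthogonal_matrix_rows)
  moreover have "closed {U :: real ^ 'n ^ 'n. U $ i \<bullet> U $ j = (if i = j then 1 else 0)}" for i j
    by (intro closed_Collect_eq continuous_intros)
  ultimately have "closed (Collect (orthogonal_matrix :: real ^ 'n ^ 'n \<Rightarrow> bool))"
    by (simp add: closed_INT)
  moreover have "norm U \<le> sqrt (real CARD('n))" if "orthogonal_matrix U" for U :: "real ^ 'n ^ 'n"
  proof -
    have "(norm U)\<^sup>2 = real CARD('n)"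
      using that by (simp add: power2_norm_eq_inner inner_vec_def[of U U] orthogonal_matrix_rows)
    then show ?thesis by (simp add: real_le_rsqrt)
  qed
  then have "bounded (Collect (orthogonal_matrix :: real ^ 'n ^ 'n \<Rightarrow> bool))"
    by (auto simp: bounded_iff)
  ultimately show ?thesis by (simp add: compact_eq_bounded_closed)
qed

text \<open>A plane rotation acting from the left. At \<open>t = 0\<close> row \<open>k\<close>
  moves in the direction of row \<open>l\<close>, and row \<open>l\<close> in the direction of minus
  row \<open>k\<close>. Since it acts on rows, it commutes with multiplication from the right, in
  particular with whitening.\<close>

definition rotate_rows :: "'n \<Rightarrow> 'n \<Rightarrow> real \<Rightarrow> real ^ 'n ^ 'n \<Rightarrow> real ^ 'n ^ 'n" where
  "rotate_rows k l t U = (\<chi> j. if j = k then cos t *\<^sub>R U $ k + sin t *\<^sub>R U $ l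
                    else if j = l then cos t *\<^sub>R U $ l - sin t *\<^sub>R U $ k else U $ j)"

lemma orthogonal_rotate_rows:
  assumes "orthogonal_matrix U" "k \<noteq> l"
  shows "orthogonal_matrix (rotate_rows k l t U)"
proof -
  have [simp]: "cos t * cos t + sin t * sin t = 1"
    using sin_cos_squared_add[of t] by (simp add: power2_eq_square)
  have "U $ i \<bullet> U $ j = (if i = j then 1 else 0)" for i j
    using assms(1) by (simp add: orthogonal_matrix_rows)
  then show ?thesis
    unfolding orthogonal_matrix_rows using assms(2)
    by (auto simp: rotate_rows_def inner_add_left inner_add_right inner_diff_left inner_diff_right algebra_simps)
qed

lemma vec_mult_matrix_nth: "((A ** B) :: real ^ 'm ^ 'n) $ i = (\<Sum>a\<in>UNIV. A $ i $ a *\<^sub>R B $ a)"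
  by (simp add: matrix_matrix_mult_def vec_eq_iff)

lemma rotate_rows_mult: "k \<noteq> l \<Longrightarrow> rotate_rows k l t U ** B = rotate_rows k l t (U ** B)"
  by (subst vec_eq_iff)
    (auto simp: rotate_rows_def vec_mult_matrix_nth scaleR_sum_right scaleR_left_distrib scaleR_left_diff_distrib
      sum.distrib sum_subtractf)

definition reflection :: "real ^ 'n \<Rightarrow> real ^ 'n ^ 'n" where
  "reflection v = (\<chi> i j. (if i = j then 1 else 0) - 2 * v $ i * v $ j / (v \<bullet> v))"

lemma orthogonal_reflection:
  assumes "v \<noteq> 0"
  shows "orthogonal_matrix (reflection v)"
proof -
  have v: "v \<bullet> v \<noteq> 0" using assms by simp
  have "reflection v $ i \<bullet> reflection v $ j = (if i = j then 1 else 0)" for i j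
  proof -
    have "reflection v $ i = axis i 1 - (2 * v $ i / (v \<bullet> v)) *\<^sub>R v" for i
      by (simp add: reflection_def vec_eq_iff axis_def)
    then have "reflection v $ i \<bullet> reflection v $ j = (axis i 1 - (2 * v $ i / (v \<bullet> v)) *\<^sub>R v) \<bullet> (axis j 1 - (2 * v $ j / (v \<bullet> v)) *\<^sub>R v)"
      by simp
    also have "\<dots> = (if i = j then 1 else 0)"
      using v by (simp add: inner_diff_left inner_diff_right inner_axis inner_axis' )
        (auto simp: axis_def field_simps)
    finally show ?thesis .
  qed
  then show ?thesis by (simp add: orthogonal_matrix_rows)
qed

text \<open>The orthogonal factor maximizes the trace of \<open>U ** C\<close>: rotations
  give symmetry of the product and reflections give semidefiniteness.\<close>

lemma polar_decomposition:
  fixes C :: "real ^ 'n ^ 'n"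
  obtains U where "orthogonal_matrix U" "psd (U ** C)"
proof -
  have "continuous_on (Collect orthogonal_matrix) (\<lambda>U. trace (U ** C))"
    unfolding trace_def matrix_matrix_mult_def by (auto intro!: continuous_intros)
  then obtain U where U: "orthogonal_matrix U"
    and max: "\<And>V. orthogonal_matrix V \<Longrightarrow> trace (V ** C) \<le> trace (U ** C)"
    using continuous_attains_sup[OF compact_orthogonal_matrices, of "\<lambda>U. trace (U ** C)"] orthogonal_matrix_id
    by blast
  define A where "A = U ** C"
  have "A $ k $ l = A $ l $ k" for k l
  proof (cases "k = l")
    case False
    define g where "g t = trace (rotate_rows k l t A)" for t
    have g: "g t = cos t * (A $ k $ k + A $ l $ l) + sin t * (A $ l $ k - A $ k $ l)
        + (\<Sum>j\<in>UNIV - {k,l}. A $ j $ j)" for t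
    proof -
      have "g t = (\<Sum>j\<in>{k,l}. rotate_rows k l t A $ j $ j) + (\<Sum>j\<in>UNIV - {k,l}. rotate_rows k l t A $ j $ j)"
        unfolding g_def trace_def by (simp add: sum.subset_diff[of "{k,l}" UNIV] add.commute)
      also have "(\<Sum>j\<in>UNIV - {k,l}. rotate_rows k l t A $ j $ j) = (\<Sum>j\<in>UNIV - {k,l}. A $ j $ j)"
        by (intro sum.cong) (auto simp: rotate_rows_def)
      finally show ?thesis
        using False by (simp add: rotate_rows_def algebra_simps)
    qed
    have "(g has_real_derivative (A $ l $ k - A $ k $ l)) (at 0)"
      unfolding g by (auto intro!: derivative_eq_intros)
    moreover have "g t \<le> g 0" for t
    proof -
      have "rotate_rows k l 0 A = A" by (simp add: rotate_rows_def vec_eq_iff)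
      moreover have "trace (rotate_rows k l t A) \<le> trace A"
        using max[OF orthogonal_rotate_rows[OF U False, of t]] by (simp add: rotate_rows_mult[OF False] A_def)
      ultimately show ?thesis by (simp add: g_def)
    qed
    ultimately have "A $ l $ k - A $ k $ l = 0"
      by (intro DERIV_local_max[of g _ 0 1]) auto
    then show ?thesis by simp
  qed simp
  then have "transpose A = A" by (simp add: transpose_def vec_eq_iff)
  moreover have "0 \<le> v \<bullet> (A *v v)" for v
  proof (cases "v = 0")
    case False
    have "trace (reflection v ** A) = trace A - 2 * (v \<bullet> (A *v v)) / (v \<bullet> v)"
    proof -
      have "trace (reflection v ** A) = (\<Sum>i\<in>UNIV. \<Sum>j\<in>UNIV. (if i = j then A $ j $ i else 0) - 2 * v $ i * v $ j / (v \<bullet> v) * A $ j $ i)"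
        by (auto simp: trace_def matrix_matrix_mult_def reflection_def left_diff_distrib intro!: sum.cong)
      also have "\<dots> = trace A - (\<Sum>i\<in>UNIV. \<Sum>j\<in>UNIV. 2 * v $ i * v $ j / (v \<bullet> v) * A $ j $ i)"
        by (simp add: trace_def sum_subtractf)
      also have "(\<Sum>i\<in>UNIV. \<Sum>j\<in>UNIV. 2 * v $ i * v $ j / (v \<bullet> v) * A $ j $ i) = 2 * (v \<bullet> (A *v v)) / (v \<bullet> v)"
        unfolding quad_form_sum sum_distrib_left sum_divide_distrib
        by (subst sum.swap) (simp add: mult_ac)
      finally show ?thesis .
    qed
    moreover have "trace (reflection v ** A) \<le> trace A"
      using max[OF orthogonal_matrix_mul[OF orthogonal_reflection[OF False] U]]
      by (simp add: A_def matrix_mul_assoc)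
    moreover have "0 < v \<bullet> v" using False by simp
    ultimately show ?thesis by (simp add: zero_le_divide_iff)
  qed simp
  ultimately have "psd A" by (simp add: psd_def)
  then show ?thesis using that U A_def by blast
qed

text \<open>A Gram factor \<open>C\<close> of \<open>S\<close> becomes semidefinite when multiplied
  by its polar factor \<open>U\<close>, and \<open>U\<close> cancels in
  \<open>transpose (U ** C) ** (U ** C)\<close>. This replaces diagonalization.\<close>

lemma psd_sqrt:
  fixes S :: "real ^ 'n ^ 'n"
  assumes "psd S"
  obtains R where "psd R" "R ** R = S"
proof -
  obtain C :: "real ^ 'n ^ 'n" where C: "transpose C ** C = S" by (rule psd_gram[OF assms]) blast
  obtain U where U: "orthogonal_matrix U" "psd (U ** C)" using polar_decomposition by blast
  have "(U ** C) ** (U ** C) = transpose (U ** C) ** (U ** C)" using U(2) by (simp add: psd_def)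
  also have "\<dots> = transpose C ** (transpose U ** U) ** C"
    by (simp add: matrix_transpose_mul matrix_mul_assoc)
  also have "\<dots> = S" using U(1) C by (simp add: orthogonal_matrix)
  finally show ?thesis using that U(2) by blast
qed

lemma matrix_inv_mult:
  fixes A :: "real ^ 'n ^ 'n"
  assumes "invertible A"
  shows "A ** matrix_inv A = mat 1" "matrix_inv A ** A = mat 1"
proof -
  obtain B where "A ** B = mat 1 \<and> B ** A = mat 1" using assms unfolding invertible_def by blast
  then have "A ** matrix_inv A = mat 1 \<and> matrix_inv A ** A = mat 1"
    unfolding matrix_inv_def by (rule someI)
  then show "A ** matrix_inv A = mat 1" "matrix_inv A ** A = mat 1" by auto
qed

lemma transpose_matrix_inv:
  fixes A :: "real ^ 'n ^ 'n"
  assumes "invertible A"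
  shows "transpose (matrix_inv A) = matrix_inv (transpose A)"
proof -
  have t: "invertible (transpose A)" using assms by (simp add: invertible_det_nz det_transpose)
  have "transpose (matrix_inv A) ** transpose A = mat 1"
    using matrix_inv_mult(1)[OF assms] by (metis matrix_transpose_mul transpose_mat)
  then have "transpose (matrix_inv A) ** (transpose A ** matrix_inv (transpose A)) = matrix_inv (transpose A)"
    by (simp add: matrix_mul_assoc)
  then show ?thesis by (simp add: matrix_inv_mult(1)[OF t])
qed

lemma sym_pos_def_matrix_inv:
  fixes S :: "real ^ 'n ^ 'n"
  assumes "sym_pos_def S"
  shows "sym_pos_def (matrix_inv S)"
proof -
  have S: "psd S" "invertible S" using assms by (auto simp: sym_pos_def_iff)
  have "transpose (matrix_inv S) = matrix_inv S"
    using transpose_matrix_inv[OF S(2)] S(1) by (simp add: psd_def)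
  moreover have "0 \<le> x \<bullet> (matrix_inv S *v x)" for x
  proof -
    have "x = S *v (matrix_inv S *v x)"
      by (simp add: matrix_vector_mul_assoc matrix_inv_mult[OF S(2)])
    then have "x \<bullet> (matrix_inv S *v x) = (matrix_inv S *v x) \<bullet> (S *v (matrix_inv S *v x))"
      by (metis inner_commute)
    then show ?thesis using S(1) by (simp add: psd_def)
  qed
  moreover have "invertible (matrix_inv S)"
    using matrix_inv_mult[OF S(2)] unfolding invertible_def by blast
  ultimately show ?thesis by (simp add: sym_pos_def_iff psd_def)
qed

lemma inner_matrix_mult_left:
  fixes D R :: "real ^ 'n ^ 'n"
  shows "D \<bullet> (R ** D) = (\<Sum>j\<in>UNIV. column j D \<bullet> (R *v column j D))"
  unfolding inner_vec_def matrix_matrix_mult_def matrix_vector_mult_def column_def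
  by (simp, subst sum.swap) (rule refl)

lemma inner_matrix_mult_right:
  fixes D R :: "real ^ 'n ^ 'n"
  shows "D \<bullet> (D ** R) = (\<Sum>i\<in>UNIV. (transpose R *v (D $ i)) \<bullet> D $ i)"
  unfolding inner_vec_def matrix_matrix_mult_def matrix_vector_mult_def transpose_def
  by (simp add: mult_ac)

text \<open>With \<open>D = R - R'\<close> one has \<open>R ** D + D ** R' = R ** R - R' ** R'\<close>; pair this with \<open>D\<close>.\<close>

lemma psd_sqrt_dist:
  fixes R R' :: "real ^ 'n ^ 'n"
  assumes R: "\<And>x. c * (x \<bullet> x) \<le> x \<bullet> (R *v x)" and R': "psd R'"
  shows "c * norm (R - R') \<le> norm (R ** R - R' ** R')"
proof -
  define D where "D = R - R'"
  have "c * (D \<bullet> D) = (\<Sum>j\<in>UNIV. c * (column j D \<bullet> column j D))"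
    unfolding inner_vec_def column_def sum_distrib_left by (simp, subst sum.swap) (rule refl)
  also have "\<dots> \<le> D \<bullet> (R ** D)"
    unfolding inner_matrix_mult_left by (intro sum_mono R)
  also have "\<dots> \<le> D \<bullet> (R ** D) + D \<bullet> (D ** R')"
    using R' unfolding inner_matrix_mult_right psd_def
    by (simp add: sum_nonneg inner_commute)
  also have "\<dots> = D \<bullet> (R ** R - R' ** R')"
  proof -
    have "R ** D + D ** R' = R ** R - R' ** R'"
      unfolding D_def
      by (simp add: vec_eq_iff matrix_matrix_mult_def algebra_simps sum_subtractf sum.distrib)
    then show ?thesis by (metis inner_add_right)
  qed
  also have "\<dots> \<le> norm D * norm (R ** R - R' ** R')"
    by (rule norm_cauchy_schwarz)
  finally have "norm D * (c * norm D) \<le> norm D * norm (R ** R - R' ** R')"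
    by (simp add: power2_norm_eq_inner[symmetric] power2_eq_square mult_ac)
  then show ?thesis
    unfolding D_def[symmetric] by (cases "norm D = 0") (simp_all add: mult_le_cancel_left)
qed

text \<open>The constant is the smallest eigenvalue, found as the minimum of the form on the compact
  unit sphere.\<close>

lemma sym_pos_def_bound:
  fixes R :: "real ^ 'n ^ 'n"
  assumes "sym_pos_def R"
  obtains c where "c > 0" "\<And>x. c * (x \<bullet> x) \<le> x \<bullet> (R *v x)"
proof -
  have "continuous_on (sphere 0 1) (\<lambda>x. x \<bullet> (R *v x))"
    unfolding quad_form_sum by (intro continuous_intros)
  moreover have "(sphere 0 1 :: (real ^ 'n) set) \<noteq> {}" by simp
  ultimately obtain y where y: "norm y = 1" and min: "\<And>x. norm x = 1 \<Longrightarrow> y \<bullet> (R *v y) \<le> x \<bullet> (R *v x)"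
    using continuous_attains_inf[of "sphere 0 1 :: (real ^ 'n) set" "\<lambda>x. x \<bullet> (R *v x)"] by auto
  have "y \<bullet> (R *v y) > 0" using assms y unfolding sym_pos_def_def by (metis norm_zero zero_neq_one)
  moreover have "(y \<bullet> (R *v y)) * (x \<bullet> x) \<le> x \<bullet> (R *v x)" for x
  proof (cases "x = 0")
    case False
    have "y \<bullet> (R *v y) \<le> (x /\<^sub>R norm x) \<bullet> (R *v (x /\<^sub>R norm x))"
      using False by (intro min) simp
    also have "\<dots> = (x \<bullet> (R *v x)) / (x \<bullet> x)"
      by (simp add: matrix_vector_mult_scaleR power2_norm_eq_inner[symmetric] power2_eq_square divide_inverse mult_ac)
    finally show ?thesis using False by (simp add: field_simps)
  qed simp
  ultimately show ?thesis by (rule that)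
qed

lemma
  fixes S :: "real ^ 'n ^ 'n"
  assumes "sym_pos_def S"
  shows sym_pos_def_inv_sqrt: "sym_pos_def (inv_sqrt S)"
    and inv_sqrt_square: "inv_sqrt S ** inv_sqrt S = matrix_inv S"
proof -
  have inv: "sym_pos_def (matrix_inv S)" by (rule sym_pos_def_matrix_inv[OF assms])
  then obtain R where R: "psd R" "R ** R = matrix_inv S"
    using psd_sqrt[of "matrix_inv S"] by (auto simp: sym_pos_def_iff)
  have "invertible R"
  proof -
    obtain B where "(R ** R) ** B = mat 1"
      using inv unfolding R(2) sym_pos_def_iff invertible_def by blast
    then have "R ** (R ** B) = mat 1" by (simp add: matrix_mul_assoc)
    then show ?thesis using invertible_right_inverse by blast
  qed
  with R have "sym_pos_def R \<and> R ** R = matrix_inv S" by (simp add: sym_pos_def_iff)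
  \<comment> \<open>Uniqueness is the case of equal squares in \<open>psd_sqrt_dist\<close>; the
    same estimate gives continuity below.\<close>
  moreover have "R1 = R2" if R12: "sym_pos_def R1 \<and> R1 ** R1 = matrix_inv S" "sym_pos_def R2 \<and> R2 ** R2 = matrix_inv S" for R1 R2
  proof -
    obtain c where c: "c > 0" "\<And>x. c * (x \<bullet> x) \<le> x \<bullet> (R1 *v x)"
      using sym_pos_def_bound[OF conjunct1[OF R12(1)]] by blast
    have "c * norm (R1 - R2) \<le> norm (R1 ** R1 - R2 ** R2)"
      using R12 c(2) by (intro psd_sqrt_dist) (auto simp: sym_pos_def_iff)
    then have "norm (R1 - R2) \<le> 0" using R12 c(1) by (simp add: mult_le_0_iff)
    then show ?thesis by simp
  qed
  ultimately have "\<exists>!R. sym_pos_def R \<and> R ** R = matrix_inv S" by blast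
  from theI'[OF this] show "sym_pos_def (inv_sqrt S)" "inv_sqrt S ** inv_sqrt S = matrix_inv S"
    unfolding inv_sqrt_def by auto
qed

lemma inv_sqrt_whitens:
  fixes S :: "real ^ 'n ^ 'n"
  assumes "sym_pos_def S"
  shows "inv_sqrt S ** S ** inv_sqrt S = mat 1"
proof -
  let ?R = "inv_sqrt S"
  have S: "invertible S" using assms by (simp add: sym_pos_def_iff)
  \<comment> \<open>One-sided inverses of square matrices are two-sided, so the factors
    \<open>?R\<close> and \<open>?R ** S\<close> may be exchanged.\<close>
  have "?R ** (?R ** S) = mat 1"
    using inv_sqrt_square[OF assms] matrix_inv_mult(2)[OF S] by (simp add: matrix_mul_assoc)
  then show ?thesis by (simp add: matrix_left_right_inverse)
qed

section \<open>Continuity and measurability of the inverse square root\<close>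

lemma continuous_on_det:
  "continuous_on UNIV (det :: real ^ 'n ^ 'n \<Rightarrow> real)"
  unfolding det_def by (intro continuous_intros)

text \<open>Cramer's rule exhibits the entries of the inverse as quotients of polynomials, from
  which continuity is read off.\<close>

lemma matrix_inv_cramer:
  fixes A :: "real ^ 'n ^ 'n"
  assumes "invertible A"
  shows "matrix_inv A $ k $ l = det (\<chi> i j. if j = k then axis l 1 $ i else A $ i $ j) / det A"
proof -
  have "A *v (matrix_inv A *v axis l 1) = axis l 1"
    by (simp add: matrix_vector_mul_assoc matrix_inv_mult[OF assms])
  then have "matrix_inv A *v axis l 1 = (\<chi> k. det (\<chi> i j. if j = k then axis l 1 $ i else A $ i $ j) / det A)"
    using assms by (subst (asm) cramer) (simp_all add: invertible_det_nz)
  moreover have "matrix_inv A $ k $ l = (matrix_inv A *v axis l 1) $ k"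
    by (simp add: matrix_vector_mul_component inner_axis)
  ultimately show ?thesis by simp
qed

lemma continuous_on_matrix_inv:
  "continuous_on {A :: real ^ 'n ^ 'n. invertible A} matrix_inv"
proof -
  have "continuous_on {A :: real ^ 'n ^ 'n. invertible A}
      (\<lambda>A. \<chi> k l. det (\<chi> i j. if j = k then axis l 1 $ i else A $ i $ j) / det A)"
    unfolding det_def
  proof (intro continuous_on_vec_lambda continuous_on_divide continuous_on_sum continuous_on_mult
      continuous_on_prod continuous_on_const ballI)
    fix k l :: 'n and p :: "'n \<Rightarrow> 'n" and i :: 'n
    have "continuous_on {A. invertible A} (\<lambda>A :: real ^ 'n ^ 'n. if p i = k then axis l 1 $ i else A $ i $ p i)"
      by (cases "p i = k") (auto intro!: continuous_intros)
    then show "continuous_on {A. invertible A} (\<lambda>x :: real ^ 'n ^ 'n. (\<chi> i j. if j = k then axis l 1 $ i else x $ i $ j) $ i $ p i)"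
      by simp
  qed (auto simp: det_def[symmetric] invertible_det_nz intro!: continuous_intros)
  moreover have "matrix_inv A = (\<chi> k l. det (\<chi> i j. if j = k then axis l 1 $ i else A $ i $ j) / det A)"
    if "invertible A" for A :: "real ^ 'n ^ 'n"
    using that by (simp add: vec_eq_iff matrix_inv_cramer)
  ultimately show ?thesis by (subst continuous_on_cong[OF refl]) auto
qed

text \<open>By \<open>psd_sqrt_dist\<close> the distance of the roots is at most
  \<open>1 / c\<close> times the distance of the inverses. Only the root at the fixed point
  \<open>S\<close> has to be bounded below, so a single \<open>c\<close> serves every nearby
  \<open>T\<close>.\<close>

lemma continuous_on_inv_sqrt:
  "continuous_on {S :: real ^ 'n ^ 'n. sym_pos_def S} inv_sqrt"
  unfolding continuous_on_def
proof
  fix S :: "real ^ 'n ^ 'n" assume "S \<in> {S. sym_pos_def S}"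
  then have S: "sym_pos_def S" by simp
  obtain c where c: "c > 0" "\<And>x. c * (x \<bullet> x) \<le> x \<bullet> (inv_sqrt S *v x)"
    by (rule sym_pos_def_bound[OF sym_pos_def_inv_sqrt[OF S]]) blast
  let ?F = "at S within {S. sym_pos_def S}"
  have "(matrix_inv \<longlongrightarrow> matrix_inv S) (at S within {S. invertible S})"
    using continuous_on_matrix_inv S unfolding continuous_on_def by (auto simp: sym_pos_def_iff)
  then have "(matrix_inv \<longlongrightarrow> matrix_inv S) ?F"
    by (rule tendsto_within_subset) (auto simp: sym_pos_def_iff)
  then have "((\<lambda>T. norm (matrix_inv S - matrix_inv T) / c) \<longlongrightarrow> norm (matrix_inv S - matrix_inv S) / c) ?F"
    using c(1) by (intro tendsto_intros) auto
  then have lim: "((\<lambda>T. norm (matrix_inv S - matrix_inv T) / c) \<longlongrightarrow> 0) ?F" by simp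
  have "\<forall>\<^sub>F T in ?F. norm (inv_sqrt T - inv_sqrt S) \<le> norm (matrix_inv S - matrix_inv T) / c"
    unfolding eventually_at_filter
  proof (intro always_eventually allI impI)
    fix T :: "real ^ 'n ^ 'n" assume "T \<in> {S. sym_pos_def S}"
    then have T: "sym_pos_def T" by simp
    then have "psd (inv_sqrt T)" using sym_pos_def_inv_sqrt sym_pos_def_iff by blast
    with psd_sqrt_dist[of c "inv_sqrt S" "inv_sqrt T"] c(2) show "norm (inv_sqrt T - inv_sqrt S) \<le> norm (matrix_inv S - matrix_inv T) / c"
      using c(1) by (simp add: inv_sqrt_square[OF S] inv_sqrt_square[OF T] field_simps norm_minus_commute)
  qed
  then have "((\<lambda>T. inv_sqrt T - inv_sqrt S) \<longlongrightarrow> 0) ?F"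
    by (rule Lim_null_comparison[OF _ lim])
  then show "(inv_sqrt \<longlongrightarrow> inv_sqrt S) ?F" by (simp add: LIM_zero_iff)
qed

lemma inv_sqrt_mat_1: "inv_sqrt (mat 1 :: real ^ 'n ^ 'n) = mat 1"
proof -
  have 1: "sym_pos_def (mat 1 :: real ^ 'n ^ 'n)" by (simp add: sym_pos_def_def)
  then have "psd (inv_sqrt (mat 1 :: real ^ 'n ^ 'n))" using sym_pos_def_inv_sqrt sym_pos_def_iff by blast
  moreover have "matrix_inv (mat 1 :: real ^ 'n ^ 'n) = mat 1"
    using matrix_inv_mult(1)[of "mat 1 :: real ^ 'n ^ 'n"] 1 by (simp add: sym_pos_def_iff)
  ultimately show ?thesis
    using psd_sqrt_dist[of 1 "mat 1" "inv_sqrt (mat 1 :: real ^ 'n ^ 'n)"] inv_sqrt_square[OF 1] by simp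
qed

lemma borel_sym_pos_def: "{S :: real ^ 'n ^ 'n. sym_pos_def S} \<in> sets borel"
proof -
  have "{S :: real ^ 'n ^ 'n. sym_pos_def S}
      = ({S. transpose S = S} \<inter> (\<Inter>x. {S. 0 \<le> x \<bullet> (S *v x)})) \<inter> {S. det S \<noteq> 0}"
    by (auto simp: sym_pos_def_iff psd_def invertible_det_nz)
  moreover have "closed {S :: real ^ 'n ^ 'n. transpose S = S}"
    unfolding transpose_def by (intro closed_Collect_eq continuous_intros continuous_on_vec_lambda)
  moreover have "closed {S :: real ^ 'n ^ 'n. 0 \<le> x \<bullet> (S *v x)}" for x
    unfolding quad_form_sum by (intro closed_Collect_le continuous_intros)
  moreover have "open {S :: real ^ 'n ^ 'n. det S \<noteq> 0}"
    by (intro open_Collect_neq continuous_on_det continuous_intros)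
  ultimately show ?thesis
    by (metis (no_types, lifting) borel_closed borel_open closed_INT closed_Int sets.Int)
qed

lemma borel_measurable_inv_sqrt:
  "(\<lambda>S :: real ^ 'n ^ 'n. if sym_pos_def S then inv_sqrt S else mat 1) \<in> borel_measurable borel"
  using borel_measurable_continuous_on_if[of "{S :: real ^ 'n ^ 'n. sym_pos_def S}" inv_sqrt "\<lambda>_. mat 1"]
  by (simp add: borel_sym_pos_def continuous_on_inv_sqrt)

section \<open>Measurable selection of maximizers\<close>

text \<open>Measurability of a set-valued map, tested on closed sets. For singleton values it is
  ordinary Borel measurability, and it survives the passage to minimizers, which is how singletons
  are reached.\<close>

definition hit_measurable :: "'a measure \<Rightarrow> ('a \<Rightarrow> 'b::topological_space set) \<Rightarrow> bool" where
  "hit_measurable M S \<longleftrightarrow> (\<forall>C. closed C \<longrightarrow> {x \<in> space M. S x \<inter> C \<noteq> {}} \<in> sets M)"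

definition minimizers :: "('b \<Rightarrow> real) \<Rightarrow> 'b set \<Rightarrow> 'b set" where
  "minimizers f A = {u \<in> A. \<forall>v\<in>A. f u \<le> f v}"

lemma minimizers_subset: "minimizers f A \<subseteq> A"
  by (auto simp: minimizers_def)

lemma compact_minimizers:
  fixes A :: "'b::t2_space set"
  assumes "compact A" "continuous_on UNIV f"
  shows "compact (minimizers f A)"
proof -
  have "minimizers f A = A \<inter> (\<Inter>v\<in>A. {u. f u \<le> f v})" by (auto simp: minimizers_def)
  moreover have "closed {u. f u \<le> f v}" for v
    using assms(2) by (intro closed_Collect_le continuous_intros) auto
  ultimately show ?thesis using assms(1) by (auto intro!: compact_Int_closed closed_INT)
qed

lemma minimizers_nonempty:
  assumes "compact A" "A \<noteq> {}" "continuous_on UNIV f"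
  shows "minimizers f A \<noteq> {}"
  using continuous_attains_inf[of A f] assms continuous_on_subset[of UNIV f A]
  by (auto simp: minimizers_def)

text \<open>The minimizers over \<open>A\<close> miss a closed set \<open>C\<close> iff a rational separates the minimum
  over \<open>A\<close> from the values on \<open>A \<inter> C\<close>.\<close>

lemma hit_measurable_minimizers:
  fixes S :: "'a \<Rightarrow> 'b::t2_space set"
  assumes S: "hit_measurable M S" and cpt: "\<And>x. compact (S x)" and ne: "\<And>x. S x \<noteq> {}"
    and f: "continuous_on UNIV f"
  shows "hit_measurable M (\<lambda>x. minimizers f (S x))"
  unfolding hit_measurable_def
proof (intro allI impI)
  fix C :: "'b set" assume C: "closed C"
  have cl: "closed {u. f u \<le> q}" for q
    using f by (intro closed_Collect_le continuous_intros) auto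
  have eq: "minimizers f (S x) \<inter> C = {} \<longleftrightarrow>
      (\<exists>q\<in>\<rat>. S x \<inter> {u. f u \<le> q} \<noteq> {} \<and> S x \<inter> (C \<inter> {u. f u \<le> q}) = {})" for x
  proof
    assume emp: "minimizers f (S x) \<inter> C = {}"
    obtain m where m: "m \<in> S x" "\<And>v. v \<in> S x \<Longrightarrow> f m \<le> f v"
      using minimizers_nonempty[OF cpt[of x] ne[of x] f] by (auto simp: minimizers_def)
    show "\<exists>q\<in>\<rat>. S x \<inter> {u. f u \<le> q} \<noteq> {} \<and> S x \<inter> (C \<inter> {u. f u \<le> q}) = {}"
    proof (cases "S x \<inter> C = {}")
      case True
      obtain q where "q \<in> \<rat>" "f m < q" using Rats_dense_in_real[of "f m" "f m + 1"] by auto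
      then show ?thesis using True m(1) by (intro bexI[of _ q]) force+
    next
      case False
      have "compact (S x \<inter> C)" using cpt C by (rule compact_Int_closed)
      then obtain c where c: "c \<in> S x \<inter> C" "\<And>v. v \<in> S x \<inter> C \<Longrightarrow> f c \<le> f v"
        using minimizers_nonempty[of "S x \<inter> C", OF _ False f] by (auto simp: minimizers_def)
      have "f m < f c"
      proof (rule ccontr)
        assume "\<not> f m < f c"
        then have "c \<in> minimizers f (S x) \<inter> C" using c m by (force simp: minimizers_def)
        then show False using emp by simp
      qed
      then obtain q where "q \<in> \<rat>" "f m < q" "q < f c" using Rats_dense_in_real by blast
      then show ?thesis using c m(1) by (intro bexI[of _ q]) force+
    qed
  next
    assume "\<exists>q\<in>\<rat>. S x \<inter> {u. f u \<le> q} \<noteq> {} \<and> S x \<inter> (C \<inter> {u. f u \<le> q}) = {}"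
    then show "minimizers f (S x) \<inter> C = {}" by (force simp: minimizers_def)
  qed
  have "{x \<in> space M. minimizers f (S x) \<inter> C \<noteq> {}} = space M - (\<Union>q\<in>\<rat>. {x \<in> space M. S x \<inter> {u. f u \<le> q} \<noteq> {}}
      \<inter> (space M - {x \<in> space M. S x \<inter> (C \<inter> {u. f u \<le> q}) \<noteq> {}}))"
    by (rule set_eqI, simp only: mem_Collect_eq eq Diff_iff UN_iff Int_iff) metis
  moreover have "{x \<in> space M. S x \<inter> {u. f u \<le> q} \<noteq> {}} \<in> sets M"
    "{x \<in> space M. S x \<inter> (C \<inter> {u. f u \<le> q}) \<noteq> {}} \<in> sets M" for q
    using S C cl unfolding hit_measurable_def by blast+
  ultimately show "{x \<in> space M. minimizers f (S x) \<inter> C \<noteq> {}} \<in> sets M"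
    by (auto intro!: sets.Diff sets.countable_UN' sets.Int countable_rat)
qed

text \<open>The head of the list is minimized first. With all coordinate functions in the list only
  one point can remain.\<close>

definition lex_minimizers :: "('b \<Rightarrow> real) list \<Rightarrow> 'b set \<Rightarrow> 'b set" where
  "lex_minimizers fs A = fold minimizers fs A"

lemma lex_minimizers_props:
  fixes S :: "'a \<Rightarrow> 'b::t2_space set"
  assumes "hit_measurable M S" "\<And>x. compact (S x)" "\<And>x. S x \<noteq> {}" "\<forall>f\<in>set fs. continuous_on UNIV f"
  shows "hit_measurable M (\<lambda>x. lex_minimizers fs (S x)) \<and> (\<forall>x. lex_minimizers fs (S x) \<noteq> {})
    \<and> (\<forall>x. lex_minimizers fs (S x) \<subseteq> S x)"
  using assms
proof (induction fs arbitrary: S)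
  case Nil
  then show ?case by (simp add: lex_minimizers_def)
next
  case (Cons f fs)
  have "lex_minimizers (f # fs) (S x) = lex_minimizers fs (minimizers f (S x))" for x
    by (simp add: lex_minimizers_def)
  moreover have "hit_measurable M (\<lambda>x. lex_minimizers fs (minimizers f (S x))) \<and>
    (\<forall>x. lex_minimizers fs (minimizers f (S x)) \<noteq> {}) \<and>
    (\<forall>x. lex_minimizers fs (minimizers f (S x)) \<subseteq> minimizers f (S x))"
    using Cons.prems
    by (intro Cons.IH hit_measurable_minimizers compact_minimizers minimizers_nonempty) auto
  ultimately show ?case using minimizers_subset by fastforce
qed

text \<open>A function is constant on the set of its minimizers, and the later minimizations only
  shrink that set.\<close>

lemma lex_minimizers_agree:
  assumes "f \<in> set fs" "u \<in> lex_minimizers fs A" "v \<in> lex_minimizers fs A"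
  shows "f u = f v"
  using assms
proof (induction fs arbitrary: A)
  case (Cons g fs)
  have sub: "lex_minimizers fs B \<subseteq> B" for B
    unfolding lex_minimizers_def using minimizers_subset
    by (induction fs arbitrary: B) fastforce+
  have uv: "u \<in> lex_minimizers fs (minimizers g A)" "v \<in> lex_minimizers fs (minimizers g A)"
    using Cons.prems by (auto simp: lex_minimizers_def)
  show ?case
  proof (cases "f = g")
    case True
    have "u \<in> minimizers g A" "v \<in> minimizers g A" using uv sub by auto
    then show ?thesis unfolding True minimizers_def by (force intro: antisym)
  next
    case False
    then show ?thesis using Cons uv by auto
  qed
qed simp

text \<open>Ties among the minimizers of \<open>f\<close> are broken by minimizing the coordinates
  one after another. The set that remains is a singleton depending measurably on \<open>x\<close>,
  so naming its element involves no arbitrary choice.\<close>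

lemma measurable_selection_minimizer:
  fixes S :: "'a \<Rightarrow> 'b::euclidean_space set"
  assumes S: "hit_measurable M S" "\<And>x. compact (S x)" "\<And>x. S x \<noteq> {}" and f: "continuous_on UNIV f"
  obtains s where "s \<in> borel_measurable M" "\<And>x. s x \<in> minimizers f (S x)"
proof -
  obtain bs :: "'b list" where bs: "set bs = Basis" using finite_list[OF finite_Basis] by blast
  define fs where "fs = map (\<lambda>b u. u \<bullet> b) bs"
  let ?T = "\<lambda>x. lex_minimizers fs (minimizers f (S x))"
  have T: "hit_measurable M ?T \<and> (\<forall>x. ?T x \<noteq> {}) \<and> (\<forall>x. ?T x \<subseteq> minimizers f (S x))"
    using assms by (intro lex_minimizers_props hit_measurable_minimizers compact_minimizers minimizers_nonempty)
      (auto simp: fs_def intro!: continuous_intros)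
  have single: "u = v" if "u \<in> ?T x" "v \<in> ?T x" for u v x
  proof (rule euclidean_eqI)
    fix b :: 'b assume "b \<in> Basis"
    then have "(\<lambda>u. u \<bullet> b) \<in> set fs" by (simp add: fs_def bs)
    from lex_minimizers_agree[OF this that] show "u \<bullet> b = v \<bullet> b" .
  qed
  define s where "s x = (SOME u. u \<in> ?T x)" for x
  have s: "s x \<in> ?T x" for x unfolding s_def using T by (metis some_in_eq)
  have "s \<in> borel_measurable M"
  proof (rule borel_measurableI)
    fix U :: "'b set" assume "open U"
    \<comment> \<open>As \<open>?T x\<close> is the singleton of \<open>s x\<close>, lying in
      \<open>U\<close> means that \<open>?T x\<close> misses the closed complement.\<close>
    have "s -` U \<inter> space M = space M - {x \<in> space M. ?T x \<inter> (- U) \<noteq> {}}"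
      using s single by blast
    moreover have "hit_measurable M ?T" using T by simp
    then have "{x \<in> space M. ?T x \<inter> (- U) \<noteq> {}} \<in> sets M"
      unfolding hit_measurable_def using closed_Compl[OF \<open>open U\<close>] by blast
    ultimately show "s -` U \<inter> space M \<in> sets M"
      by (simp only: sets.compl_sets)
  qed
  then show ?thesis using s T by (intro that[of s]) auto
qed

section \<open>Parametric maximization over a compact set\<close>

text \<open>Joint continuity makes the set of pairs (maximizer, parameter) closed, and projecting a
  closed set along a compact factor yields a closed set of parameters. So the hitting sets are even
  closed.\<close>

lemma hit_measurable_argmax:
  fixes F :: "'a::euclidean_space \<Rightarrow> 'b::euclidean_space \<Rightarrow> real"
  assumes K: "compact K" and F: "continuous_on UNIV (\<lambda>(x, u). F x u)"
  shows "hit_measurable borel (\<lambda>x. {u \<in> K. \<forall>v\<in>K. F x v \<le> F x u})"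
  unfolding hit_measurable_def
proof (intro allI impI)
  fix C :: "'b set" assume C: "closed C"
  have cont: "continuous_on A (\<lambda>p. F (snd p) (g p))" if "continuous_on A g" for A and g :: "'b \<times> 'a \<Rightarrow> 'b"
  proof -
    have "continuous_on A (\<lambda>p. case (snd p, g p) of (x, u) \<Rightarrow> F x u)"
      by (rule continuous_on_compose2[OF F]) (auto intro!: continuous_intros that)
    then show ?thesis by simp
  qed
  let ?T = "{p. fst p \<in> C} \<inter> (\<Inter>v\<in>K. {p :: 'b \<times> 'a. F (snd p) v \<le> F (snd p) (fst p)})"
  have "closed {p :: 'b \<times> 'a. fst p \<in> C}"
    using continuous_closed_vimage[OF C, of fst] by (simp add: vimage_def continuous_on_fst)
  moreover have "closed {p :: 'b \<times> 'a. F (snd p) v \<le> F (snd p) (fst p)}" for v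
    by (intro closed_Collect_le cont continuous_intros)
  ultimately have "closed ?T" by (intro closed_Int closed_INT) auto
  from closed_compact_projection[OF K this]
  have "closed {x. \<exists>u. u \<in> K \<and> (u, x) \<in> ?T}" .
  moreover have "{x \<in> space borel. {u \<in> K. \<forall>v\<in>K. F x v \<le> F x u} \<inter> C \<noteq> {}} = {x. \<exists>u. u \<in> K \<and> (u, x) \<in> ?T}"
    by auto
  ultimately show "{x \<in> space borel. {u \<in> K. \<forall>v\<in>K. F x v \<le> F x u} \<inter> C \<noteq> {}} \<in> sets borel"
    by (simp only: borel_closed)
qed

lemma compact_argmax:
  fixes F :: "'b::euclidean_space \<Rightarrow> real"
  assumes "compact K" "K \<noteq> {}" "continuous_on UNIV F"
  shows "compact {u \<in> K. \<forall>v\<in>K. F v \<le> F u}" "{u \<in> K. \<forall>v\<in>K. F v \<le> F u} \<noteq> {}"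
proof -
  have "{u \<in> K. \<forall>v\<in>K. F v \<le> F u} = minimizers (\<lambda>u. - F u) K" by (auto simp: minimizers_def)
  then show "compact {u \<in> K. \<forall>v\<in>K. F v \<le> F u}" "{u \<in> K. \<forall>v\<in>K. F v \<le> F u} \<noteq> {}"
    using compact_minimizers[of K "\<lambda>u. - F u"] minimizers_nonempty[of K "\<lambda>u. - F u"] assms
    by (auto intro: continuous_on_minus)
qed

lemma measurable_argmax_closest:
  fixes F :: "'a::euclidean_space \<Rightarrow> 'b::euclidean_space \<Rightarrow> real"
  assumes "compact K" "K \<noteq> {}" "continuous_on UNIV (\<lambda>(x, u). F x u)"
  obtains s where "s \<in> borel_measurable borel" "\<And>x. s x \<in> K" "\<And>x v. v \<in> K \<Longrightarrow> F x v \<le> F x (s x)"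
    "\<And>x u. \<lbrakk>u \<in> K; \<And>v. v \<in> K \<Longrightarrow> F x v \<le> F x u\<rbrakk> \<Longrightarrow> dist (s x) c \<le> dist u c"
proof -
  have F: "continuous_on UNIV (F x)" for x
    using continuous_on_compose2[OF assms(3), of UNIV "\<lambda>u. (x, u)"] by (simp add: continuous_on_Pair)
  obtain s where s: "s \<in> borel_measurable borel"
    "\<And>x. s x \<in> minimizers (\<lambda>u. dist u c) {u \<in> K. \<forall>v\<in>K. F x v \<le> F x u}"
    by (rule measurable_selection_minimizer[OF hit_measurable_argmax[OF assms(1,3)]
          compact_argmax(1)[OF assms(1,2) F] compact_argmax(2)[OF assms(1,2) F], of "\<lambda>u. dist u c"])
      (intro continuous_intros, blast)
  then have "s x \<in> K \<and> (\<forall>v\<in>K. F x v \<le> F x (s x)) \<and>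
      (\<forall>u\<in>K. (\<forall>v\<in>K. F x v \<le> F x u) \<longrightarrow> dist (s x) c \<le> dist u c)" for x
    unfolding minimizers_def by blast
  then show ?thesis using s(1) by (intro that[of s]) auto
qed

section \<open>The multivariate delta method\<close>

lemma distr_std_normal_scale:
  assumes "0 < \<sigma>"
  shows "distr std_normal_distribution borel (\<lambda>x. \<sigma> * x) = normal_law 0 \<sigma>"
proof -
  interpret real_distribution std_normal_distribution by (rule real_dist_normal_dist)
  have "distributed std_normal_distribution lborel (\<lambda>x. x) std_normal_density"
    unfolding distributed_def by (auto simp: distr_id2)
  from normal_density_affine[OF this, of \<sigma> 0] assms
  have "distributed std_normal_distribution lborel (\<lambda>x. \<sigma> * x) (normal_density 0 \<sigma>)" by simp
  from distributed_distr_eq_density[OF this] assms show ?thesis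
    by (simp add: normal_law_def cong: distr_cong)
qed

lemma prob_space_normal_law: "0 \<le> \<sigma> \<Longrightarrow> prob_space (normal_law m \<sigma>)"
  by (auto simp: normal_law_def intro: prob_space_return prob_space_normal_density)

lemma exists_multivariate_normal:
  fixes C :: "real ^ 'n ^ 'n"
  assumes "psd C"
  obtains L :: "(real ^ 'n) measure" where "prob_space L" "sets L = sets borel"
    "\<And>a. distr L borel (\<lambda>x. a \<bullet> x) = normal_law 0 (sqrt (a \<bullet> (C *v a)))"
proof -
  obtain G :: "real ^ 'n ^ 'n" where G: "transpose G ** G = C" by (rule psd_gram[OF assms]) blast
  define P where "P = (\<Pi>\<^sub>M m\<in>(UNIV :: 'n set). std_normal_distribution)"
  interpret std: real_distribution std_normal_distribution by (rule real_dist_normal_dist)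
  interpret PP: product_prob_space "\<lambda>_::'n. std_normal_distribution" UNIV ..
  interpret P: prob_space P unfolding P_def by unfold_locales
  have coord[measurable]: "(\<lambda>g. g m) \<in> borel_measurable P" for m
    unfolding P_def by measurable
  have law: "distr P borel (\<lambda>g. g m) = std_normal_distribution" for m
  proof -
    have "distr P borel (\<lambda>g. g m) = distr P std_normal_distribution (\<lambda>g. g m)"
      by (rule distr_cong) auto
    then show ?thesis unfolding P_def using PP.PiM_component[of m] by simp
  qed
  have indep: "P.indep_vars (\<lambda>_. borel) (\<lambda>m g. g m) UNIV"
  proof (subst P.indep_vars_iff_distr_eq_PiM)
    have "distr P (\<Pi>\<^sub>M i\<in>UNIV. borel) (\<lambda>x. \<lambda>i\<in>UNIV. x i) = distr P P (\<lambda>x. x)"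
      unfolding P_def by (rule distr_cong) (auto intro!: sets_PiM_cong simp: restrict_UNIV)
    also have "\<dots> = P" by (rule distr_id)
    finally show "distr P (\<Pi>\<^sub>M i\<in>UNIV. borel) (\<lambda>x. \<lambda>i\<in>UNIV. x i) = (\<Pi>\<^sub>M i\<in>UNIV. distr P borel (\<lambda>g. g i))"
      by (simp only: law) (simp only: P_def)
  qed auto
  define L where "L = distr P borel (\<lambda>g. \<Sum>m\<in>UNIV. g m *\<^sub>R G $ m)"
  have meas[measurable]: "(\<lambda>g. \<Sum>m\<in>UNIV. g m *\<^sub>R G $ m) \<in> borel_measurable P" by measurable
  have "distr L borel (\<lambda>x. a \<bullet> x) = normal_law 0 (sqrt (a \<bullet> (C *v a)))" for a
  proof -
    define c where "c m = G $ m \<bullet> a" for m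
    \<comment> \<open>The theorem on sums of independent normals asks for positive standard
      deviations and a nonempty index set. Zero coefficients are therefore dropped, and an empty
      \<open>J\<close> gives the point mass at zero.\<close>
    define J where "J = {m. c m \<noteq> 0}"
    have "a \<bullet> (C *v a) = (G *v a) \<bullet> (G *v a)"
      unfolding G[symmetric] by (metis dot_lmul_matrix matrix_vector_mul_assoc vector_transpose_matrix transpose_transpose)
    also have "\<dots> = (\<Sum>m\<in>UNIV. (c m)\<^sup>2)"
      by (simp add: inner_vec_def[of "G *v a"] matrix_vector_mul_component c_def power2_eq_square)
    also have "\<dots> = (\<Sum>m\<in>J. (c m)\<^sup>2)"
      by (rule sum.mono_neutral_right) (auto simp: J_def)
    finally have var: "a \<bullet> (C *v a) = (\<Sum>m\<in>J. (c m)\<^sup>2)" .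
    have "distr L borel (\<lambda>x. a \<bullet> x) = distr P borel (\<lambda>g. a \<bullet> (\<Sum>m\<in>UNIV. g m *\<^sub>R G $ m))"
      unfolding L_def by (subst distr_distr) (auto simp: comp_def)
    also have "(\<lambda>g. a \<bullet> (\<Sum>m\<in>UNIV. g m *\<^sub>R G $ m)) = (\<lambda>g. \<Sum>m\<in>UNIV. c m * g m)"
      by (simp add: inner_sum_right c_def inner_commute mult.commute)
    also have "\<dots> = (\<lambda>g. \<Sum>m\<in>J. c m * g m)"
      by (rule ext, rule sum.mono_neutral_right) (auto simp: J_def)
    also have "distr P borel (\<lambda>g. \<Sum>m\<in>J. c m * g m) = normal_law 0 (sqrt (\<Sum>m\<in>J. (c m)\<^sup>2))"
    proof (cases "J = {}")
      case True
      then show ?thesis by (simp add: normal_law_def P.distr_const)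
    next
      case False
      have "distributed P lborel (\<lambda>g. c m * g m) (normal_density 0 \<bar>c m\<bar>)" if "m \<in> J" for m
      proof -
        have "distributed P lborel (\<lambda>g. g m) std_normal_density"
          unfolding distributed_def using law[of m] by (auto cong: distr_cong)
        from P.normal_density_affine[OF this, of "c m" 0] that show ?thesis by (simp add: J_def)
      qed
      moreover have "P.indep_vars (\<lambda>_. borel) (\<lambda>m g. c m * g m) J"
        by (rule P.indep_vars_compose2[OF P.indep_vars_subset[OF indep]]) auto
      ultimately have d: "distributed P lborel (\<lambda>g. \<Sum>m\<in>J. c m * g m)
          (normal_density (\<Sum>m\<in>J. 0) (sqrt (\<Sum>m\<in>J. \<bar>c m\<bar>\<^sup>2)))"
        using False by (intro P.sum_indep_normal) (auto simp: J_def)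
      obtain j where "j \<in> J" using False by blast
      then have "0 < (\<Sum>m\<in>J. (c m)\<^sup>2)"
        by (intro sum_pos2[of J j]) (auto simp: J_def)
      moreover have "distr P borel (\<lambda>g. \<Sum>m\<in>J. c m * g m) = distr P lborel (\<lambda>g. \<Sum>m\<in>J. c m * g m)"
        by (rule distr_cong) auto
      ultimately show ?thesis
        using distributed_distr_eq_density[OF d] by (simp add: normal_law_def)
    qed
    finally show ?thesis by (simp add: var)
  qed
  moreover have "prob_space L" unfolding L_def by (rule P.prob_space_distr) measurable
  moreover have "sets L = sets borel" by (simp add: L_def)
  ultimately show ?thesis using that by blast
qed

lemma normal_law_variance:
  assumes L: "sets L = sets borel" "distr L borel f = normal_law 0 \<sigma>"
    and f: "f \<in> borel_measurable L" and "0 \<le> \<sigma>"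
  shows "prob_space.variance L f = \<sigma>\<^sup>2"
proof -
  let ?D = "distr L borel f"
  have 1: "integral\<^sup>L L f = integral\<^sup>L ?D (\<lambda>x. x)" using f by (simp add: integral_distr)
  have 2: "(LINT x|L. (f x - c)\<^sup>2) = (LINT x|?D. (x - c)\<^sup>2)" for c using f by (simp add: integral_distr)
  show ?thesis
  proof (cases "\<sigma> = 0")
    case True
    then show ?thesis unfolding 1 2 unfolding L(2) by (simp add: normal_law_def integral_return)
  next
    case False
    then have s: "0 < \<sigma>" using \<open>0 \<le> \<sigma>\<close> by simp
    interpret N: prob_space "normal_law 0 \<sigma>" using \<open>0 \<le> \<sigma>\<close> by (rule prob_space_normal_law)
    have "distributed (normal_law 0 \<sigma>) lborel (\<lambda>x. x) (normal_density 0 \<sigma>)"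
      unfolding distributed_def using False by (auto simp: normal_law_def distr_id2)
    from N.normal_distributed_variance[OF s this] show ?thesis unfolding 1 2 unfolding L(2) .
  qed
qed

section \<open>Trigonometric test functions\<close>

text \<open>Real trigonometric polynomials with arbitrary frequencies. The phase \<open>b\<close>
  covers sines as well, so the class is an algebra by the product-to-sum formula, while convergence
  of expectations has to be known for single cosines only.\<close>

inductive trig :: "('a::euclidean_space \<Rightarrow> real) \<Rightarrow> bool" where
  trig_cos: "trig (\<lambda>x. cos (a \<bullet> x + b))"
| trig_add: "trig f \<Longrightarrow> trig g \<Longrightarrow> trig (\<lambda>x. f x + g x)"
| trig_scale: "trig f \<Longrightarrow> trig (\<lambda>x. c * f x)"

lemma trig_mult:
  assumes "trig f" "trig g"
  shows "trig (\<lambda>x. f x * g x)"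
  using assms(1)
proof induction
  case (trig_cos a b)
  show ?case using assms(2)
  proof induction
    case (trig_cos a' b')
    have "trig (\<lambda>x. (1/2) * cos ((a - a') \<bullet> x + (b - b')) + (1/2) * cos ((a + a') \<bullet> x + (b + b')))"
      by (intro trig.intros)
    moreover have "cos (a \<bullet> x + b) * cos (a' \<bullet> x + b')
        = (1/2) * cos ((a - a') \<bullet> x + (b - b')) + (1/2) * cos ((a + a') \<bullet> x + (b + b'))" for x
    proof -
      have "(a - a') \<bullet> x + (b - b') = (a \<bullet> x + b) - (a' \<bullet> x + b')"
        "(a + a') \<bullet> x + (b + b') = (a \<bullet> x + b) + (a' \<bullet> x + b')"
        by (simp_all add: inner_diff_left inner_add_left)
      then show ?thesis by (simp only: cos_times_cos) simp
    qed
    ultimately show ?case by simp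
  next
    case (trig_add f g)
    from trig.trig_add[OF trig_add.IH] show ?case by (simp add: distrib_left)
  next
    case (trig_scale f c)
    from trig.trig_scale[OF trig_scale.IH, of c] show ?case by (simp add: mult_ac)
  qed
next
  case (trig_add f1 f2)
  from trig.trig_add[OF trig_add.IH] show ?case by (simp add: distrib_right)
next
  case (trig_scale f c)
  from trig.trig_scale[OF trig_scale.IH, of c] show ?case by (simp add: mult_ac)
qed

lemma trig_const: "trig (\<lambda>x. c)"
  using trig_scale[OF trig_cos[of 0 0], of c] by simp

lemma trig_sum: "finite I \<Longrightarrow> (\<And>i. i \<in> I \<Longrightarrow> trig (f i)) \<Longrightarrow> trig (\<lambda>x. \<Sum>i\<in>I. f i x)"
  by (induction I rule: finite_induct) (auto intro: trig_add trig_const)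

lemma trig_continuous: "trig f \<Longrightarrow> continuous_on UNIV f"
  by (induction rule: trig.induct) (auto intro!: continuous_intros)

lemma trig_bounded: "trig f \<Longrightarrow> \<exists>B. \<forall>x. \<bar>f x\<bar> \<le> B"
proof (induction rule: trig.induct)
  case (trig_cos a b)
  then show ?case using abs_cos_le_one by blast
next
  case (trig_add f g)
  then obtain B1 B2 where "\<forall>x. \<bar>f x\<bar> \<le> B1" "\<forall>x. \<bar>g x\<bar> \<le> B2" by blast
  then have "\<forall>x. \<bar>f x + g x\<bar> \<le> B1 + B2" by (meson abs_triangle_ineq add_mono order_trans)
  then show ?case by blast
next
  case (trig_scale f c)
  then obtain B where "\<forall>x. \<bar>f x\<bar> \<le> B" by blast
  then have "\<forall>x. \<bar>c * f x\<bar> \<le> \<bar>c\<bar> * B" by (simp add: abs_mult mult_left_mono)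
  then show ?case by blast
qed

definition sin_vec :: "real \<Rightarrow> 'a::euclidean_space \<Rightarrow> 'a" where
  "sin_vec R x = (\<Sum>b\<in>Basis. sin ((x \<bullet> b) / R) *\<^sub>R b)"

lemma trig_polynomial_sin_vec:
  assumes "real_polynomial_function p"
  shows "trig (\<lambda>x. p (sin_vec R x))"
  using assms
proof induction
  case (linear f)
  interpret bounded_linear f by fact
  have s: "trig (\<lambda>x. sin ((x \<bullet> b) / R))" for b :: 'a
  proof -
    have "cos ((b /\<^sub>R R) \<bullet> x + (- (pi / 2))) = sin ((x \<bullet> b) / R)" for x
    proof -
      have "(b /\<^sub>R R) \<bullet> x = (x \<bullet> b) / R" by (simp add: inner_commute[of b x] divide_inverse)
      then show ?thesis by (simp add: cos_diff)
    qed
    then show ?thesis using trig_cos[of "b /\<^sub>R R" "- (pi / 2)"] by (simp only:)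
  qed
  have "trig (\<lambda>x. \<Sum>b\<in>Basis. f b * sin ((x \<bullet> b) / R))"
    by (intro trig_sum trig_scale s finite_Basis)
  moreover have "f (sin_vec R x) = (\<Sum>b\<in>Basis. f b * sin ((x \<bullet> b) / R))" for x
    by (simp only: sin_vec_def sum scaleR real_scaleR_def mult.commute)
  ultimately show ?case by (simp only:)
next
  case (const c)
  show ?case by (rule trig_const)
next
  case (add f g)
  show ?case by (rule trig_add[OF add.IH])
next
  case (mult f g)
  show ?case by (rule trig_mult[OF mult.IH])
qed

text \<open>A bounded continuous function is approximated on a cube of half-width \<open>R\<close> by a polynomial
  in the functions \<open>sin (x\<^sub>i / R)\<close>. As these range in \<open>[-1, 1]\<close>, the approximant
  obeys the same global bound.\<close>

lemma trig_approximation: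
  fixes f :: "'a::euclidean_space \<Rightarrow> real"
  assumes f: "continuous_on UNIV f" "\<And>x. \<bar>f x\<bar> \<le> B" and "0 < R" "0 < e"
  obtains g where "trig g" "\<And>x. \<bar>g x\<bar> \<le> B + e" "\<And>x. norm x \<le> R \<Longrightarrow> \<bar>f x - g x\<bar> \<le> e"
proof -
  \<comment> \<open>This is \<open>f\<close> in the coordinates \<open>y = sin (x / R)\<close>,
    continuous on the whole unit cube. Polynomial approximation there yields both the local error
    and the global bound.\<close>
  define h where "h y = f (\<Sum>b\<in>Basis. (R * arcsin (y \<bullet> b)) *\<^sub>R b)" for y
  have "continuous_on (cbox (-One) One) (\<lambda>y::'a. \<Sum>b\<in>Basis. (R * arcsin (y \<bullet> b)) *\<^sub>R b)"
    by (intro continuous_intros) (auto simp: mem_box)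
  then have "continuous_on (cbox (-One) One) h"
    unfolding h_def by (rule continuous_on_compose2[OF f(1)]) auto
  then obtain p where p: "real_polynomial_function p" "\<And>y. y \<in> cbox (-One) One \<Longrightarrow> \<bar>h y - p y\<bar> < e"
    using Stone_Weierstrass_real_polynomial_function[OF compact_cbox _ \<open>0 < e\<close>] by blast
  have box: "sin_vec R x \<in> cbox (-One) One" for x
    by (simp add: mem_box sin_vec_def inner_sum_left inner_Basis if_distrib cong: if_cong)
  have "\<bar>p (sin_vec R x)\<bar> \<le> B + e" for x
    using p(2)[OF box[of x]] f(2)[of "\<Sum>b\<in>Basis. (R * arcsin (sin_vec R x \<bullet> b)) *\<^sub>R b"]
    unfolding h_def by linarith
  moreover have "\<bar>f x - p (sin_vec R x)\<bar> \<le> e" if x: "norm x \<le> R" for x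
  proof -
    have "R * arcsin (sin_vec R x \<bullet> b) = x \<bullet> b" if b: "b \<in> Basis" for b
    proof -
      have "\<bar>x \<bullet> b\<bar> \<le> R" using Basis_le_norm[OF b, of x] x by linarith
      then have "\<bar>(x \<bullet> b) / R\<bar> \<le> 1" using \<open>0 < R\<close> by simp
      \<comment> \<open>The argument lies in [-1, 1], which is inside [-pi/2, pi/2], where arcsin
        inverts sin.\<close>
      then have "arcsin (sin ((x \<bullet> b) / R)) = (x \<bullet> b) / R"
        using pi_gt3 by (intro arcsin_sin) linarith+
      moreover have "sin_vec R x \<bullet> b = sin ((x \<bullet> b) / R)"
        using b by (simp add: sin_vec_def inner_sum_left inner_Basis if_distrib cong: if_cong)
      ultimately show ?thesis using \<open>0 < R\<close> by simp
    qed
    then have "h (sin_vec R x) = f (\<Sum>b\<in>Basis. (x \<bullet> b) *\<^sub>R b)"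
      unfolding h_def by (metis (mono_tags, lifting) sum.cong)
    also have "\<dots> = f x" by (simp add: euclidean_representation)
    finally show ?thesis using p(2)[OF box[of x]] by simp
  qed
  ultimately show ?thesis using trig_polynomial_sin_vec[OF p(1)] that by blast
qed

text \<open>Meant for a difference of two bounded test functions that is small off the exceptional
  event \<open>Q\<close>.\<close>

lemma (in prob_space) integral_diff_bound:
  assumes u: "u \<in> borel_measurable M" "\<And>x. \<bar>u x\<bar> \<le> D" and v[measurable]: "{x \<in> space M. Q x} \<in> sets M"
    and d: "\<And>x. x \<in> space M \<Longrightarrow> \<not> Q x \<Longrightarrow> \<bar>u x\<bar> \<le> e" and "0 \<le> e" "0 \<le> D"
  shows "\<bar>expectation u\<bar> \<le> e + D * prob {x \<in> space M. Q x}"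
proof -
  have iu: "integrable M u" using u by (intro integrable_const_bound[of _ D]) auto
  have "\<bar>expectation u\<bar> \<le> expectation (\<lambda>x. \<bar>u x\<bar>)" by (rule integral_abs_bound)
  also have "\<dots> \<le> expectation (\<lambda>x. e + D * indicator {x \<in> space M. Q x} x)"
  proof (rule integral_mono)
    show "integrable M (\<lambda>x. e + D * indicator {x \<in> space M. Q x} x)"
      by (intro Bochner_Integration.integrable_add integrable_mult_right integrable_real_indicator integrable_const)
        (auto simp: emeasure_eq_measure)
    fix x assume x: "x \<in> space M"
    show "\<bar>u x\<bar> \<le> e + D * indicator {x \<in> space M. Q x} x"
      using d[OF x] u(2)[of x] x \<open>0 \<le> e\<close> by (cases "Q x") (auto simp: indicator_def)
  qed (use iu in auto)
  also have "\<dots> = e + D * prob {x \<in> space M. Q x}"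
    by (subst Bochner_Integration.integral_add) (auto simp: emeasure_eq_measure prob_space)
  finally show ?thesis .
qed

lemma (in prob_space) bounded_measurable_tail:
  fixes X :: "'a \<Rightarrow> 'c::euclidean_space"
  assumes [measurable]: "X \<in> borel_measurable M" and "0 < e"
  obtains R where "R > 0" "prob {x \<in> space M. norm (X x) > R} < e"
proof -
  have "(\<lambda>n. prob {x \<in> space M. norm (X x) > real n}) \<longlonglongrightarrow> prob (\<Inter>n. {x \<in> space M. norm (X x) > real n})"
    by (rule finite_Lim_measure_decseq) (auto simp: decseq_def)
  moreover have "(\<Inter>n. {x \<in> space M. norm (X x) > real n}) = {}"
  proof -
    have "\<exists>n. \<not> real n < norm (X x)" for x by (metis not_less real_arch_simple)
    then show ?thesis by blast
  qed
  ultimately have "(\<lambda>n. prob {x \<in> space M. norm (X x) > real n}) \<longlonglongrightarrow> 0" by simp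
  then have "\<forall>\<^sub>F n in sequentially. prob {x \<in> space M. norm (X x) > real n} < e"
    using \<open>0 < e\<close> by (rule order_tendstoD)
  then have "\<forall>\<^sub>F n in sequentially. prob {x \<in> space M. norm (X x) > real n} < e \<and> n > 0"
    using eventually_gt_at_top[of 0] by (rule eventually_conj)
  then obtain n where "prob {x \<in> space M. norm (X x) > real n} < e \<and> n > 0"
    unfolding eventually_sequentially by blast
  then show ?thesis by (intro that[of "real n"]) auto
qed

text \<open>Tightness confines both laws to a ball up to small mass. There \<open>f\<close> is
  within \<open>e\<close> of a trigonometric polynomial, and outside the global bound of the
  polynomial limits the discrepancy to \<open>2 * B + 1\<close>.\<close>

lemma (in prob_space) converges_in_distribution_cos:
  fixes X :: "nat \<Rightarrow> 'a \<Rightarrow> 'c::euclidean_space" and L :: "'c measure"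
  assumes X[measurable]: "\<And>n. X n \<in> borel_measurable M"
    and L: "prob_space L" "sets L = sets borel"
    and cos: "\<And>a b. (\<lambda>n. expectation (\<lambda>\<omega>. cos (a \<bullet> X n \<omega> + b))) \<longlonglongrightarrow> (\<integral>x. cos (a \<bullet> x + b) \<partial>L)"
    and tight: "\<And>e. 0 < e \<Longrightarrow> \<exists>R. \<forall>\<^sub>F n in sequentially. prob {\<omega> \<in> space M. norm (X n \<omega>) > R} < e"
  shows "converges_in_distribution M X L"
  unfolding converges_in_distribution_def
proof (intro allI impI)
  fix f :: "'c \<Rightarrow> real" assume f: "continuous_on UNIV f \<and> bounded (range f)"
  interpret L: prob_space L by fact
  have [measurable]: "(\<lambda>x. x) \<in> borel_measurable L" "f \<in> borel_measurable borel"
    using L f by (auto simp: borel_measurable_continuous_onI cong: measurable_cong_sets)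
  have measL[measurable]: "g \<in> borel_measurable L" if "continuous_on UNIV g" for g :: "'c \<Rightarrow> real"
    using borel_measurable_continuous_onI[OF that] L(2) by (auto cong: measurable_cong_sets)
  obtain B where B0: "\<And>x. \<bar>f x\<bar> \<le> B" using f by (auto simp: bounded_iff)
  then have "0 \<le> B" by (meson abs_ge_zero order_trans)
  have trig: "(\<lambda>n. expectation (\<lambda>\<omega>. g (X n \<omega>))) \<longlonglongrightarrow> L.expectation g" if "trig g" for g
    using that
  proof induction
    case (trig_cos a b)
    then show ?case by (rule cos)
  next
    case (trig_add f g)
    have "integrable M (\<lambda>\<omega>. h (X n \<omega>))" "integrable L h" if h: "trig h" for h n
    proof -
      obtain D where D: "\<And>x. \<bar>h x\<bar> \<le> D" using trig_bounded[OF h] by blast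
      have [measurable]: "h \<in> borel_measurable borel"
        using trig_continuous[OF that] by (rule borel_measurable_continuous_onI)
      show "integrable M (\<lambda>\<omega>. h (X n \<omega>))" by (rule integrable_const_bound[of _ D]) (auto simp: D)
      show "integrable L h" by (rule L.integrable_const_bound[of _ D]) (auto simp: D measL trig_continuous[OF that])
    qed
    then show ?case using trig_add by (simp add: tendsto_add)
  next
    case (trig_scale f c)
    then show ?case by (simp add: tendsto_mult_left)
  qed
  show "(\<lambda>n. expectation (\<lambda>\<omega>. f (X n \<omega>))) \<longlonglongrightarrow> L.expectation f"
  proof (rule LIMSEQ_I)
    fix r :: real assume "0 < r"
    \<comment> \<open>The total error is \<open>e * (4 * B + 5)\<close>: two approximation errors
      \<open>e + (2 * B + 1) * e\<close> and one convergence error \<open>e\<close>.\<close>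
    define e where "e = min 1 (r / (8 * B + 16))"
    have e: "0 < e" "e \<le> 1" using \<open>0 < r\<close> \<open>0 \<le> B\<close> by (auto simp: e_def)
    have er: "2 * (e + (2 * B + 1) * e) + e < r"
    proof -
      have "e \<le> r / (8 * B + 16)" by (simp add: e_def)
      then have "e * (8 * B + 16) \<le> r" using \<open>0 \<le> B\<close> by (simp add: pos_le_divide_eq)
      moreover have "0 \<le> e * B" using e \<open>0 \<le> B\<close> by simp
      ultimately show ?thesis using e by (simp add: algebra_simps)
    qed
    obtain R1 where R1: "\<forall>\<^sub>F n in sequentially. prob {\<omega> \<in> space M. norm (X n \<omega>) > R1} < e"
      using tight[OF e(1)] by blast
    obtain R2 where R2: "R2 > 0" "L.prob {x \<in> space L. norm x > R2} < e"
      using L.bounded_measurable_tail[of "\<lambda>x. x" e] e(1) by auto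
    define R where "R = max R1 R2"
    have "0 < R" using R2 by (auto simp: R_def)
    obtain g where g: "trig g" "\<And>x. \<bar>g x\<bar> \<le> B + e" "\<And>x. norm x \<le> R \<Longrightarrow> \<bar>f x - g x\<bar> \<le> e"
      using trig_approximation[OF conjunct1[OF f] B0 \<open>0 < R\<close> e(1)] by blast
    have gc: "continuous_on UNIV g" by (rule trig_continuous[OF g(1)])
    have [measurable]: "g \<in> borel_measurable borel" by (rule borel_measurable_continuous_onI[OF gc])
    have fg: "\<bar>f x - g x\<bar> \<le> 2 * B + 1" for x
      using B0[of x] g(2)[of x] e(2) by linarith
    have bL: "\<bar>L.expectation f - L.expectation g\<bar> \<le> e + (2 * B + 1) * e"
    proof -
      have "integrable L f" by (rule L.integrable_const_bound[of _ B]) (use B0 f measL in auto)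
      moreover have "integrable L g" by (rule L.integrable_const_bound[of _ "B + e"]) (use g gc measL in auto)
      ultimately have "L.expectation f - L.expectation g = L.expectation (\<lambda>x. f x - g x)" by simp
      moreover have "\<bar>L.expectation (\<lambda>x. f x - g x)\<bar> \<le> e + (2 * B + 1) * L.prob {x \<in> space L. norm x > R}"
        using fg g(3) e \<open>0 \<le> B\<close> f gc by (intro L.integral_diff_bound) (auto intro!: borel_measurable_diff measL)
      moreover have "L.prob {x \<in> space L. norm x > R} \<le> L.prob {x \<in> space L. norm x > R2}"
        by (rule L.finite_measure_mono) (auto simp: R_def)
      then have "(2 * B + 1) * L.prob {x \<in> space L. norm x > R} \<le> (2 * B + 1) * e"
        using R2(2) \<open>0 \<le> B\<close> by (intro mult_left_mono) auto
      ultimately show ?thesis by linarith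
    qed
    have bM: "\<bar>expectation (\<lambda>\<omega>. f (X n \<omega>)) - expectation (\<lambda>\<omega>. g (X n \<omega>))\<bar> \<le> e + (2 * B + 1) * e"
      if n: "prob {\<omega> \<in> space M. norm (X n \<omega>) > R1} < e" for n
    proof -
      have "integrable M (\<lambda>\<omega>. f (X n \<omega>))" by (rule integrable_const_bound[of _ B]) (use B0 in auto)
      moreover have "integrable M (\<lambda>\<omega>. g (X n \<omega>))" by (rule integrable_const_bound[of _ "B + e"]) (use g in auto)
      ultimately have "expectation (\<lambda>\<omega>. f (X n \<omega>)) - expectation (\<lambda>\<omega>. g (X n \<omega>)) = expectation (\<lambda>\<omega>. f (X n \<omega>) - g (X n \<omega>))" by simp
      moreover have "\<bar>expectation (\<lambda>\<omega>. f (X n \<omega>) - g (X n \<omega>))\<bar> \<le> e + (2 * B + 1) * prob {\<omega> \<in> space M. norm (X n \<omega>) > R}"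
        using fg g(3) e \<open>0 \<le> B\<close> by (intro integral_diff_bound) auto
      moreover have "prob {\<omega> \<in> space M. norm (X n \<omega>) > R} \<le> prob {\<omega> \<in> space M. norm (X n \<omega>) > R1}"
        by (rule finite_measure_mono) (auto simp: R_def)
      then have "(2 * B + 1) * prob {\<omega> \<in> space M. norm (X n \<omega>) > R} \<le> (2 * B + 1) * e"
        using n \<open>0 \<le> B\<close> by (intro mult_left_mono) auto
      ultimately show ?thesis by linarith
    qed
    have "\<forall>\<^sub>F n in sequentially. \<bar>expectation (\<lambda>\<omega>. g (X n \<omega>)) - L.expectation g\<bar> < e"
      using tendstoD[OF trig[OF g(1)] e(1)] by (simp add: dist_real_def)
    with R1 have "\<forall>\<^sub>F n in sequentially. \<bar>expectation (\<lambda>\<omega>. f (X n \<omega>)) - L.expectation f\<bar> < r"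
    proof eventually_elim
      case (elim n)
      have "\<bar>a - d\<bar> < r" if "\<bar>a - b\<bar> \<le> u" "\<bar>d - c\<bar> \<le> u" "\<bar>b - c\<bar> < e" "2 * u + e < r" for a b c d u :: real
        using that by linarith
      from this[OF bM[OF elim(1)] bL elim(2) er] show ?case .
    qed
    then show "\<exists>no. \<forall>n\<ge>no. norm (expectation (\<lambda>\<omega>. f (X n \<omega>)) - L.expectation f) < r"
      by (simp add: eventually_sequentially)
  qed
qed

section \<open>Central limit theorem for sample means of random vectors\<close>

text \<open>Zero variance is treated apart: all summands then vanish almost surely and the limit is
  a point mass, whereas the scalar central limit theorem divides by the standard deviation.\<close>

lemma (in prob_space) clt_cos:
  fixes X :: "nat \<Rightarrow> 'a \<Rightarrow> real"
  assumes indep: "indep_vars (\<lambda>_. borel) X UNIV"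
    and law: "\<And>i. distr M borel (X i) = distr M borel (X 0)"
    and sq: "integrable M (\<lambda>\<omega>. (X 0 \<omega>)\<^sup>2)" and mean: "expectation (X 0) = 0"
  shows "(\<lambda>n. expectation (\<lambda>\<omega>. cos ((\<Sum>i<n. X i \<omega>) / sqrt (real n) + b)))
    \<longlonglongrightarrow> (\<integral>x. cos (x + b) \<partial>normal_law 0 (sqrt (expectation (\<lambda>\<omega>. (X 0 \<omega>)\<^sup>2))))"
proof -
  define v where "v = expectation (\<lambda>\<omega>. (X 0 \<omega>)\<^sup>2)"
  have X[measurable]: "X i \<in> borel_measurable M" for i
    using indep unfolding indep_vars_def2 by simp
  have eq: "expectation (\<lambda>\<omega>. f (X i \<omega>)) = expectation (\<lambda>\<omega>. f (X 0 \<omega>))"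
    if [measurable]: "f \<in> borel_measurable borel" for f :: "real \<Rightarrow> real" and i
    using law[of i] by (metis X integral_distr that)
  have int: "integrable M (\<lambda>\<omega>. f (X i \<omega>))" if [measurable]: "f \<in> borel_measurable borel"
    and "integrable M (\<lambda>\<omega>. f (X 0 \<omega>))" for f :: "real \<Rightarrow> real" and i
    using law[of i] that(2) by (metis X integrable_distr_eq that(1))
  have "0 \<le> v" by (simp add: v_def)
  show ?thesis
  proof (cases "v = 0")
    case True
    have "AE \<omega> in M. X i \<omega> = 0" for i
    proof -
      have "expectation (\<lambda>\<omega>. (X i \<omega>)\<^sup>2) = 0" using eq[of "\<lambda>x. x\<^sup>2" i] True by (simp add: v_def)
      moreover have "integrable M (\<lambda>\<omega>. (X i \<omega>)\<^sup>2)" using int[of "\<lambda>x. x\<^sup>2" i] sq by simp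
      ultimately show ?thesis by (subst (asm) integral_nonneg_eq_0_iff_AE) auto
    qed
    then have "AE \<omega> in M. \<forall>i. X i \<omega> = 0" by (simp add: AE_all_countable)
    then have "expectation (\<lambda>\<omega>. cos ((\<Sum>i<n. X i \<omega>) / sqrt (real n) + b)) = expectation (\<lambda>\<omega>. cos b)" for n
      by (intro integral_cong_AE) (auto elim!: eventually_mono)
    then show ?thesis using True
      by (simp add: v_def[symmetric] normal_law_def integral_return prob_space)
  next
    case False
    define s where "s = sqrt v"
    have s: "0 < s" "s\<^sup>2 = v" using False \<open>0 \<le> v\<close> by (auto simp: s_def)
    interpret std: real_distribution std_normal_distribution by (rule real_dist_normal_dist)
    have mean0: "expectation (X i) = 0" for i using eq[of "\<lambda>x. x" i] mean by simp
    let ?D = "\<lambda>n. distr M borel (\<lambda>x. (\<Sum>i<n. X i x) / sqrt (real n * s\<^sup>2))"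
    have "weak_conv_m ?D std_normal_distribution"
    proof (rule central_limit_theorem_zero_mean[OF indep mean0 s(1)])
      show "integrable M (\<lambda>x. (X n x)\<^sup>2)" for n using int[of "\<lambda>x. x\<^sup>2" n] sq by simp
      show "variance (X n) = s\<^sup>2" for n
        using eq[of "\<lambda>x. x\<^sup>2" n] by (simp add: mean0 s v_def)
      show "distr M borel (X n) = distr M borel (X 0)" for n by (rule law)
    qed
    \<comment> \<open>The sums are normalized to variance one; the factor \<open>s\<close> inside
      the cosine restores the original scale.\<close>
    then have "(\<lambda>n. integral\<^sup>L (?D n) (\<lambda>x. cos (s * x + b))) \<longlonglongrightarrow> integral\<^sup>L std_normal_distribution (\<lambda>x. cos (s * x + b))"
      by (intro weak_conv_imp_integral_bdd_continuous_conv[where B = 1])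
        (auto intro!: real_distribution_distr std.real_distribution_axioms continuous_intros)
    moreover have "integral\<^sup>L (?D n) (\<lambda>x. cos (s * x + b)) = expectation (\<lambda>\<omega>. cos ((\<Sum>i<n. X i \<omega>) / sqrt (real n) + b))" for n
      using s by (subst integral_distr) (auto simp: real_sqrt_mult)
    moreover have "integral\<^sup>L std_normal_distribution (\<lambda>x. cos (s * x + b)) = (\<integral>x. cos (x + b) \<partial>normal_law 0 s)"
      by (subst distr_std_normal_scale[OF s(1), symmetric], subst integral_distr) auto
    ultimately show ?thesis by (simp add: v_def[symmetric] s_def[symmetric])
  qed
qed

text \<open>Instantiated later with the vectors of monomials of the observations, so that square
  integrability here doubles the order of the moments required of the data.\<close>

locale iid_vectors = prob_space +
  fixes H :: "nat \<Rightarrow> 'a \<Rightarrow> 'e::euclidean_space"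
  assumes indep: "indep_vars (\<lambda>_. borel) H UNIV"
    and law: "\<And>i. distr M borel (H i) = distr M borel (H 0)"
    and square_integrable: "integrable M (\<lambda>\<omega>. (norm (H 0 \<omega>))\<^sup>2)"
begin

lemma H_measurable[measurable]: "H i \<in> borel_measurable M"
  using indep unfolding indep_vars_def2 by simp

definition mu :: 'e where "mu = (\<integral>\<omega>. H 0 \<omega> \<partial>M)"

definition mean :: "nat \<Rightarrow> 'a \<Rightarrow> 'e" where "mean n \<omega> = (1 / real n) *\<^sub>R (\<Sum>i<n. H i \<omega>)"

lemma mean_measurable[measurable]: "mean n \<in> borel_measurable M"
  unfolding mean_def by measurable

lemma expectation_H: "f \<in> borel_measurable borel \<Longrightarrow> expectation (\<lambda>\<omega>. f (H i \<omega>)) = expectation (\<lambda>\<omega>. f (H 0 \<omega>))"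
  for f :: "'e \<Rightarrow> real"
  using law[of i] by (metis H_measurable integral_distr)

lemma integrable_H: "f \<in> borel_measurable borel \<Longrightarrow> integrable M (\<lambda>\<omega>. f (H i \<omega>)) \<longleftrightarrow> integrable M (\<lambda>\<omega>. f (H 0 \<omega>))"
  for f :: "'e \<Rightarrow> real"
  using law[of i] by (metis H_measurable integrable_distr_eq)

lemma integrable_norm_H0: "integrable M (\<lambda>\<omega>. norm (H 0 \<omega>))"
  using square_integrable by (rule square_integrable_imp_integrable[rotated]) measurable

lemma integrable_H0: "integrable M (H 0)"
  using integrable_norm_H0 by (simp add: integrable_norm_iff)

lemma square_integrable_diff: "integrable M (\<lambda>\<omega>. (norm (H 0 \<omega> - mu))\<^sup>2)"
proof (rule Bochner_Integration.integrable_bound)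
  show "integrable M (\<lambda>\<omega>. 2 * (norm (H 0 \<omega>))\<^sup>2 + 2 * (norm mu)\<^sup>2)"
    using square_integrable by auto
  have "(norm (H 0 \<omega> - mu))\<^sup>2 \<le> 2 * (norm (H 0 \<omega>))\<^sup>2 + 2 * (norm mu)\<^sup>2" for \<omega>
  proof -
    have "(norm (H 0 \<omega> - mu))\<^sup>2 \<le> (norm (H 0 \<omega>) + norm mu)\<^sup>2"
      by (rule power_mono[OF norm_triangle_ineq4]) simp
    also have "\<dots> \<le> 2 * (norm (H 0 \<omega>))\<^sup>2 + 2 * (norm mu)\<^sup>2"
      using sum_squares_bound[of "norm (H 0 \<omega>)" "norm mu"] by (simp add: power2_sum)
    finally show ?thesis .
  qed
  then show "AE \<omega> in M. norm ((norm (H 0 \<omega> - mu))\<^sup>2) \<le> norm (2 * (norm (H 0 \<omega>))\<^sup>2 + 2 * (norm mu)\<^sup>2)"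
    by (auto intro!: AE_I2)
qed measurable

definition V :: real where "V = expectation (\<lambda>\<omega>. (norm (H 0 \<omega> - mu))\<^sup>2)"

lemma linear_part:
  fixes f :: "'e \<Rightarrow> real"
  assumes f: "bounded_linear f"
  defines "D \<equiv> \<lambda>i \<omega>. f (H i \<omega> - mu)"
  shows "indep_vars (\<lambda>_. borel) D UNIV" "distr M borel (D i) = distr M borel (D 0)"
    "integrable M (\<lambda>\<omega>. (D i \<omega>)\<^sup>2)" "integrable M (D i)" "expectation (D i) = 0"
    "expectation (\<lambda>\<omega>. (D i \<omega>)\<^sup>2) = expectation (\<lambda>\<omega>. (D 0 \<omega>)\<^sup>2)"
proof -
  interpret f: bounded_linear f by fact
  have fc: "continuous_on UNIV f" by (rule linear_continuous_on[OF f])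
  then have [measurable]: "f \<in> borel_measurable borel" by (rule borel_measurable_continuous_onI)
  show "indep_vars (\<lambda>_. borel) D UNIV"
    unfolding D_def by (rule indep_vars_compose2[OF indep]) measurable
  have "distr M borel (D j) = distr (distr M borel (H j)) borel (\<lambda>x. f (x - mu))" for j
    unfolding D_def by (subst distr_distr) (auto simp: comp_def)
  then show "distr M borel (D i) = distr M borel (D 0)" using law[of i] by simp
  obtain K where K: "\<And>x. norm (f x) \<le> norm x * K" using f.bounded by blast
  have sq0: "integrable M (\<lambda>\<omega>. (D 0 \<omega>)\<^sup>2)"
  proof (rule Bochner_Integration.integrable_bound)
    show "integrable M (\<lambda>\<omega>. (norm (H 0 \<omega> - mu))\<^sup>2 * K\<^sup>2)" using square_integrable_diff by simp
    have "(D 0 \<omega>)\<^sup>2 \<le> (norm (H 0 \<omega> - mu))\<^sup>2 * K\<^sup>2" for \<omega>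
      using power_mono[OF K[of "H 0 \<omega> - mu"], of 2] unfolding D_def by (simp add: power_mult_distrib)
    then show "AE \<omega> in M. norm ((D 0 \<omega>)\<^sup>2) \<le> norm ((norm (H 0 \<omega> - mu))\<^sup>2 * K\<^sup>2)"
      by (auto intro!: AE_I2)
  qed (unfold D_def, measurable)
  then show sq: "integrable M (\<lambda>\<omega>. (D i \<omega>)\<^sup>2)"
    using integrable_H[of "\<lambda>x. (f (x - mu))\<^sup>2" i] unfolding D_def by simp
  show "integrable M (D i)"
    using sq by (rule square_integrable_imp_integrable[rotated]) (unfold D_def, measurable)
  have "expectation (D 0) = f (expectation (\<lambda>\<omega>. H 0 \<omega> - mu))"
    unfolding D_def by (rule integral_bounded_linear[OF f]) (use integrable_H0 in auto)
  also have "expectation (\<lambda>\<omega>. H 0 \<omega> - mu) = 0"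
    using integrable_H0 by (simp add: mu_def prob_space)
  finally show "expectation (D i) = 0"
    using expectation_H[of "\<lambda>x. f (x - mu)" i] unfolding D_def by (simp add: f.zero)
  show "expectation (\<lambda>\<omega>. (D i \<omega>)\<^sup>2) = expectation (\<lambda>\<omega>. (D 0 \<omega>)\<^sup>2)"
    using expectation_H[of "\<lambda>x. (f (x - mu))\<^sup>2" i] unfolding D_def by simp
qed

lemma linear_part_sum:
  fixes f :: "'e \<Rightarrow> real"
  assumes f: "bounded_linear f"
  shows "integrable M (\<lambda>\<omega>. (\<Sum>i<n. f (H i \<omega> - mu))\<^sup>2)"
    "expectation (\<lambda>\<omega>. (\<Sum>i<n. f (H i \<omega> - mu))\<^sup>2) = real n * expectation (\<lambda>\<omega>. (f (H 0 \<omega> - mu))\<^sup>2)"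
proof -
  let ?D = "\<lambda>i \<omega>. f (H i \<omega> - mu)"
  note D = linear_part[OF f]
  have prod: "integrable M (\<lambda>\<omega>. ?D i \<omega> * ?D j \<omega>) \<and>
      expectation (\<lambda>\<omega>. ?D i \<omega> * ?D j \<omega>) = (if i = j then expectation (\<lambda>\<omega>. (?D 0 \<omega>)\<^sup>2) else 0)" for i j
  proof (cases "i = j")
    case True
    then show ?thesis using D(3)[of i] D(6)[of i] by (simp add: power2_eq_square)
  next
    case False
    have "indep_vars (\<lambda>_. borel) ?D {i, j}" by (rule indep_vars_subset[OF D(1)]) auto
    then show ?thesis
      using indep_vars_integrable[of "{i, j}" ?D] indep_vars_lebesgue_integral[of "{i, j}" ?D] D(4,5) False
      by simp
  qed
  have eq: "(\<lambda>\<omega>. (\<Sum>i<n. ?D i \<omega>)\<^sup>2) = (\<lambda>\<omega>. \<Sum>i<n. \<Sum>j<n. ?D i \<omega> * ?D j \<omega>)"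
    by (simp add: power2_eq_square sum_product)
  show "integrable M (\<lambda>\<omega>. (\<Sum>i<n. ?D i \<omega>)\<^sup>2)"
    unfolding eq using prod by (intro Bochner_Integration.integrable_sum) blast
  have "expectation (\<lambda>\<omega>. (\<Sum>i<n. ?D i \<omega>)\<^sup>2) = (\<Sum>i<n. \<Sum>j<n. expectation (\<lambda>\<omega>. ?D i \<omega> * ?D j \<omega>))"
    unfolding eq using prod by (simp add: Bochner_Integration.integral_sum)
  also have "\<dots> = (\<Sum>i<n. \<Sum>j<n. if i = j then expectation (\<lambda>\<omega>. (?D 0 \<omega>)\<^sup>2) else 0)"
    using prod by simp
  finally show "expectation (\<lambda>\<omega>. (\<Sum>i<n. ?D i \<omega>)\<^sup>2) = real n * expectation (\<lambda>\<omega>. (?D 0 \<omega>)\<^sup>2)"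
    by simp
qed

lemma norm_square_Basis: "(norm x)\<^sup>2 = (\<Sum>b\<in>Basis. (x \<bullet> b)\<^sup>2)" for x :: 'e
  unfolding power2_norm_eq_inner by (subst euclidean_inner) (simp add: power2_eq_square)

text \<open>Independent centered summands are orthogonal, so the variances add and the scaling by
  \<open>sqrt n\<close> makes the value independent of \<open>n\<close>. Every tightness bound below
  rests on this.\<close>

lemma mean_second_moment:
  assumes "n > 0"
  shows "integrable M (\<lambda>\<omega>. (norm (sqrt (real n) *\<^sub>R (mean n \<omega> - mu)))\<^sup>2)"
    "expectation (\<lambda>\<omega>. (norm (sqrt (real n) *\<^sub>R (mean n \<omega> - mu)))\<^sup>2) = V"
proof -
  have lin: "bounded_linear (\<lambda>x :: 'e. x \<bullet> b)" for b by (rule bounded_linear_inner_left)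
  have eq: "(\<lambda>\<omega>. (norm (sqrt (real n) *\<^sub>R (mean n \<omega> - mu)))\<^sup>2)
      = (\<lambda>\<omega>. \<Sum>b\<in>Basis. (1 / real n) * (\<Sum>i<n. (H i \<omega> - mu) \<bullet> b)\<^sup>2)"
  proof
    fix \<omega>
    have "(sqrt (real n) *\<^sub>R (mean n \<omega> - mu)) \<bullet> b = (1 / sqrt (real n)) * (\<Sum>i<n. (H i \<omega> - mu) \<bullet> b)" for b
    proof -
      have "(\<Sum>i<n. (H i \<omega> - mu) \<bullet> b) = real n * ((mean n \<omega> - mu) \<bullet> b)"
        using assms by (simp add: mean_def inner_diff_left sum_subtractf inner_sum_left algebra_simps)
      moreover have "real n = sqrt (real n) * sqrt (real n)" by simp
      ultimately have "(\<Sum>i<n. (H i \<omega> - mu) \<bullet> b) = sqrt (real n) * (sqrt (real n) * ((mean n \<omega> - mu) \<bullet> b))"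
        by (metis mult.assoc)
      then show ?thesis using assms by simp
    qed
    then show "(norm (sqrt (real n) *\<^sub>R (mean n \<omega> - mu)))\<^sup>2 = (\<Sum>b\<in>Basis. (1 / real n) * (\<Sum>i<n. (H i \<omega> - mu) \<bullet> b)\<^sup>2)"
      unfolding norm_square_Basis by (simp add: power_mult_distrib power_divide)
  qed
  show "integrable M (\<lambda>\<omega>. (norm (sqrt (real n) *\<^sub>R (mean n \<omega> - mu)))\<^sup>2)"
    unfolding eq by (intro Bochner_Integration.integrable_sum integrable_mult_right linear_part_sum(1)[OF lin])
  have "expectation (\<lambda>\<omega>. (norm (sqrt (real n) *\<^sub>R (mean n \<omega> - mu)))\<^sup>2)
      = (\<Sum>b\<in>Basis. (1 / real n) * expectation (\<lambda>\<omega>. (\<Sum>i<n. (H i \<omega> - mu) \<bullet> b)\<^sup>2))"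
    unfolding eq using linear_part_sum(1)[OF lin] by (simp add: Bochner_Integration.integral_sum)
  also have "\<dots> = (\<Sum>b\<in>Basis. expectation (\<lambda>\<omega>. ((H 0 \<omega> - mu) \<bullet> b)\<^sup>2))"
    unfolding linear_part_sum(2)[OF lin] using assms by simp
  also have "\<dots> = V"
    unfolding V_def norm_square_Basis
    by (rule Bochner_Integration.integral_sum[symmetric]) (rule linear_part(3)[OF lin])
  finally show "expectation (\<lambda>\<omega>. (norm (sqrt (real n) *\<^sub>R (mean n \<omega> - mu)))\<^sup>2) = V" .
qed

lemma V_nonneg: "0 \<le> V" by (simp add: V_def)

lemma mean_tail:
  assumes "n > 0" "r > 0"
  shows "prob {\<omega> \<in> space M. r \<le> sqrt (real n) * norm (mean n \<omega> - mu)} \<le> V / r\<^sup>2"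
proof -
  have "prob {\<omega> \<in> space M. r\<^sup>2 \<le> (norm (sqrt (real n) *\<^sub>R (mean n \<omega> - mu)))\<^sup>2} \<le> V / r\<^sup>2"
    unfolding mean_second_moment(2)[OF assms(1), symmetric]
    by (rule integral_Markov_inequality_measure[OF mean_second_moment(1)[OF assms(1)], of "{}"]) (use assms in auto)
  moreover have "r\<^sup>2 \<le> (norm (sqrt (real n) *\<^sub>R (mean n \<omega> - mu)))\<^sup>2 \<longleftrightarrow> r \<le> sqrt (real n) * norm (mean n \<omega> - mu)" for \<omega>
    using assms(2) power2_le_iff_abs_le[of "norm (sqrt (real n) *\<^sub>R (mean n \<omega> - mu))" r]
    by (simp add: abs_le_square_iff[symmetric])
  ultimately show ?thesis by simp
qed

lemma mean_consistent:
  assumes "d > 0"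
  shows "(\<lambda>n. prob {\<omega> \<in> space M. d \<le> norm (mean n \<omega> - mu)}) \<longlonglongrightarrow> 0"
proof (rule tendsto_sandwich[of "\<lambda>_. 0"])
  show "\<forall>\<^sub>F n in sequentially. prob {\<omega> \<in> space M. d \<le> norm (mean n \<omega> - mu)} \<le> V / d\<^sup>2 * (1 / real n)"
    using eventually_gt_at_top[of 0]
  proof eventually_elim
    case (elim n)
    have "prob {\<omega> \<in> space M. d \<le> norm (mean n \<omega> - mu)} = prob {\<omega> \<in> space M. sqrt (real n) * d \<le> sqrt (real n) * norm (mean n \<omega> - mu)}"
      using elim by simp
    also have "\<dots> \<le> V / (sqrt (real n) * d)\<^sup>2"
      using elim assms by (intro mean_tail) auto
    finally show ?case by (simp add: power_mult_distrib mult.commute)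
  qed
  show "(\<lambda>n. V / d\<^sup>2 * (1 / real n)) \<longlonglongrightarrow> 0"
    by (rule tendsto_mult_right_zero[OF lim_1_over_n])
qed auto


text \<open>Each projection \<open>a \<bullet> T (...)\<close> is a normalized sum of scalar
  variables, so the one-dimensional theorem applies to it. The second moments of the projections
  form one semidefinite quadratic form, which supplies a common limit law for all
  \<open>a\<close>.\<close>

lemma linear_clt:
  fixes T :: "'e \<Rightarrow> real ^ 'n"
  assumes T: "bounded_linear T"
  obtains L :: "(real ^ 'n) measure" where "prob_space L" "sets L = sets borel"
    "\<And>a. distr L borel (\<lambda>x. a \<bullet> x) = normal_law 0 (sqrt (expectation (\<lambda>\<omega>. (a \<bullet> T (H 0 \<omega> - mu))\<^sup>2)))"
    "\<And>a b. (\<lambda>n. expectation (\<lambda>\<omega>. cos (a \<bullet> T (sqrt (real n) *\<^sub>R (mean n \<omega> - mu)) + b))) \<longlonglongrightarrow> (\<integral>x. cos (a \<bullet> x + b) \<partial>L)"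
proof -
  interpret T: bounded_linear T by fact
  define Y where "Y i \<omega> = T (H i \<omega> - mu)" for i \<omega>
  have lin: "bounded_linear (\<lambda>x. a \<bullet> T x)" for a
    by (intro bounded_linear_compose[OF bounded_linear_inner_right T])
  have lin_nth: "bounded_linear (\<lambda>x. T x $ i)" for i
    by (intro bounded_linear_compose[OF bounded_linear_vec_nth T])
  define C :: "real ^ 'n ^ 'n" where "C = (\<chi> i j. expectation (\<lambda>\<omega>. Y 0 \<omega> $ i * Y 0 \<omega> $ j))"
  have int: "integrable M (\<lambda>\<omega>. Y 0 \<omega> $ i * Y 0 \<omega> $ j)" for i j
  proof (rule Bochner_Integration.integrable_bound)
    show "integrable M (\<lambda>\<omega>. (Y 0 \<omega> $ i)\<^sup>2 + (Y 0 \<omega> $ j)\<^sup>2)"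
      unfolding Y_def using linear_part(3)[OF lin_nth, of 0] by (intro Bochner_Integration.integrable_add)
    have Tm[measurable]: "T \<in> borel_measurable borel"
      by (intro borel_measurable_continuous_onI linear_continuous_on T)
    have "(\<lambda>\<omega>. T (H 0 \<omega> - mu) $ i) \<in> borel_measurable M" for i
      using borel_measurable_integrable[OF linear_part(4)[OF lin_nth, of 0]] .
    then show "(\<lambda>\<omega>. Y 0 \<omega> $ i * Y 0 \<omega> $ j) \<in> borel_measurable M"
      unfolding Y_def by measurable
    have "\<bar>x * y\<bar> \<le> x\<^sup>2 + y\<^sup>2" for x y :: real
    proof -
      have "2 * (\<bar>x\<bar> * \<bar>y\<bar>) \<le> x\<^sup>2 + y\<^sup>2" using sum_squares_bound[of "\<bar>x\<bar>" "\<bar>y\<bar>"] by (simp add: mult.assoc)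
      moreover have "0 \<le> \<bar>x\<bar> * \<bar>y\<bar>" by simp
      ultimately show ?thesis unfolding abs_mult by linarith
    qed
    then show "AE \<omega> in M. norm (Y 0 \<omega> $ i * Y 0 \<omega> $ j) \<le> norm ((Y 0 \<omega> $ i)\<^sup>2 + (Y 0 \<omega> $ j)\<^sup>2)"
      by (auto intro!: AE_I2)
  qed
  have form: "a \<bullet> (C *v a) = expectation (\<lambda>\<omega>. (a \<bullet> T (H 0 \<omega> - mu))\<^sup>2)" for a
  proof -
    have "(a \<bullet> T (H 0 \<omega> - mu))\<^sup>2 = (\<Sum>i\<in>UNIV. \<Sum>j\<in>UNIV. a $ i * a $ j * (Y 0 \<omega> $ i * Y 0 \<omega> $ j))" for \<omega>
      unfolding Y_def[symmetric] by (simp add: power2_eq_square inner_vec_def sum_product mult_ac)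
    then have "expectation (\<lambda>\<omega>. (a \<bullet> T (H 0 \<omega> - mu))\<^sup>2) = (\<Sum>i\<in>UNIV. \<Sum>j\<in>UNIV. a $ i * a $ j * C $ i $ j)"
      using int by (simp add: C_def)
    then show ?thesis by (simp add: quad_form_sum)
  qed
  have "psd C"
    unfolding psd_def form by (simp add: C_def transpose_def vec_eq_iff mult.commute)
  then obtain L :: "(real ^ 'n) measure" where L: "prob_space L" "sets L = sets borel"
    "\<And>a. distr L borel (\<lambda>x. a \<bullet> x) = normal_law 0 (sqrt (a \<bullet> (C *v a)))"
    by (rule exists_multivariate_normal) blast
  have "(\<lambda>n. expectation (\<lambda>\<omega>. cos (a \<bullet> T (sqrt (real n) *\<^sub>R (mean n \<omega> - mu)) + b))) \<longlonglongrightarrow> (\<integral>x. cos (a \<bullet> x + b) \<partial>L)" for a b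
  proof -
    note D = linear_part[OF lin[of a]]
    have "(\<lambda>n. expectation (\<lambda>\<omega>. cos ((\<Sum>i<n. a \<bullet> T (H i \<omega> - mu)) / sqrt (real n) + b)))
        \<longlonglongrightarrow> (\<integral>x. cos (x + b) \<partial>normal_law 0 (sqrt (expectation (\<lambda>\<omega>. (a \<bullet> T (H 0 \<omega> - mu))\<^sup>2))))"
      by (rule clt_cos[OF D(1,2,3,5)])
    moreover have "(\<integral>x. cos (a \<bullet> x + b) \<partial>L) = (\<integral>x. cos (x + b) \<partial>distr L borel (\<lambda>x. a \<bullet> x))"
      using L(2) by (subst integral_distr) (auto cong: measurable_cong_sets)
    moreover have "(\<Sum>i<n. a \<bullet> T (H i \<omega> - mu)) / sqrt (real n) = a \<bullet> T (sqrt (real n) *\<^sub>R (mean n \<omega> - mu))" for n \<omega>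
    proof (cases "n = 0")
      case False
      have "(\<Sum>i<n. H i \<omega> - mu) = real n *\<^sub>R (mean n \<omega> - mu)"
        using False by (simp add: mean_def sum_subtractf scaleR_diff_right sum_constant_scaleR)
      then have "(\<Sum>i<n. a \<bullet> T (H i \<omega> - mu)) = real n * (a \<bullet> T (mean n \<omega> - mu))"
        by (metis T.scaleR T.sum inner_scaleR_right inner_sum_right)
      moreover have "real n / sqrt (real n) = sqrt (real n)" by (simp add: real_div_sqrt)
      ultimately have "(\<Sum>i<n. a \<bullet> T (H i \<omega> - mu)) / sqrt (real n) = sqrt (real n) * (a \<bullet> T (mean n \<omega> - mu))"
        by (metis times_divide_eq_left)
      then show ?thesis by (simp only: T.scaleR inner_scaleR_right)
    qed (simp add: T.zero)
    ultimately show ?thesis unfolding L(3) form by simp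
  qed
  then show ?thesis using L form that by auto
qed

section \<open>Delta method\<close>

text \<open>Near \<open>mu\<close> the remainder is at most \<open>k * norm (y - mu)\<close>.
  Multiplied by \<open>sqrt n\<close> this is \<open>k\<close> times a quantity that is bounded in
  probability, and \<open>k\<close> is arbitrarily small.\<close>

lemma delta_remainder:
  fixes \<Phi> :: "'e \<Rightarrow> 'c::euclidean_space"
  assumes [measurable]: "\<Phi> \<in> borel_measurable borel" and der: "(\<Phi> has_derivative T) (at mu)" and "0 < r"
  shows "(\<lambda>n. prob {\<omega> \<in> space M. r < norm (sqrt (real n) *\<^sub>R (\<Phi> (mean n \<omega>) - \<Phi> mu) - T (sqrt (real n) *\<^sub>R (mean n \<omega> - mu)))}) \<longlonglongrightarrow> 0"
proof -
  interpret T: bounded_linear T using der by (rule has_derivative_bounded_linear)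
  have [measurable]: "T \<in> borel_measurable borel"
    by (intro borel_measurable_continuous_onI linear_continuous_on T.bounded_linear)
  let ?A = "\<lambda>n. {\<omega> \<in> space M. r < norm (sqrt (real n) *\<^sub>R (\<Phi> (mean n \<omega>) - \<Phi> mu) - T (sqrt (real n) *\<^sub>R (mean n \<omega> - mu)))}"
  show ?thesis
  proof (rule LIMSEQ_I)
    fix e :: real assume "0 < e"
    \<comment> \<open>Chosen so that the Chebyshev bound \<open>V / (r / k)^2\<close> equals
      \<open>e / 2 * (V / (V + 1))\<close>; the summand 1 covers \<open>V = 0\<close> and makes the
      inequality strict.\<close>
    define k where "k = sqrt (e * r\<^sup>2 / (2 * (V + 1)))"
    have "0 < k" using \<open>0 < e\<close> \<open>0 < r\<close> V_nonneg by (simp add: k_def)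
    have kV: "V / (r / k)\<^sup>2 < e / 2"
    proof -
      have "k\<^sup>2 = e * r\<^sup>2 / (2 * (V + 1))" using \<open>0 < e\<close> V_nonneg by (simp add: k_def)
      then have "V / (r / k)\<^sup>2 = e / 2 * (V / (V + 1))" using \<open>0 < r\<close> V_nonneg by (simp add: power_divide)
      also have "\<dots> < e / 2 * 1" using \<open>0 < e\<close> V_nonneg by (intro mult_strict_left_mono) auto
      finally show ?thesis by simp
    qed
    obtain d where d: "d > 0" "\<And>y. norm (y - mu) < d \<Longrightarrow> norm (\<Phi> y - \<Phi> mu - T (y - mu)) \<le> k * norm (y - mu)"
      using der \<open>0 < k\<close> unfolding has_derivative_at_alt by blast
    have "\<forall>\<^sub>F n in sequentially. prob {\<omega> \<in> space M. d \<le> norm (mean n \<omega> - mu)} < e / 2"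
      using mean_consistent[OF d(1)] \<open>0 < e\<close> by (intro order_tendstoD) auto
    then have "\<forall>\<^sub>F n in sequentially. prob (?A n) < e"
      using eventually_gt_at_top[of 0]
    proof eventually_elim
      case (elim n)
      let ?B = "{\<omega> \<in> space M. d \<le> norm (mean n \<omega> - mu)}"
      let ?C = "{\<omega> \<in> space M. r / k \<le> sqrt (real n) * norm (mean n \<omega> - mu)}"
      have "?A n \<subseteq> ?B \<union> ?C"
      proof
        fix \<omega> assume \<omega>: "\<omega> \<in> ?A n"
        show "\<omega> \<in> ?B \<union> ?C"
        proof (cases "norm (mean n \<omega> - mu) < d")
          case True
          have "sqrt (real n) *\<^sub>R (\<Phi> (mean n \<omega>) - \<Phi> mu) - T (sqrt (real n) *\<^sub>R (mean n \<omega> - mu))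
              = sqrt (real n) *\<^sub>R (\<Phi> (mean n \<omega>) - \<Phi> mu - T (mean n \<omega> - mu))"
            by (subst T.scaleR) (rule scaleR_diff_right[symmetric])
          then have "r < sqrt (real n) * norm (\<Phi> (mean n \<omega>) - \<Phi> mu - T (mean n \<omega> - mu))"
            using \<omega> by simp
          also have "\<dots> \<le> sqrt (real n) * (k * norm (mean n \<omega> - mu))"
            by (intro mult_left_mono d(2) True) simp
          finally have "r / k \<le> sqrt (real n) * norm (mean n \<omega> - mu)"
            using \<open>0 < k\<close> by (simp add: field_simps)
          then show ?thesis using \<omega> by simp
        qed (use \<omega> in auto)
      qed
      then have 1: "prob (?A n) \<le> prob (?B \<union> ?C)" by (intro finite_measure_mono) measurable
      have 2: "prob (?B \<union> ?C) \<le> prob ?B + prob ?C" by (rule measure_Un_le) measurable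
      have 3: "prob ?C \<le> V / (r / k)\<^sup>2"
        using elim \<open>0 < r\<close> \<open>0 < k\<close> by (intro mean_tail) auto
      have "a < e" if "a \<le> b" "b \<le> c + d" "d \<le> v" "c < e / 2" "v < e / 2" for a b c d v :: real
        using that by linarith
      from this[OF 1 2 3 elim(1) kV] show ?case .
    qed
    then show "\<exists>no. \<forall>n\<ge>no. norm (prob (?A n) - 0) < e" by (simp add: eventually_sequentially)
  qed
qed

text \<open>Cosine is 1-Lipschitz and bounded by 1, so replacing \<open>X n\<close> by its linear
  part \<open>S n\<close> changes the expectation by at most \<open>norm a * r\<close> plus twice
  the probability that the remainder exceeds \<open>r\<close>. Tightness of \<open>X n\<close>
  follows from that of \<open>S n\<close> and of the remainder.\<close>

theorem delta_method:
  fixes \<Phi> :: "'e \<Rightarrow> real ^ 'n"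
  assumes meas[measurable]: "\<Phi> \<in> borel_measurable borel" and der: "(\<Phi> has_derivative T) (at mu)"
  obtains L :: "(real ^ 'n) measure" where
    "converges_in_distribution M (\<lambda>n \<omega>. sqrt (real n) *\<^sub>R (\<Phi> (mean n \<omega>) - \<Phi> mu)) L"
    "multivariate_normal 0 L"
    "\<And>i. prob_space.variance L (\<lambda>x. x $ i) = expectation (\<lambda>\<omega>. (T (H 0 \<omega> - mu) $ i)\<^sup>2)"
proof -
  have T: "bounded_linear T" using der by (rule has_derivative_bounded_linear)
  then interpret T: bounded_linear T .
  have [measurable]: "T \<in> borel_measurable borel"
    by (intro borel_measurable_continuous_onI linear_continuous_on T)
  obtain L :: "(real ^ 'n) measure" where L: "prob_space L" "sets L = sets borel"
    "\<And>a. distr L borel (\<lambda>x. a \<bullet> x) = normal_law 0 (sqrt (expectation (\<lambda>\<omega>. (a \<bullet> T (H 0 \<omega> - mu))\<^sup>2)))"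
    "\<And>a b. (\<lambda>n. expectation (\<lambda>\<omega>. cos (a \<bullet> T (sqrt (real n) *\<^sub>R (mean n \<omega> - mu)) + b))) \<longlonglongrightarrow> (\<integral>x. cos (a \<bullet> x + b) \<partial>L)"
    by (rule linear_clt[OF T]) blast
  define X where "X n \<omega> = sqrt (real n) *\<^sub>R (\<Phi> (mean n \<omega>) - \<Phi> mu)" for n \<omega>
  define S where "S n \<omega> = T (sqrt (real n) *\<^sub>R (mean n \<omega> - mu))" for n \<omega>
  have [measurable]: "X n \<in> borel_measurable M" "S n \<in> borel_measurable M" for n
    unfolding X_def S_def by measurable
  have rem: "(\<lambda>n. prob {\<omega> \<in> space M. r < norm (X n \<omega> - S n \<omega>)}) \<longlonglongrightarrow> 0" if "0 < r" for r
    using delta_remainder[OF meas der that] unfolding X_def S_def .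
  have "converges_in_distribution M X L"
  proof (rule converges_in_distribution_cos[OF _ L(1,2)])
    fix a :: "real ^ 'n" and b :: real
    have "(\<lambda>n. expectation (\<lambda>\<omega>. cos (a \<bullet> X n \<omega> + b)) - expectation (\<lambda>\<omega>. cos (a \<bullet> S n \<omega> + b))) \<longlonglongrightarrow> 0"
    proof (rule LIMSEQ_I)
      fix e :: real assume "0 < e"
      define r where "r = e / (2 * (norm a + 1))"
      have "0 < r" using \<open>0 < e\<close> by (simp add: r_def add_nonneg_pos)
      have ar: "norm a * r \<le> e / 2"
      proof -
        have "r * (2 * (norm a + 1)) = e" by (simp add: r_def add_nonneg_eq_0_iff)
        then show ?thesis using \<open>0 < r\<close> by (simp add: algebra_simps)
      qed
      have "\<forall>\<^sub>F n in sequentially. prob {\<omega> \<in> space M. r < norm (X n \<omega> - S n \<omega>)} < e / 4"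
        using rem[OF \<open>0 < r\<close>] \<open>0 < e\<close> by (intro order_tendstoD) auto
      then have "\<forall>\<^sub>F n in sequentially. \<bar>expectation (\<lambda>\<omega>. cos (a \<bullet> X n \<omega> + b)) - expectation (\<lambda>\<omega>. cos (a \<bullet> S n \<omega> + b))\<bar> < e"
      proof eventually_elim
        case (elim n)
        have "integrable M (\<lambda>\<omega>. cos (a \<bullet> X n \<omega> + b))" "integrable M (\<lambda>\<omega>. cos (a \<bullet> S n \<omega> + b))"
          by (auto intro!: integrable_const_bound[of _ 1])
        then have "expectation (\<lambda>\<omega>. cos (a \<bullet> X n \<omega> + b)) - expectation (\<lambda>\<omega>. cos (a \<bullet> S n \<omega> + b))
            = expectation (\<lambda>\<omega>. cos (a \<bullet> X n \<omega> + b) - cos (a \<bullet> S n \<omega> + b))" by simp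
        moreover have "\<bar>expectation (\<lambda>\<omega>. cos (a \<bullet> X n \<omega> + b) - cos (a \<bullet> S n \<omega> + b))\<bar>
            \<le> e / 2 + 2 * prob {\<omega> \<in> space M. r < norm (X n \<omega> - S n \<omega>)}"
        proof (rule integral_diff_bound)
          show "\<bar>cos (a \<bullet> X n \<omega> + b) - cos (a \<bullet> S n \<omega> + b)\<bar> \<le> 2" for \<omega>
            using abs_cos_le_one[of "a \<bullet> X n \<omega> + b"] abs_cos_le_one[of "a \<bullet> S n \<omega> + b"] by linarith
          fix \<omega> assume "\<not> r < norm (X n \<omega> - S n \<omega>)"
          then have "norm a * norm (X n \<omega> - S n \<omega>) \<le> norm a * r" by (intro mult_left_mono) auto
          moreover have "\<bar>a \<bullet> (X n \<omega> - S n \<omega>)\<bar> \<le> norm a * norm (X n \<omega> - S n \<omega>)"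
            by (rule Cauchy_Schwarz_ineq2)
          moreover have "\<bar>cos x - cos y\<bar> \<le> \<bar>x - y\<bar>" for x y :: real
          proof -
            have "\<bar>cos x - cos y\<bar> = 2 * (\<bar>sin ((x + y) / 2)\<bar> * \<bar>sin ((y - x) / 2)\<bar>)"
              by (simp add: cos_diff_cos abs_mult)
            also have "\<dots> \<le> 2 * (1 * \<bar>(y - x) / 2\<bar>)"
              by (intro mult_left_mono mult_mono abs_sin_le_one abs_sin_x_le_abs_x) auto
            finally show ?thesis by simp
          qed
          from this[of "a \<bullet> X n \<omega> + b" "a \<bullet> S n \<omega> + b"]
          have "\<bar>cos (a \<bullet> X n \<omega> + b) - cos (a \<bullet> S n \<omega> + b)\<bar> \<le> \<bar>a \<bullet> (X n \<omega> - S n \<omega>)\<bar>"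
            by (simp add: inner_diff_right)
          ultimately show "\<bar>cos (a \<bullet> X n \<omega> + b) - cos (a \<bullet> S n \<omega> + b)\<bar> \<le> e / 2"
            using ar by linarith
        qed (use \<open>0 < e\<close> in auto)
        ultimately show ?case using elim by linarith
      qed
      then show "\<exists>no. \<forall>n\<ge>no. norm (expectation (\<lambda>\<omega>. cos (a \<bullet> X n \<omega> + b)) - expectation (\<lambda>\<omega>. cos (a \<bullet> S n \<omega> + b)) - 0) < e"
        by (simp add: eventually_sequentially)
    qed
    from tendsto_add[OF this L(4)[of a b]]
    show "(\<lambda>n. expectation (\<lambda>\<omega>. cos (a \<bullet> X n \<omega> + b))) \<longlonglongrightarrow> (\<integral>x. cos (a \<bullet> x + b) \<partial>L)"
      by (simp add: S_def)
  next
    fix e :: real assume "0 < e"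
    obtain K where K: "K > 0" "\<And>x. norm (T x) \<le> norm x * K" using T.pos_bounded by blast
    \<comment> \<open>Chebyshev at level \<open>q\<close> leaves mass below \<open>e / 2\<close>. In
      the radius \<open>q * K + 1\<close> used below, \<open>q * K\<close> bounds the linear part
      and 1 allows for the remainder.\<close>
    define q where "q = sqrt (2 * (V + 1) / e)"
    have "0 < q" using \<open>0 < e\<close> V_nonneg by (simp add: q_def)
    have Vq: "V / q\<^sup>2 < e / 2"
    proof -
      have "q\<^sup>2 = 2 * (V + 1) / e" using \<open>0 < e\<close> V_nonneg by (simp add: q_def)
      then have "V / q\<^sup>2 = e / 2 * (V / (V + 1))" using \<open>0 < e\<close> V_nonneg by simp
      also have "\<dots> < e / 2 * 1" using \<open>0 < e\<close> V_nonneg by (intro mult_strict_left_mono) auto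
      finally show ?thesis by simp
    qed
    have "\<forall>\<^sub>F n in sequentially. prob {\<omega> \<in> space M. 1 < norm (X n \<omega> - S n \<omega>)} < e / 2"
      using rem[of 1] \<open>0 < e\<close> by (intro order_tendstoD) auto
    then have "\<forall>\<^sub>F n in sequentially. prob {\<omega> \<in> space M. q * K + 1 < norm (X n \<omega>)} < e"
      using eventually_gt_at_top[of 0]
    proof eventually_elim
      case (elim n)
      let ?B = "{\<omega> \<in> space M. 1 < norm (X n \<omega> - S n \<omega>)}"
      let ?C = "{\<omega> \<in> space M. q \<le> sqrt (real n) * norm (mean n \<omega> - mu)}"
      have "{\<omega> \<in> space M. q * K + 1 < norm (X n \<omega>)} \<subseteq> ?B \<union> ?C"
      proof
        fix \<omega> assume \<omega>: "\<omega> \<in> {\<omega> \<in> space M. q * K + 1 < norm (X n \<omega>)}"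
        show "\<omega> \<in> ?B \<union> ?C"
        proof (rule ccontr)
          assume "\<omega> \<notin> ?B \<union> ?C"
          then have 1: "norm (X n \<omega> - S n \<omega>) \<le> 1" "sqrt (real n) * norm (mean n \<omega> - mu) \<le> q"
            using \<omega> by auto
          have "norm (S n \<omega>) \<le> (sqrt (real n) * norm (mean n \<omega> - mu)) * K"
            using K(2)[of "sqrt (real n) *\<^sub>R (mean n \<omega> - mu)"] unfolding S_def by simp
          also have "\<dots> \<le> q * K" using 1(2) K(1) by (intro mult_right_mono) auto
          finally have "norm (X n \<omega>) \<le> q * K + 1"
            using 1(1) norm_triangle_sub[of "X n \<omega>" "S n \<omega>"] by linarith
          then show False using \<omega> by simp
        qed
      qed
      then have 1: "prob {\<omega> \<in> space M. q * K + 1 < norm (X n \<omega>)} \<le> prob (?B \<union> ?C)" by (intro finite_measure_mono) measurable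
      have 2: "prob (?B \<union> ?C) \<le> prob ?B + prob ?C" by (rule measure_Un_le) measurable
      have 3: "prob ?C \<le> V / q\<^sup>2" using elim \<open>0 < q\<close> by (intro mean_tail) auto
      have "a < e" if "a \<le> b" "b \<le> c + d" "d \<le> v" "c < e / 2" "v < e / 2" for a b c d v :: real
        using that by linarith
      from this[OF 1 2 3 elim(1) Vq] show ?case .
    qed
    then show "\<exists>R. \<forall>\<^sub>F n in sequentially. prob {\<omega> \<in> space M. R < norm (X n \<omega>)} < e" by blast
  qed measurable
  moreover have "multivariate_normal 0 L"
    unfolding multivariate_normal_def
  proof (intro conjI allI L(2))
    fix a :: "real ^ 'n"
    show "\<exists>\<sigma>\<ge>0. distr L borel (\<lambda>x. a \<bullet> x) = normal_law (a \<bullet> 0) \<sigma>"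
      by (rule exI[of _ "sqrt (expectation (\<lambda>\<omega>. (a \<bullet> T (H 0 \<omega> - mu))\<^sup>2))"]) (simp add: L(3))
  qed
  moreover have "prob_space.variance L (\<lambda>x. x $ i) = expectation (\<lambda>\<omega>. (T (H 0 \<omega> - mu) $ i)\<^sup>2)" for i
  proof -
    have eq: "axis i 1 \<bullet> x = x $ i" for x :: "real ^ 'n" by (simp add: inner_axis')
    have "distr L borel (\<lambda>x. x $ i) = normal_law 0 (sqrt (expectation (\<lambda>\<omega>. (T (H 0 \<omega> - mu) $ i)\<^sup>2)))"
      using L(3)[of "axis i 1"] by (simp add: eq)
    from normal_law_variance[OF L(2) this] show ?thesis
      using L(2) by (auto cong: measurable_cong_sets)
  qed
  ultimately show ?thesis using that unfolding X_def[abs_def] by blast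
qed

lemma delta_consistent:
  fixes \<Phi> :: "'e \<Rightarrow> 'c::euclidean_space"
  assumes [measurable]: "\<Phi> \<in> borel_measurable borel" and cont: "isCont \<Phi> mu"
  shows "converges_in_prob M (\<lambda>n \<omega>. \<Phi> (mean n \<omega>)) (\<Phi> mu)"
  unfolding converges_in_prob_def
proof (intro allI impI)
  fix e :: real assume "0 < e"
  obtain d where d: "d > 0" "\<And>y. dist y mu < d \<Longrightarrow> dist (\<Phi> y) (\<Phi> mu) < e"
    using cont \<open>0 < e\<close> unfolding continuous_at_eps_delta by blast
  have "prob {\<omega> \<in> space M. dist (\<Phi> (mean n \<omega>)) (\<Phi> mu) > e} \<le> prob {\<omega> \<in> space M. d \<le> norm (mean n \<omega> - mu)}" for n
    by (rule finite_measure_mono) (use d(2) in \<open>force simp: dist_norm not_less[symmetric]\<close>, measurable)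
  then show "(\<lambda>n. prob {\<omega> \<in> space M. dist (\<Phi> (mean n \<omega>)) (\<Phi> mu) > e}) \<longlonglongrightarrow> 0"
    by (intro tendsto_sandwich[OF _ _ tendsto_const mean_consistent[OF d(1)]]) auto
qed

end

section \<open>Moments and the objective\<close>

text \<open>Full tensors of orders one to four without any symmetry constraint, so that moment space
  is a Euclidean space and derivatives need no tangent conditions. Most of its points are not
  moments of a distribution.\<close>

type_synonym 'p moments =
  "(real ^ 'p) \<times> (real ^ 'p ^ 'p) \<times> (real ^ 'p ^ 'p ^ 'p) \<times> (real ^ 'p ^ 'p ^ 'p ^ 'p)"

definition raw1 :: "'p::finite moments \<Rightarrow> 'p \<Rightarrow> real" where "raw1 m a = fst m $ a"
definition raw2 :: "'p::finite moments \<Rightarrow> 'p \<Rightarrow> 'p \<Rightarrow> real" where "raw2 m a b = fst (snd m) $ a $ b"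
definition raw3 :: "'p::finite moments \<Rightarrow> 'p \<Rightarrow> 'p \<Rightarrow> 'p \<Rightarrow> real" where
  "raw3 m a b c = fst (snd (snd m)) $ a $ b $ c"
definition raw4 :: "'p::finite moments \<Rightarrow> 'p \<Rightarrow> 'p \<Rightarrow> 'p \<Rightarrow> 'p \<Rightarrow> real" where
  "raw4 m a b c d = snd (snd (snd m)) $ a $ b $ c $ d"

lemma bounded_linear_raw1: "bounded_linear (\<lambda>m. raw1 m a)"
  unfolding raw1_def by (intro bounded_linear_compose[OF bounded_linear_vec_nth] bounded_linear_fst)
lemma bounded_linear_raw2: "bounded_linear (\<lambda>m. raw2 m a b)"
  unfolding raw2_def by (intro bounded_linear_compose[OF bounded_linear_vec_nth]
    bounded_linear_compose[OF bounded_linear_fst] bounded_linear_snd)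
lemma bounded_linear_raw3: "bounded_linear (\<lambda>m. raw3 m a b c)"
  unfolding raw3_def by (intro bounded_linear_compose[OF bounded_linear_vec_nth]
    bounded_linear_compose[OF bounded_linear_fst] bounded_linear_compose[OF bounded_linear_snd] bounded_linear_snd)
lemma bounded_linear_raw4: "bounded_linear (\<lambda>m. raw4 m a b c d)"
  unfolding raw4_def by (intro bounded_linear_compose[OF bounded_linear_vec_nth]
    bounded_linear_compose[OF bounded_linear_snd] bounded_linear_snd)

lemmas raw_has_derivative [derivative_intros] =
  bounded_linear.has_derivative[OF bounded_linear_raw1] bounded_linear.has_derivative[OF bounded_linear_raw2]
  bounded_linear.has_derivative[OF bounded_linear_raw3] bounded_linear.has_derivative[OF bounded_linear_raw4]
lemmas raw_continuous_on [continuous_intros] =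
  bounded_linear.continuous_on[OF bounded_linear_raw1] bounded_linear.continuous_on[OF bounded_linear_raw2]
  bounded_linear.continuous_on[OF bounded_linear_raw3] bounded_linear.continuous_on[OF bounded_linear_raw4]

text \<open>The second moments are symmetrized so that \<open>cm2\<close> is symmetric on the whole moment space, not
  only at attained moments.\<close>

definition cm2 :: "'p::finite moments \<Rightarrow> 'p \<Rightarrow> 'p \<Rightarrow> real" where
  "cm2 m a b = (raw2 m a b + raw2 m b a) / 2 - raw1 m a * raw1 m b"

definition cm3 :: "'p::finite moments \<Rightarrow> 'p \<Rightarrow> 'p \<Rightarrow> 'p \<Rightarrow> real" where
  "cm3 m a b c = raw3 m a b c - raw2 m a b * raw1 m c - raw2 m a c * raw1 m b - raw2 m b c * raw1 m a
    + 2 * raw1 m a * raw1 m b * raw1 m c"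

definition cm4 :: "'p::finite moments \<Rightarrow> 'p \<Rightarrow> 'p \<Rightarrow> 'p \<Rightarrow> 'p \<Rightarrow> real" where
  "cm4 m a b c d = raw4 m a b c d
    - raw3 m a b c * raw1 m d - raw3 m a b d * raw1 m c - raw3 m a c d * raw1 m b - raw3 m b c d * raw1 m a
    + raw2 m a b * raw1 m c * raw1 m d + raw2 m a c * raw1 m b * raw1 m d + raw2 m a d * raw1 m b * raw1 m c
    + raw2 m b c * raw1 m a * raw1 m d + raw2 m b d * raw1 m a * raw1 m c + raw2 m c d * raw1 m a * raw1 m b
    - 3 * raw1 m a * raw1 m b * raw1 m c * raw1 m d"

definition cov_of :: "'p::finite moments \<Rightarrow> real ^ 'p ^ 'p" where
  "cov_of m = (\<chi> a b. cm2 m a b)"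

definition ml2 :: "('p::finite \<Rightarrow> 'p \<Rightarrow> real) \<Rightarrow> real ^ 'p \<Rightarrow> real ^ 'p \<Rightarrow> real" where
  "ml2 C u v = (\<Sum>a\<in>UNIV. \<Sum>b\<in>UNIV. C a b * u $ a * v $ b)"
definition ml3 :: "('p::finite \<Rightarrow> 'p \<Rightarrow> 'p \<Rightarrow> real) \<Rightarrow> real ^ 'p \<Rightarrow> real ^ 'p \<Rightarrow> real ^ 'p \<Rightarrow> real" where
  "ml3 C u v w = (\<Sum>a\<in>UNIV. \<Sum>b\<in>UNIV. \<Sum>c\<in>UNIV. C a b c * u $ a * v $ b * w $ c)"
definition ml4 :: "('p::finite \<Rightarrow> 'p \<Rightarrow> 'p \<Rightarrow> 'p \<Rightarrow> real) \<Rightarrow>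
    real ^ 'p \<Rightarrow> real ^ 'p \<Rightarrow> real ^ 'p \<Rightarrow> real ^ 'p \<Rightarrow> real" where
  "ml4 C u v w x = (\<Sum>a\<in>UNIV. \<Sum>b\<in>UNIV. \<Sum>c\<in>UNIV. \<Sum>d\<in>UNIV. C a b c d * u $ a * v $ b * w $ c * x $ d)"

lemma ml2_has_derivative:
  assumes "\<And>a b. ((\<lambda>x. C x a b) has_derivative (\<lambda>h. C' h a b)) (at x)"
    and "(u has_derivative u') (at x)" "(v has_derivative v') (at x)"
  shows "((\<lambda>x. ml2 (C x) (u x) (v x)) has_derivative
    (\<lambda>h. ml2 (C' h) (u x) (v x) + ml2 (C x) (u' h) (v x) + ml2 (C x) (u x) (v' h))) (at x)"
  unfolding ml2_def
  by (rule has_derivative_eq_rhs)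
    ((rule has_derivative_sum has_derivative_mult assms bounded_linear.has_derivative[OF bounded_linear_vec_nth])+,
      simp add: sum.distrib algebra_simps)

lemma ml3_has_derivative:
  assumes "\<And>a b c. ((\<lambda>x. C x a b c) has_derivative (\<lambda>h. C' h a b c)) (at x)"
    and "(u has_derivative u') (at x)" "(v has_derivative v') (at x)" "(w has_derivative w') (at x)"
  shows "((\<lambda>x. ml3 (C x) (u x) (v x) (w x)) has_derivative
    (\<lambda>h. ml3 (C' h) (u x) (v x) (w x) + ml3 (C x) (u' h) (v x) (w x)
      + ml3 (C x) (u x) (v' h) (w x) + ml3 (C x) (u x) (v x) (w' h))) (at x)"
  unfolding ml3_def
  by (rule has_derivative_eq_rhs)
    ((rule has_derivative_sum has_derivative_mult assms bounded_linear.has_derivative[OF bounded_linear_vec_nth])+,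
      simp add: sum.distrib algebra_simps)

lemma ml4_has_derivative:
  assumes "\<And>a b c d. ((\<lambda>x. C x a b c d) has_derivative (\<lambda>h. C' h a b c d)) (at x)"
    and "(u has_derivative u') (at x)" "(v has_derivative v') (at x)" "(w has_derivative w') (at x)"
    and "(y has_derivative y') (at x)"
  shows "((\<lambda>x. ml4 (C x) (u x) (v x) (w x) (y x)) has_derivative
    (\<lambda>h. ml4 (C' h) (u x) (v x) (w x) (y x) + ml4 (C x) (u' h) (v x) (w x) (y x)
      + ml4 (C x) (u x) (v' h) (w x) (y x) + ml4 (C x) (u x) (v x) (w' h) (y x)
      + ml4 (C x) (u x) (v x) (w x) (y' h))) (at x)"
  unfolding ml4_def
  by (rule has_derivative_eq_rhs)
    ((rule has_derivative_sum has_derivative_mult assms bounded_linear.has_derivative[OF bounded_linear_vec_nth])+,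
      simp add: sum.distrib algebra_simps)

lemma axis_nth_if: "axis k (1::real) $ a = (if a = k then 1 else 0)"
  by (simp add: axis_def)

lemma sum_delta_mult [simp]:
  fixes f :: "'p::finite \<Rightarrow> real"
  shows "(\<Sum>a\<in>UNIV. f a * (if a = k then 1 else 0)) = f k"
  by (simp add: if_distrib cong: if_cong)

lemma multilinear_axis:
  "ml2 C (axis a 1) (axis b 1) = C a b"
  "ml3 C' (axis a 1) (axis b 1) (axis c 1) = C' a b c"
  "ml4 C'' (axis a 1) (axis b 1) (axis c 1) (axis d 1) = C'' a b c d"
  unfolding ml2_def ml3_def ml4_def axis_nth_if
  by (simp_all add: sum_distrib_right[symmetric] del: mult_if_delta)

lemma multilinear_zero [simp]:
  "ml3 (\<lambda>_ _ _. 0) u v w = 0" "ml4 (\<lambda>_ _ _ _. 0) u v w x = 0"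
  by (simp_all add: ml3_def ml4_def)

lemma ml3_scale: "ml3 C (c *\<^sub>R w) (c *\<^sub>R w) (c *\<^sub>R w) = c ^ 3 * ml3 C w w w"
  by (simp add: ml3_def sum_distrib_left power3_eq_cube mult_ac)

lemma ml4_scale: "ml4 C (c *\<^sub>R w) (c *\<^sub>R w) (c *\<^sub>R w) (c *\<^sub>R w) = c ^ 4 * ml4 C w w w w"
  by (simp add: ml4_def sum_distrib_left power4_eq_xxxx mult_ac)

text \<open>The derivative of the cubic form at \<open>w\<close> along \<open>v\<close>. The
  placements of \<open>v\<close> are listed separately because the tensors need not be
  symmetric.\<close>

definition dq3 :: "('p::finite \<Rightarrow> 'p \<Rightarrow> 'p \<Rightarrow> real) \<Rightarrow> real ^ 'p \<Rightarrow> real ^ 'p \<Rightarrow> real" where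
  "dq3 C w v = ml3 C v w w + ml3 C w v w + ml3 C w w v"
definition dq4 :: "('p::finite \<Rightarrow> 'p \<Rightarrow> 'p \<Rightarrow> 'p \<Rightarrow> real) \<Rightarrow> real ^ 'p \<Rightarrow> real ^ 'p \<Rightarrow> real" where
  "dq4 C w v = ml4 C v w w w + ml4 C w v w w + ml4 C w w v w + ml4 C w w w v"

section \<open>The objective, its stationarity conditions and its symmetries\<close>

definition row_obj :: "real \<Rightarrow> 'p::finite moments \<Rightarrow> real ^ 'p \<Rightarrow> real" where
  "row_obj \<alpha> m w = \<alpha> * (ml3 (cm3 m) w w w)\<^sup>2 + (1 - \<alpha>) * (ml4 (cm4 m) w w w w - 3)\<^sup>2"

definition objective :: "real \<Rightarrow> 'p::finite moments \<Rightarrow> real ^ 'p ^ 'p \<Rightarrow> real" where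
  "objective \<alpha> m W = (\<Sum>k\<in>UNIV. row_obj \<alpha> m (W $ k))"

text \<open>Half the derivative of \<open>row_obj\<close> at \<open>w\<close> along
  \<open>v\<close>; the factor 2 from the squares is left out.\<close>

definition grad :: "real \<Rightarrow> 'p::finite moments \<Rightarrow> real ^ 'p \<Rightarrow> real ^ 'p \<Rightarrow> real" where
  "grad \<alpha> m w v = \<alpha> * (ml3 (cm3 m) w w w * dq3 (cm3 m) w v)
    + (1 - \<alpha>) * ((ml4 (cm4 m) w w w w - 3) * dq4 (cm4 m) w v)"

lemma row_obj_has_derivative:
  assumes "(w has_derivative w') (at x)"
  shows "((\<lambda>x. row_obj \<alpha> m (w x)) has_derivative (\<lambda>h. 2 * grad \<alpha> m (w x) (w' h))) (at x)"
proof -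
  have 3: "((\<lambda>x. ml3 (cm3 m) (w x) (w x) (w x)) has_derivative (\<lambda>h. dq3 (cm3 m) (w x) (w' h))) (at x)"
    by (rule has_derivative_eq_rhs, rule ml3_has_derivative[where C' = "\<lambda>_ _ _ _. 0"])
      (auto intro: assms simp: dq3_def)
  have 4: "((\<lambda>x. ml4 (cm4 m) (w x) (w x) (w x) (w x)) has_derivative (\<lambda>h. dq4 (cm4 m) (w x) (w' h))) (at x)"
    by (rule has_derivative_eq_rhs, rule ml4_has_derivative[where C' = "\<lambda>_ _ _ _ _. 0"])
      (auto intro: assms simp: dq4_def)
  show ?thesis unfolding row_obj_def grad_def
    by (rule has_derivative_eq_rhs, (rule derivative_intros 3 4)+) (auto simp: algebra_simps)
qed

lemma grad_minus: "grad \<alpha> m w (- v) = - grad \<alpha> m w v"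
proof -
  have "dq3 C w (- v) = - dq3 C w v" "dq4 D w (- v) = - dq4 D w v" for C D
    by (simp_all add: dq3_def dq4_def ml3_def ml4_def sum_negf)
  then show ?thesis by (simp add: grad_def algebra_simps)
qed

lemma grad_scale_left: "grad \<alpha> m w (c *\<^sub>R v) = c * grad \<alpha> m w v"
proof -
  have "dq3 C w (c *\<^sub>R v) = c * dq3 C w v" "dq4 D w (c *\<^sub>R v) = c * dq4 D w v" for C D
    by (simp_all add: dq3_def dq4_def ml3_def ml4_def sum_distrib_left algebra_simps)
  then show ?thesis by (simp add: grad_def algebra_simps)
qed

text \<open>Rotating in the plane of rows \<open>k\<close> and \<open>l\<close> moves them along
  \<open>W $ l\<close> and \<open>- W $ k\<close>; at a maximum the two first-order contributions
  cancel. Orthogonality of \<open>W\<close> does not enter, so \<open>W\<close> may be an orthogonal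
  matrix times the whitener.\<close>

lemma grad_symmetric_at_max:
  assumes "k \<noteq> l" and max: "\<And>t. objective \<alpha> m (rotate_rows k l t W) \<le> objective \<alpha> m W"
  shows "grad \<alpha> m (W $ k) (W $ l) = grad \<alpha> m (W $ l) (W $ k)"
proof -
  define g where "g t = row_obj \<alpha> m (cos t *\<^sub>R W $ k + sin t *\<^sub>R W $ l)
    + row_obj \<alpha> m (cos t *\<^sub>R W $ l - sin t *\<^sub>R W $ k)" for t
  have objective: "objective \<alpha> m (rotate_rows k l t W) = g t + (\<Sum>j\<in>UNIV - {k, l}. row_obj \<alpha> m (W $ j))" for t
  proof -
    have "objective \<alpha> m (rotate_rows k l t W) = (\<Sum>j\<in>{k, l}. row_obj \<alpha> m (rotate_rows k l t W $ j)) + (\<Sum>j\<in>UNIV - {k, l}. row_obj \<alpha> m (rotate_rows k l t W $ j))"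
      unfolding objective_def by (simp add: sum.subset_diff[of "{k,l}" UNIV] add.commute)
    also have "(\<Sum>j\<in>UNIV - {k, l}. row_obj \<alpha> m (rotate_rows k l t W $ j)) = (\<Sum>j\<in>UNIV - {k, l}. row_obj \<alpha> m (W $ j))"
      by (intro sum.cong) (auto simp: rotate_rows_def)
    finally show ?thesis using \<open>k \<noteq> l\<close> by (simp add: rotate_rows_def g_def)
  qed
  have "rotate_rows k l 0 W = W" by (simp add: rotate_rows_def vec_eq_iff)
  then have "g t \<le> g 0" for t using max[of t] objective[of t] objective[of 0] by simp
  moreover
  have "((\<lambda>t. row_obj \<alpha> m (cos t *\<^sub>R W $ k + sin t *\<^sub>R W $ l)) has_derivative
      (\<lambda>h. 2 * grad \<alpha> m (cos 0 *\<^sub>R W $ k + sin 0 *\<^sub>R W $ l) (h *\<^sub>R W $ l))) (at 0)"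
    by (rule row_obj_has_derivative) (auto intro!: derivative_eq_intros)
  moreover have "((\<lambda>t. row_obj \<alpha> m (cos t *\<^sub>R W $ l - sin t *\<^sub>R W $ k)) has_derivative
      (\<lambda>h. 2 * grad \<alpha> m (cos 0 *\<^sub>R W $ l - sin 0 *\<^sub>R W $ k) (h *\<^sub>R (- W $ k)))) (at 0)"
    by (rule row_obj_has_derivative) (auto intro!: derivative_eq_intros)
  ultimately have "(g has_derivative (\<lambda>h. 2 * grad \<alpha> m (W $ k) (h *\<^sub>R W $ l) + 2 * grad \<alpha> m (W $ l) (h *\<^sub>R (- W $ k)))) (at 0)"
    unfolding g_def by (intro has_derivative_add) auto
  then have "(g has_real_derivative (2 * (grad \<alpha> m (W $ k) (W $ l) - grad \<alpha> m (W $ l) (W $ k)))) (at 0)"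
    unfolding has_field_derivative_def grad_scale_left grad_minus
    by (rule has_derivative_eq_rhs) (auto simp: algebra_simps)
  then have "2 * (grad \<alpha> m (W $ k) (W $ l) - grad \<alpha> m (W $ l) (W $ k)) = 0"
    using \<open>\<And>t. g t \<le> g 0\<close> by (intro DERIV_local_max[of g _ 0 1]) auto
  then show ?thesis by simp
qed

text \<open>The whitener is a free parameter next to the moments. This makes the objective
  continuous on the whole parameter space, including points whose covariance has no inverse
  root.\<close>

lemma continuous_objective:
  "continuous_on UNIV (\<lambda>(\<theta> :: (real ^ 'p ^ 'p) \<times> 'p::finite moments, U). objective \<alpha> (snd \<theta>) (U ** fst \<theta>))"
  unfolding objective_def row_obj_def ml3_def ml4_def cm3_def cm4_def matrix_matrix_mult_def case_prod_beta
  by (simp, intro continuous_intros)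

definition signed_permute :: "('p::finite \<Rightarrow> 'p) \<Rightarrow> ('p \<Rightarrow> real) \<Rightarrow> real ^ 'p ^ 'p \<Rightarrow> real ^ 'p ^ 'p" where
  "signed_permute \<sigma> s U = (\<chi> j. s j *\<^sub>R U $ \<sigma> j)"

lemma signed_permute_mult: "signed_permute \<sigma> s U ** R = signed_permute \<sigma> s (U ** R)"
  by (subst vec_eq_iff) (simp add: signed_permute_def vec_mult_matrix_nth scaleR_sum_right)

lemma orthogonal_signed_permute:
  assumes "orthogonal_matrix U" "inj \<sigma>" "\<And>j. s j * s j = 1"
  shows "orthogonal_matrix (signed_permute \<sigma> s U)"
  using assms by (auto simp: orthogonal_matrix_rows signed_permute_def inj_eq)

text \<open>Signs disappear because the cubic form is squared and the quartic form is even; a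
  permutation only reorders the sum over rows.\<close>

lemma objective_signed_permute:
  assumes "bij \<sigma>" "\<And>j. s j * s j = 1"
  shows "objective \<alpha> m (signed_permute \<sigma> s W) = objective \<alpha> m W"
proof -
  have "row_obj \<alpha> m (s j *\<^sub>R w) = row_obj \<alpha> m w" for j w
  proof -
    have "(s j ^ 3)\<^sup>2 = 1" "s j ^ 4 = 1"
      using assms(2)[of j] by (simp_all add: power2_eq_square power3_eq_cube power4_eq_xxxx)
    then show ?thesis by (simp add: row_obj_def ml3_scale ml4_scale power_mult_distrib)
  qed
  then have "objective \<alpha> m (signed_permute \<sigma> s W) = (\<Sum>j\<in>UNIV. row_obj \<alpha> m (W $ \<sigma> j))"
    by (simp add: objective_def signed_permute_def)
  also have "\<dots> = objective \<alpha> m W"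
    unfolding objective_def using assms(1) by (rule sum.reindex_bij_betw)
  finally show ?thesis .
qed

lemma dist_signed_permute:
  assumes "bij \<sigma>" "\<And>j. s j * s j = 1"
  shows "dist (signed_permute \<sigma> s U) (signed_permute \<sigma> s V) = dist U V"
proof -
  have "s j = 1 \<or> s j = - 1" for j using assms(2)[of j] by (metis square_eq_1_iff)
  then have "\<bar>s j\<bar> = 1" for j by (metis abs_minus_cancel abs_one)
  then have "norm (s j *\<^sub>R U $ \<sigma> j - s j *\<^sub>R V $ \<sigma> j) = norm (U $ \<sigma> j - V $ \<sigma> j)" for j
    by (simp add: scaleR_diff_right[symmetric] del: scaleR_diff_right)
  then have "L2_set (\<lambda>j. norm ((signed_permute \<sigma> s U - signed_permute \<sigma> s V) $ j)) UNIV = L2_set (\<lambda>j. norm ((U - V) $ \<sigma> j)) UNIV"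
    by (simp add: signed_permute_def)
  also have "\<dots> = L2_set (\<lambda>j. norm ((U - V) $ j)) UNIV"
    unfolding L2_set_def by (rule arg_cong[of _ _ sqrt], rule sum.reindex_bij_betw[OF assms(1)])
  finally show ?thesis by (simp add: dist_norm norm_vec_def)
qed

text \<open>Existence and continuity of the solution \<open>f\<close> are given, so
  differentiability of \<open>G\<close> at the single point suffices. The partial derivative in the
  unknown is diagonal with entries \<open>c i\<close>, which inverts equation by equation.\<close>

lemma implicit_derivative:
  fixes f :: "'a::real_normed_vector \<Rightarrow> real ^ 'q"
  assumes der: "\<And>i. (G i has_derivative (\<lambda>h. c i * fst h $ i + B i (snd h))) (at (f y0, y0))"
    and c: "\<And>i. c i \<noteq> 0" and cont: "isCont f y0"
    and zero: "\<forall>\<^sub>F y in nhds y0. \<forall>i. G i (f y, y) = 0"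
  shows "(f has_derivative (\<lambda>d. \<chi> i. - B i d / c i)) (at y0)"
proof -
  define T where "T d = (\<chi> i. - B i d / c i)" for d
  have B: "bounded_linear (B i)" for i
  proof -
    have "bounded_linear (\<lambda>d. c i * fst (0 :: real ^ 'q, d) $ i + B i (snd (0 :: real ^ 'q, d)))"
      by (rule bounded_linear_compose[OF has_derivative_bounded_linear[OF der]])
        (intro bounded_linear_Pair bounded_linear_zero bounded_linear_ident)
    then show ?thesis by simp
  qed
  have "bounded_linear (\<lambda>d. \<Sum>i\<in>UNIV. B i d *\<^sub>R ((- 1 / c i) *\<^sub>R axis i (1::real)))"
    by (intro bounded_linear_sum bounded_linear_compose[OF bounded_linear_scaleR_left] B)
  moreover have T_sum: "T d = (\<Sum>i\<in>UNIV. B i d *\<^sub>R ((- 1 / c i) *\<^sub>R axis i 1))" for d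
    by (simp add: T_def vec_eq_iff axis_def if_distrib cong: if_cong)
  ultimately have T: "bounded_linear T" by (simp add: T_sum[abs_def])
  obtain M where M: "M > 0" "\<And>d. norm (T d) \<le> norm d * M" using bounded_linear.pos_bounded[OF T] by blast
  \<comment> \<open>Converts the coordinatewise errors, each divided by \<open>c i\<close>, into a
    norm bound through the l1 norm; the added 1 keeps \<open>K\<close> at least 1.\<close>
  define K where "K = (\<Sum>i\<in>UNIV. 1 / \<bar>c i\<bar>) + 1"
  have "K \<ge> 1" by (simp add: K_def sum_nonneg)
  have G0: "G i (f y0, y0) = 0" for i using eventually_nhds_x_imp_x[OF zero] by blast
  show ?thesis
    unfolding T_def[symmetric, abs_def] has_derivative_at_alt
  proof (intro conjI T allI impI)
    fix e :: real assume "0 < e"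
    \<comment> \<open>Two requirements: \<open>e' * K\<close> at most 1/2 lets the unknown increment
      of \<open>f\<close> be absorbed on the left, and \<open>e' * K * (2 * M + 2)\<close> at most
      \<open>e\<close> gives the final estimate.\<close>
    define e' where "e' = min (1/2) (e / (2 * M + 2)) / K"
    have e': "0 < e'" "e' * K \<le> 1/2" "e' * K * (2 * M + 2) \<le> e"
    proof -
      have eK: "e' * K = min (1/2) (e / (2 * M + 2))" using \<open>K \<ge> 1\<close> by (simp add: e'_def)
      show "0 < e'" using \<open>K \<ge> 1\<close> \<open>0 < e\<close> M(1) by (simp add: e'_def)
      show "e' * K \<le> 1/2" unfolding eK by (rule min.cobounded1)
      have "e' * K \<le> e / (2 * M + 2)" unfolding eK by (rule min.cobounded2)
      then show "e' * K * (2 * M + 2) \<le> e" using M(1) by (simp add: pos_le_divide_eq)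
    qed
    have "\<forall>i. \<exists>d>0. \<forall>p. norm (p - (f y0, y0)) < d \<longrightarrow>
        norm (G i p - G i (f y0, y0) - (c i * fst (p - (f y0, y0)) $ i + B i (snd (p - (f y0, y0))))) \<le> e' * norm (p - (f y0, y0))"
      using der e'(1) unfolding has_derivative_at_alt by blast
    then obtain dl where dl: "\<And>i. dl i > 0" "\<And>i p. norm (p - (f y0, y0)) < dl i \<Longrightarrow>
        norm (G i p - G i (f y0, y0) - (c i * fst (p - (f y0, y0)) $ i + B i (snd (p - (f y0, y0))))) \<le> e' * norm (p - (f y0, y0))"
      by metis
    define d0 where "d0 = Min (range dl)"
    have d0: "d0 > 0" "d0 \<le> dl i" for i by (auto simp: d0_def dl(1))
    have "isCont (\<lambda>y. (f y, y)) y0" using cont by (intro continuous_intros)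
    then obtain d1 where d1: "d1 > 0" "\<And>y. dist y y0 < d1 \<Longrightarrow> dist (f y, y) (f y0, y0) < d0"
      using d0(1) unfolding continuous_at_eps_delta by blast
    obtain d2 where d2: "d2 > 0" "\<And>y. dist y y0 < d2 \<Longrightarrow> \<forall>i. G i (f y, y) = 0"
      using zero unfolding eventually_nhds_metric by blast
    have "norm (f y - f y0 - T (y - y0)) \<le> e * norm (y - y0)" if y: "norm (y - y0) < min d1 d2" for y
    proof -
      define D where "D = f y - f y0"
      define d where "d = y - y0"
      define r where "r = D - T d"
      have near: "norm ((f y, y) - (f y0, y0)) < d0" using d1(2)[of y] y by (simp add: dist_norm)
      have "\<bar>r $ i\<bar> \<le> e' * (norm D + norm d) * (1 / \<bar>c i\<bar>)" for i
      proof -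
        have "\<bar>c i * D $ i + B i d\<bar> \<le> e' * norm ((f y, y) - (f y0, y0))"
          using dl(2)[of "(f y, y)" i] near d0(2)[of i] d2(2)[of y] y G0[of i]
          by (simp add: dist_norm D_def d_def abs_minus_commute minus_add_distrib[symmetric] del: minus_add_distrib)
        also have "norm ((f y, y) - (f y0, y0)) \<le> norm D + norm d"
          using norm_Pair_le[of D d] by (simp add: D_def d_def)
        finally have "\<bar>c i * D $ i + B i d\<bar> \<le> e' * (norm D + norm d)" using e'(1) by simp
        moreover have "r $ i = (c i * D $ i + B i d) / c i"
          using c[of i] by (simp add: r_def T_def field_simps)
        ultimately show ?thesis using c[of i] by (simp add: abs_divide divide_right_mono)
      qed
      then have "(\<Sum>i\<in>UNIV. \<bar>r $ i\<bar>) \<le> (\<Sum>i\<in>UNIV. e' * (norm D + norm d) * (1 / \<bar>c i\<bar>))"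
        by (intro sum_mono)
      also have "\<dots> = e' * (norm D + norm d) * (K - 1)"
        by (simp add: K_def sum_distrib_left)
      also have "\<dots> \<le> e' * (norm D + norm d) * K"
        using e'(1) by (intro mult_left_mono) auto
      finally have r: "norm r \<le> (e' * K) * (norm D + norm d)"
        using norm_le_l1_cart[of r] by (simp add: mult_ac)
      have "norm D \<le> norm (T d) + norm r" unfolding r_def by (metis norm_triangle_sub add.commute)
      also have "\<dots> \<le> norm d * M + (1/2) * (norm D + norm d)"
      proof (rule add_mono[OF M(2)])
        have "(e' * K) * (norm D + norm d) \<le> (1/2) * (norm D + norm d)"
          by (rule mult_right_mono[OF e'(2)]) simp
        then show "norm r \<le> (1/2) * (norm D + norm d)" using r by (rule order_trans[rotated])
      qed
      finally have "norm D \<le> norm d * M + (1/2) * (norm D + norm d)" .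
      \<comment> \<open>The absorption: half of the increment \<open>x\<close> of \<open>f\<close>
        moves to the left, which bounds it by a multiple of the increment \<open>y\<close> of the
        argument.\<close>
      moreover have "x + y \<le> (2 * M + 2) * y" if "x \<le> y * M + (1/2) * (x + y)" "0 \<le> y" for x y :: real
        using that by (simp add: algebra_simps add_divide_distrib)
      ultimately have "norm D + norm d \<le> (2 * M + 2) * norm d" by simp
      then have "(e' * K) * (norm D + norm d) \<le> (e' * K) * ((2 * M + 2) * norm d)"
        using e'(1) \<open>K \<ge> 1\<close> by (intro mult_left_mono) auto
      with r have "norm r \<le> (e' * K) * ((2 * M + 2) * norm d)" by (rule order_trans)
      also have "\<dots> \<le> e * norm d" using mult_right_mono[OF e'(3), of "norm d"] by (simp add: mult.assoc)
      finally show ?thesis by (simp add: r_def D_def d_def)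
    qed
    then show "\<exists>d>0. \<forall>y. norm (y - y0) < d \<longrightarrow> norm (f y - f y0 - T (y - y0)) \<le> e * norm (y - y0)"
      using d1(1) d2(1) by (intro exI[of _ "min d1 d2"]) auto
  qed
qed

section \<open>Population maximizers\<close>

definition delta :: "'p \<Rightarrow> 'p \<Rightarrow> real" where "delta a b = (if a = b then 1 else 0)"

lemma sum_delta [simp]:
  fixes f :: "'p::finite \<Rightarrow> real"
  shows "(\<Sum>b\<in>UNIV. delta a b * f b) = f a" "(\<Sum>b\<in>UNIV. delta b a * f b) = f a"
  by (simp_all add: delta_def if_distrib[of "\<lambda>x. x * _"] cong: if_cong)

lemma ml2_delta: "ml2 delta u v = u \<bullet> v"
proof -
  have "(\<Sum>b\<in>UNIV. delta a b * u $ a * v $ b) = u $ a * v $ a" for a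
    using sum_delta(1)[of a "\<lambda>b. u $ a * v $ b"] by (simp add: mult_ac)
  then show ?thesis by (simp add: ml2_def inner_vec_def)
qed

lemma ml3_delta: "ml3 (\<lambda>a b c. g a * delta a b * delta a c) u v w = (\<Sum>a\<in>UNIV. g a * u $ a * v $ a * w $ a)"
proof -
  have "(\<Sum>b\<in>UNIV. \<Sum>c\<in>UNIV. g a * delta a b * delta a c * u $ a * v $ b * w $ c) = g a * u $ a * v $ a * w $ a" for a
  proof -
    have "(\<Sum>c\<in>UNIV. g a * delta a b * delta a c * u $ a * v $ b * w $ c)
        = g a * delta a b * u $ a * v $ b * w $ a" for b
      using sum_delta(1)[of a "\<lambda>c. g a * delta a b * u $ a * v $ b * w $ c"] by (simp add: mult_ac)
    moreover have "(\<Sum>b\<in>UNIV. g a * delta a b * u $ a * v $ b * w $ a) = g a * u $ a * v $ a * w $ a"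
      using sum_delta(1)[of a "\<lambda>b. g a * u $ a * v $ b * w $ a"] by (simp add: mult_ac)
    ultimately show ?thesis by simp
  qed
  then show ?thesis by (simp add: ml3_def)
qed

text \<open>The tensor is that of fourth moments of independent standardized components: excess
  kurtosis on the diagonal plus the three pairings of a Gaussian vector. Each pairing contracts to a
  product of inner products.\<close>

lemma ml4_delta: "ml4 (\<lambda>a b c d. g a * delta a b * delta a c * delta a d + delta a b * delta c d
      + delta a c * delta b d + delta a d * delta b c) u v w x
    = (\<Sum>a\<in>UNIV. g a * u $ a * v $ a * w $ a * x $ a)
      + (u \<bullet> v) * (w \<bullet> x) + (u \<bullet> w) * (v \<bullet> x) + (u \<bullet> x) * (v \<bullet> w)"
proof -
  have i: "(\<Sum>b\<in>UNIV. \<Sum>c\<in>UNIV. \<Sum>d\<in>UNIV. g a * delta a b * delta a c * delta a d * u $ a * v $ b * w $ c * x $ d)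
      = g a * u $ a * v $ a * w $ a * x $ a" for a
  proof -
    have "(\<Sum>d\<in>UNIV. g a * delta a b * delta a c * delta a d * u $ a * v $ b * w $ c * x $ d)
        = g a * delta a b * delta a c * u $ a * v $ b * w $ c * x $ a" for b c
      using sum_delta(1)[of a "\<lambda>d. g a * delta a b * delta a c * u $ a * v $ b * w $ c * x $ d"] by (simp add: mult_ac)
    moreover have "(\<Sum>c\<in>UNIV. g a * delta a b * delta a c * u $ a * v $ b * w $ c * x $ a)
        = g a * delta a b * u $ a * v $ b * w $ a * x $ a" for b
      using sum_delta(1)[of a "\<lambda>c. g a * delta a b * u $ a * v $ b * w $ c * x $ a"] by (simp add: mult_ac)
    moreover have "(\<Sum>b\<in>UNIV. g a * delta a b * u $ a * v $ b * w $ a * x $ a) = g a * u $ a * v $ a * w $ a * x $ a"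
      using sum_delta(1)[of a "\<lambda>b. g a * u $ a * v $ b * w $ a * x $ a"] by (simp add: mult_ac)
    ultimately show ?thesis by simp
  qed
  have last: "(\<Sum>d\<in>UNIV. delta e d * (y * x $ d)) = y * x $ e" for e y
    by (rule sum_delta)
  have ii: "(\<Sum>a\<in>UNIV. \<Sum>b\<in>UNIV. \<Sum>c\<in>UNIV. \<Sum>d\<in>UNIV. delta a b * delta c d * u $ a * v $ b * w $ c * x $ d)
      = (u \<bullet> v) * (w \<bullet> x)"
  proof -
    have "(\<Sum>d\<in>UNIV. delta a b * delta c d * u $ a * v $ b * w $ c * x $ d) = delta a b * u $ a * v $ b * (w $ c * x $ c)" for a b c
      using last[of c "delta a b * u $ a * v $ b * w $ c"] by (simp add: mult_ac)
    moreover have "(\<Sum>b\<in>UNIV. delta a b * (u $ a * v $ b * y)) = u $ a * v $ a * y" for a y by (rule sum_delta)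
    then have "(\<Sum>b\<in>UNIV. \<Sum>c\<in>UNIV. delta a b * u $ a * v $ b * (w $ c * x $ c)) = u $ a * v $ a * (w \<bullet> x)" for a
      unfolding sum_distrib_left[symmetric] by (simp add: inner_vec_def mult.assoc)
    ultimately show ?thesis by (simp add: sum_distrib_right[symmetric]) (simp add: inner_vec_def)
  qed
  have iii: "(\<Sum>a\<in>UNIV. \<Sum>b\<in>UNIV. \<Sum>c\<in>UNIV. \<Sum>d\<in>UNIV. delta a c * delta b d * u $ a * v $ b * w $ c * x $ d)
      = (u \<bullet> w) * (v \<bullet> x)"
  proof -
    have "(\<Sum>d\<in>UNIV. delta a c * delta b d * u $ a * v $ b * w $ c * x $ d) = delta a c * (u $ a * w $ c * (v $ b * x $ b))" for a b c
      using last[of b "delta a c * u $ a * v $ b * w $ c"] by (simp add: mult_ac)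
    moreover have "(\<Sum>c\<in>UNIV. delta a c * (u $ a * w $ c * y)) = u $ a * w $ a * y" for a y by (rule sum_delta)
    ultimately have "(\<Sum>a\<in>UNIV. \<Sum>b\<in>UNIV. \<Sum>c\<in>UNIV. \<Sum>d\<in>UNIV. delta a c * delta b d * u $ a * v $ b * w $ c * x $ d)
        = (\<Sum>a\<in>UNIV. \<Sum>b\<in>UNIV. u $ a * w $ a * (v $ b * x $ b))" by simp
    then show ?thesis by (simp add: sum_product[symmetric] inner_vec_def)
  qed
  have iv: "(\<Sum>a\<in>UNIV. \<Sum>b\<in>UNIV. \<Sum>c\<in>UNIV. \<Sum>d\<in>UNIV. delta a d * delta b c * u $ a * v $ b * w $ c * x $ d)
      = (u \<bullet> x) * (v \<bullet> w)"
  proof -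
    have "(\<Sum>d\<in>UNIV. delta a d * delta b c * u $ a * v $ b * w $ c * x $ d) = delta b c * (u $ a * x $ a * (v $ b * w $ c))" for a b c
      using last[of a "delta b c * u $ a * v $ b * w $ c"] by (simp add: mult_ac)
    moreover have "(\<Sum>c\<in>UNIV. delta b c * (y * (v $ b * w $ c))) = y * (v $ b * w $ b)" for b y by (rule sum_delta)
    ultimately have "(\<Sum>a\<in>UNIV. \<Sum>b\<in>UNIV. \<Sum>c\<in>UNIV. \<Sum>d\<in>UNIV. delta a d * delta b c * u $ a * v $ b * w $ c * x $ d)
        = (\<Sum>a\<in>UNIV. \<Sum>b\<in>UNIV. u $ a * x $ a * (v $ b * w $ b))" by simp
    then show ?thesis by (simp add: sum_product[symmetric] inner_vec_def)
  qed
  show ?thesis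
    unfolding ml4_def by (simp only: distrib_right sum.distrib i ii iii iv)
qed

lemma norm_matrix_vector_le: "norm (A *v x) \<le> norm A * norm x" for A :: "real ^ 'n ^ 'm"
proof -
  have "norm (A *v x) = L2_set (\<lambda>i. \<bar>(A *v x) $ i\<bar>) UNIV" by (simp add: norm_vec_def)
  also have "\<dots> \<le> L2_set (\<lambda>i. norm (A $ i) * norm x) UNIV"
    by (rule L2_set_mono) (auto simp: matrix_vector_mul_component intro: Cauchy_Schwarz_ineq2)
  also have "\<dots> = norm A * norm x" by (simp add: norm_vec_def L2_set_left_distrib)
  finally show ?thesis .
qed

text \<open>The matrix norm used here is the Frobenius norm, which dominates the operator norm, so
  the perturbation changes the form \<open>x \<bullet> x\<close> by less than its own value.\<close>

lemma sym_pos_def_near_mat_1: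
  fixes S :: "real ^ 'n ^ 'n"
  assumes "transpose S = S" "dist S (mat 1) < 1"
  shows "sym_pos_def S"
  unfolding sym_pos_def_def
proof (intro conjI allI impI assms(1))
  fix x :: "real ^ 'n" assume "x \<noteq> 0"
  have "\<bar>x \<bullet> ((S - mat 1) *v x)\<bar> \<le> norm x * norm ((S - mat 1) *v x)" by (rule Cauchy_Schwarz_ineq2)
  also have "\<dots> \<le> norm x * (norm (S - mat 1) * norm x)" by (intro mult_left_mono norm_matrix_vector_le) auto
  also have "\<dots> = norm (S - mat 1) * (x \<bullet> x)" by (simp add: power2_norm_eq_inner[symmetric] power2_eq_square)
  also have "\<dots> < 1 * (x \<bullet> x)" using assms(2) \<open>x \<noteq> 0\<close> by (intro mult_strict_right_mono) (auto simp: dist_norm)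
  finally have "- (x \<bullet> ((S - mat 1) *v x)) < x \<bullet> x" by linarith
  moreover have "x \<bullet> (S *v x) = x \<bullet> x + x \<bullet> ((S - mat 1) *v x)"
    by (simp add: matrix_vector_mult_diff_rdistrib inner_diff_right)
  ultimately show "0 < x \<bullet> (S *v x)" by linarith
qed

lemma transpose_cov_of: "transpose (cov_of m) = cov_of m"
  by (simp add: cov_of_def transpose_def vec_eq_iff cm2_def add.commute mult.commute)

lemma continuous_cov_of: "continuous_on UNIV cov_of"
  unfolding cov_of_def[abs_def] cm2_def by (intro continuous_on_vec_lambda continuous_intros) auto

text \<open>Only a point \<open>m0\<close> of moment space is fixed; no measure is involved yet. The
  fourth-order identity is conditional because for \<alpha> = 1 that tensor will be set to zero. The
  last condition says that at most one component has zero weight in the objective.\<close>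

locale population =
  fixes \<alpha> :: real and \<gamma> \<kappa> :: "'p::finite \<Rightarrow> real" and m0 :: "'p moments"
  assumes alpha: "0 \<le> \<alpha>" "\<alpha> \<le> 1"
    and m0_1: "raw1 m0 a = 0"
    and m0_2: "raw2 m0 a b = delta a b"
    and m0_3: "raw3 m0 a b c = \<gamma> a * delta a b * delta a c"
    and m0_4: "\<alpha> \<noteq> 1 \<Longrightarrow> raw4 m0 a b c d = \<kappa> a * delta a b * delta a c * delta a d
      + delta a b * delta c d + delta a c * delta b d + delta a d * delta b c"
    and nondegenerate: "k \<noteq> l \<Longrightarrow> 0 < \<alpha> * ((\<gamma> k)\<^sup>2 + (\<gamma> l)\<^sup>2) + (1 - \<alpha>) * ((\<kappa> k)\<^sup>2 + (\<kappa> l)\<^sup>2)"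
begin

lemma cm2_m0: "cm2 m0 = delta"
proof (intro ext)
  show "cm2 m0 a b = delta a b" for a b
    by (cases "a = b") (simp_all add: cm2_def m0_1 m0_2 delta_def)
qed

lemma cov_of_m0: "cov_of m0 = mat 1"
  by (simp add: cov_of_def cm2_m0 mat_def vec_eq_iff delta_def)

lemma cm3_m0: "ml3 (cm3 m0) u v w = (\<Sum>a\<in>UNIV. \<gamma> a * u $ a * v $ a * w $ a)"
proof -
  have "cm3 m0 = (\<lambda>a b c. \<gamma> a * delta a b * delta a c)" by (intro ext) (simp add: cm3_def m0_1 m0_3)
  then show ?thesis by (simp add: ml3_delta)
qed

lemma cm4_m0:
  assumes "\<alpha> \<noteq> 1"
  shows "ml4 (cm4 m0) u v w x = (\<Sum>a\<in>UNIV. \<kappa> a * u $ a * v $ a * w $ a * x $ a)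
      + (u \<bullet> v) * (w \<bullet> x) + (u \<bullet> w) * (v \<bullet> x) + (u \<bullet> x) * (v \<bullet> w)"
proof -
  have "cm4 m0 = (\<lambda>a b c d. \<kappa> a * delta a b * delta a c * delta a d + delta a b * delta c d
      + delta a c * delta b d + delta a d * delta b c)" by (intro ext) (simp add: cm4_def m0_1 m0_4[OF assms])
  then show ?thesis by (simp add: ml4_delta)
qed

definition weight :: "'p \<Rightarrow> real" where "weight j = \<alpha> * (\<gamma> j)\<^sup>2 + (1 - \<alpha>) * (\<kappa> j)\<^sup>2"

lemma weight_nonneg: "0 \<le> weight j"
  using alpha by (simp add: weight_def)

text \<open>Cauchy-Schwarz with the unit vector \<open>w\<close> as one factor: the cubic form is
  \<open>w\<close> against \<gamma>_j w_j^2, and the quartic form minus 3 is \<open>w\<close>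
  against \<kappa>_j w_j^3, since 3 cancels the pairings. The sixth powers that arise are then
  lowered to fourth powers by |w_j| \<le> 1.\<close>

lemma row_obj_bound:
  assumes "w \<bullet> w = 1"
  shows "row_obj \<alpha> m0 w \<le> (\<Sum>j\<in>UNIV. weight j * (w $ j) ^ 4)"
proof -
  have w2: "(\<Sum>j\<in>UNIV. (w $ j)\<^sup>2) = 1" using assms by (simp add: inner_vec_def power2_eq_square)
  have le1: "(w $ j)\<^sup>2 \<le> 1" for j
    using member_le_sum[of j UNIV "\<lambda>j. (w $ j)\<^sup>2"] w2 by simp
  have cs: "(\<Sum>j\<in>UNIV. w $ j * f j)\<^sup>2 \<le> (\<Sum>j\<in>UNIV. (f j)\<^sup>2)" for f
    using Cauchy_Schwarz_ineq_sum[of "\<lambda>j. w $ j" f UNIV] w2 by simp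
  have "(ml3 (cm3 m0) w w w)\<^sup>2 \<le> (\<Sum>j\<in>UNIV. (\<gamma> j)\<^sup>2 * (w $ j) ^ 4)"
    using cs[of "\<lambda>j. \<gamma> j * (w $ j)\<^sup>2"]
    by (simp add: cm3_m0 power2_eq_square power4_eq_xxxx mult_ac)
  then have 1: "\<alpha> * (ml3 (cm3 m0) w w w)\<^sup>2 \<le> \<alpha> * (\<Sum>j\<in>UNIV. (\<gamma> j)\<^sup>2 * (w $ j) ^ 4)"
    using alpha by (intro mult_left_mono) auto
  have 2: "(1 - \<alpha>) * (ml4 (cm4 m0) w w w w - 3)\<^sup>2 \<le> (1 - \<alpha>) * (\<Sum>j\<in>UNIV. (\<kappa> j)\<^sup>2 * (w $ j) ^ 4)"
  proof (cases "\<alpha> = 1")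
    case False
    have "ml4 (cm4 m0) w w w w - 3 = (\<Sum>j\<in>UNIV. w $ j * (\<kappa> j * (w $ j) ^ 3))"
      using assms by (simp add: cm4_m0[OF False] power3_eq_cube mult_ac)
    then have "(ml4 (cm4 m0) w w w w - 3)\<^sup>2 \<le> (\<Sum>j\<in>UNIV. (\<kappa> j * (w $ j) ^ 3)\<^sup>2)" using cs by simp
    also have "\<dots> \<le> (\<Sum>j\<in>UNIV. (\<kappa> j)\<^sup>2 * (w $ j) ^ 4)"
    proof (rule sum_mono)
      fix j
      have "(\<kappa> j * (w $ j) ^ 3)\<^sup>2 = ((\<kappa> j)\<^sup>2 * (w $ j) ^ 4) * (w $ j)\<^sup>2"
        by (simp add: power2_eq_square power3_eq_cube power4_eq_xxxx)
      also have "\<dots> \<le> ((\<kappa> j)\<^sup>2 * (w $ j) ^ 4) * 1" by (intro mult_left_mono le1) simp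
      finally show "(\<kappa> j * (w $ j) ^ 3)\<^sup>2 \<le> (\<kappa> j)\<^sup>2 * (w $ j) ^ 4" by simp
    qed
    finally show ?thesis using alpha by (intro mult_left_mono) auto
  qed simp
  show ?thesis
    using add_mono[OF 1 2]
    by (simp add: row_obj_def weight_def sum_distrib_left sum.distrib[symmetric] algebra_simps)
qed

lemma objective_mat_1: "objective \<alpha> m0 (mat 1) = (\<Sum>j\<in>UNIV. weight j)"
proof -
  have "row_obj \<alpha> m0 (mat 1 $ k) = weight k" for k
  proof -
    have e: "(mat 1 :: real ^ 'p ^ 'p) $ k = axis k 1" by (simp add: mat_def axis_def vec_eq_iff)
    have s: "(\<Sum>a\<in>UNIV. f a * axis k 1 $ a * axis k 1 $ a * axis k 1 $ a) = f k" for f :: "'p \<Rightarrow> real"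
    proof -
      have "(\<Sum>a\<in>UNIV. f a * axis k 1 $ a * axis k 1 $ a * axis k 1 $ a) = (\<Sum>a\<in>UNIV. f a * (if a = k then 1 else 0))"
        unfolding axis_nth_if by (intro sum.cong) auto
      then show ?thesis by simp
    qed
    have s': "(\<Sum>a\<in>UNIV. f a * axis k 1 $ a * axis k 1 $ a * axis k 1 $ a * axis k 1 $ a) = f k" for f :: "'p \<Rightarrow> real"
    proof -
      have "(\<Sum>a\<in>UNIV. f a * axis k 1 $ a * axis k 1 $ a * axis k 1 $ a * axis k 1 $ a) = (\<Sum>a\<in>UNIV. f a * (if a = k then 1 else 0))"
        unfolding axis_nth_if by (intro sum.cong) auto
      then show ?thesis by simp
    qed
    have "(1 - \<alpha>) * (ml4 (cm4 m0) (axis k 1) (axis k 1) (axis k 1) (axis k 1) - 3)\<^sup>2 = (1 - \<alpha>) * (\<kappa> k)\<^sup>2"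
      by (cases "\<alpha> = 1") (simp_all add: cm4_m0 s' inner_axis_axis)
    then show ?thesis unfolding e row_obj_def weight_def by (simp add: cm3_m0 s)
  qed
  then show ?thesis by (simp add: objective_def)
qed

text \<open>By Cauchy-Schwarz the objective at \<open>U\<close> is at most the sum of \<open>weight j * u\<^sub>k\<^sub>j ^ 4\<close>, so at a
  maximizer every entry of \<open>U\<close> in a column of positive weight is \<open>0\<close> or \<open>\<plusminus> 1\<close>.\<close>

lemma population_maximizer:
  assumes U: "orthogonal_matrix U" and max: "objective \<alpha> m0 (mat 1) \<le> objective \<alpha> m0 U"
  obtains \<pi> e where "bij \<pi>" "\<And>k. e k * e k = 1" "\<And>k. U $ k = e k *\<^sub>R axis (\<pi> k) (1::real)"
proof -
  have rows: "U $ k \<bullet> U $ k = 1" for k using U by (simp add: orthogonal_matrix_rows)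
  have row_sum: "(\<Sum>j\<in>UNIV. (U $ k $ j)\<^sup>2) = 1" for k
    using rows[of k] by (simp add: inner_vec_def power2_eq_square)
  have col_sum: "(\<Sum>k\<in>UNIV. (U $ k $ j)\<^sup>2) = 1" for j
    using orthogonal_matrix_columns[OF U, of j j] by (simp add: power2_eq_square)
  have le1: "(U $ k $ j)\<^sup>2 \<le> 1" for k j
    using member_le_sum[of j UNIV "\<lambda>j. (U $ k $ j)\<^sup>2"] row_sum[of k] by simp
  have nonneg: "0 \<le> weight j * ((U $ k $ j)\<^sup>2 - (U $ k $ j) ^ 4)" for k j
  proof -
    have "(U $ k $ j) ^ 4 = (U $ k $ j)\<^sup>2 * (U $ k $ j)\<^sup>2" by (simp add: power2_eq_square power4_eq_xxxx)
    also have "\<dots> \<le> (U $ k $ j)\<^sup>2 * 1" by (intro mult_left_mono le1) simp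
    finally show ?thesis using weight_nonneg[of j] by simp
  qed
  have "(\<Sum>k\<in>UNIV. \<Sum>j\<in>UNIV. weight j * ((U $ k $ j)\<^sup>2 - (U $ k $ j) ^ 4)) \<le> 0"
  proof -
    have "(\<Sum>j\<in>UNIV. weight j) \<le> (\<Sum>k\<in>UNIV. \<Sum>j\<in>UNIV. weight j * (U $ k $ j) ^ 4)"
    proof -
      have "objective \<alpha> m0 U \<le> (\<Sum>k\<in>UNIV. \<Sum>j\<in>UNIV. weight j * (U $ k $ j) ^ 4)"
        unfolding objective_def by (intro sum_mono row_obj_bound rows)
      with max show ?thesis unfolding objective_mat_1 by (rule order_trans)
    qed
    \<comment> \<open>The columns have unit length, so the value at the identity is the weighted sum
      of squares. Comparing it with the weighted sum of fourth powers makes all the nonnegative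
      deficits vanish.\<close>
    moreover have "(\<Sum>k\<in>UNIV. \<Sum>j\<in>UNIV. weight j * (U $ k $ j)\<^sup>2) = (\<Sum>j\<in>UNIV. weight j)"
      by (subst sum.swap) (simp add: sum_distrib_left[symmetric] col_sum)
    ultimately show ?thesis by (simp add: right_diff_distrib sum_subtractf)
  qed
  then have "(\<Sum>k\<in>UNIV. \<Sum>j\<in>UNIV. weight j * ((U $ k $ j)\<^sup>2 - (U $ k $ j) ^ 4)) = 0"
    by (intro antisym sum_nonneg nonneg)
  then have zero: "weight j * ((U $ k $ j)\<^sup>2 - (U $ k $ j) ^ 4) = 0" for k j
    using nonneg by (simp add: sum_nonneg_eq_0_iff sum_nonneg)
  have int: "(U $ k $ j)\<^sup>2 \<in> {0, 1}" if "weight j \<noteq> 0" for k j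
  proof -
    have "(U $ k $ j)\<^sup>2 * (1 - (U $ k $ j)\<^sup>2) = 0"
      using zero[of j k] that by (simp add: algebra_simps power2_eq_square power4_eq_xxxx)
    then show ?thesis by auto
  qed
  \<comment> \<open>At most one column can have weight zero. Its entries are recovered from the
    rows: all others in a row have square 0 or 1 and the squares add up to 1.\<close>
  have all_int: "(U $ k $ j)\<^sup>2 \<in> {0, 1}" for k j
  proof (cases "weight j = 0")
    case True
    have "weight i \<noteq> 0" if "i \<noteq> j" for i
      using nondegenerate[OF that] True by (simp add: weight_def algebra_simps)
    then have ints: "(U $ k $ i)\<^sup>2 \<in> {0, 1}" if "i \<noteq> j" for i using int that by blast
    have split: "(U $ k $ j)\<^sup>2 + (\<Sum>i\<in>UNIV - {j}. (U $ k $ i)\<^sup>2) = 1"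
      using row_sum[of k] by (simp add: sum.remove[of UNIV j])
    show ?thesis
    proof (cases "\<exists>i. i \<noteq> j \<and> (U $ k $ i)\<^sup>2 = 1")
      case True
      then obtain i where i: "i \<noteq> j" "(U $ k $ i)\<^sup>2 = 1" by blast
      then have "1 \<le> (\<Sum>i\<in>UNIV - {j}. (U $ k $ i)\<^sup>2)"
        using member_le_sum[of i "UNIV - {j}" "\<lambda>i. (U $ k $ i)\<^sup>2"] by simp
      then have "(U $ k $ j)\<^sup>2 \<le> 0" using split by linarith
      then show ?thesis by simp
    next
      case False
      then have "(U $ k $ i)\<^sup>2 = 0" if "i \<noteq> j" for i using ints[OF that] that by blast
      then have "(\<Sum>i\<in>UNIV - {j}. (U $ k $ i)\<^sup>2) = 0" by (intro sum.neutral) blast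
      then show ?thesis using split by simp
    qed
  qed (rule int)
  have "\<exists>j. (U $ k $ j)\<^sup>2 = 1" for k
  proof (rule ccontr)
    assume "\<nexists>j. (U $ k $ j)\<^sup>2 = 1"
    then have "(U $ k $ j)\<^sup>2 = 0" for j using all_int[of k j] by blast
    then have "(\<Sum>j\<in>UNIV. (U $ k $ j)\<^sup>2) = 0" by (intro sum.neutral) blast
    then show False using row_sum[of k] by simp
  qed
  then obtain \<pi> where \<pi>: "\<And>k. (U $ k $ \<pi> k)\<^sup>2 = 1" by metis
  have off: "U $ k $ j = 0" if "j \<noteq> \<pi> k" for k j
  proof -
    have "(\<Sum>i\<in>UNIV. (U $ k $ i)\<^sup>2) = (U $ k $ \<pi> k)\<^sup>2 + (\<Sum>i\<in>UNIV - {\<pi> k}. (U $ k $ i)\<^sup>2)"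
      by (simp add: sum.remove[of UNIV "\<pi> k"])
    then have "(\<Sum>i\<in>UNIV - {\<pi> k}. (U $ k $ i)\<^sup>2) = 0" using row_sum[of k] \<pi>[of k] by simp
    then have "(U $ k $ j)\<^sup>2 = 0" using that by (subst (asm) sum_nonneg_eq_0_iff) auto
    then show ?thesis by simp
  qed
  have "inj \<pi>"
  proof (rule injI, rule ccontr)
    fix k l assume kl: "\<pi> k = \<pi> l" "k \<noteq> l"
    have "(U $ k $ \<pi> k)\<^sup>2 + (U $ l $ \<pi> k)\<^sup>2 = (\<Sum>i\<in>{k, l}. (U $ i $ \<pi> k)\<^sup>2)" using kl by simp
    also have "\<dots> \<le> (\<Sum>i\<in>UNIV. (U $ i $ \<pi> k)\<^sup>2)" by (rule sum_mono2) auto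
    finally show False using \<pi>[of k] \<pi>[of l] kl col_sum[of "\<pi> k"] by simp
  qed
  then have "bij \<pi>" by (simp add: bij_def finite_UNIV_inj_surj)
  then show ?thesis
    by (rule that[of _ "\<lambda>k. U $ k $ \<pi> k"])
      (use \<pi> off in \<open>auto simp: power2_eq_square vec_eq_iff axis_def\<close>)
qed

end

section \<open>The estimator as a function of the sample moments\<close>

lemma tendsto_matrix_mult:
  fixes A B :: "'a::topological_space \<Rightarrow> real ^ 'n ^ 'n"
  assumes "(A \<longlongrightarrow> a) F" "(B \<longlongrightarrow> b) F"
  shows "((\<lambda>x. A x ** B x) \<longlongrightarrow> a ** b) F"
  unfolding matrix_matrix_mult_def
  by (intro vec_tendstoI) (simp, intro tendsto_intros assms)

text \<open>The identity is an arbitrary default that makes the function total and Borel; points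
  where it applies stay away from the population moments.\<close>

definition whitener :: "'p::finite moments \<Rightarrow> real ^ 'p ^ 'p" where
  "whitener m = (if sym_pos_def (cov_of m) then inv_sqrt (cov_of m) else mat 1)"

text \<open>Closeness to the identity resolves the ambiguity by permutations and signs of the rows.\<close>

locale closest_maximizer =
  fixes \<alpha> :: real and s :: "(real ^ 'p ^ 'p) \<times> 'p::finite moments \<Rightarrow> real ^ 'p ^ 'p"
  assumes s_orthogonal: "orthogonal_matrix (s \<theta>)"
    and s_max: "orthogonal_matrix V \<Longrightarrow> objective \<alpha> (snd \<theta>) (V ** fst \<theta>) \<le> objective \<alpha> (snd \<theta>) (s \<theta> ** fst \<theta>)"
    and s_closest: "orthogonal_matrix U \<Longrightarrow>
      (\<And>V. orthogonal_matrix V \<Longrightarrow> objective \<alpha> (snd \<theta>) (V ** fst \<theta>) \<le> objective \<alpha> (snd \<theta>) (U ** fst \<theta>)) \<Longrightarrow>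
      dist (s \<theta>) (mat 1) \<le> dist U (mat 1)"
begin

definition estimate :: "'p moments \<Rightarrow> real ^ 'p ^ 'p" where
  "estimate m = (if sym_pos_def (cov_of m) then s (whitener m, m) ** whitener m else mat 1)"

lemma estimate_eq: "sym_pos_def (cov_of m) \<Longrightarrow> estimate m = s (whitener m, m) ** inv_sqrt (cov_of m)"
  by (simp add: estimate_def whitener_def)

lemma estimate_whitens:
  assumes "sym_pos_def (cov_of m)"
  shows "estimate m ** cov_of m ** transpose (estimate m) = mat 1"
proof -
  let ?R = "inv_sqrt (cov_of m)" and ?U = "s (whitener m, m)"
  have "transpose ?R = ?R" using sym_pos_def_inv_sqrt[OF assms] by (simp add: sym_pos_def_def)
  then have "estimate m ** cov_of m ** transpose (estimate m) = ?U ** (?R ** cov_of m ** ?R) ** transpose ?U"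
    by (simp add: estimate_eq[OF assms] matrix_transpose_mul matrix_mul_assoc)
  also have "\<dots> = mat 1"
    using s_orthogonal by (simp add: inv_sqrt_whitens[OF assms] orthogonal_matrix_def)
  finally show ?thesis .
qed

text \<open>A rotation of the estimate is again an orthogonal matrix times the same whitener, hence
  a competitor in the maximization.\<close>

lemma estimate_grad:
  assumes "sym_pos_def (cov_of m)" "k \<noteq> l"
  shows "grad \<alpha> m (estimate m $ k) (estimate m $ l) = grad \<alpha> m (estimate m $ l) (estimate m $ k)"
proof (rule grad_symmetric_at_max[OF assms(2)])
  fix t
  show "objective \<alpha> m (rotate_rows k l t (estimate m)) \<le> objective \<alpha> m (estimate m)"
    using s_max[OF orthogonal_rotate_rows[OF s_orthogonal assms(2), of t], of "(whitener m, m)" "(whitener m, m)"] assms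
    by (simp add: estimate_def rotate_rows_mult)
qed

end

lemma ml2_matrix: "(W ** (\<chi> a b. C a b) ** transpose W) $ k $ l = ml2 C (W $ k) (W $ l)"
  for W :: "real ^ 'p ^ 'p"
  unfolding matrix_matrix_mult_def transpose_def ml2_def
  by (simp add: sum_distrib_right, subst sum.swap) (simp add: mult_ac)

locale estimator = population \<alpha> \<gamma> \<kappa> m0 + closest_maximizer \<alpha> s
  for \<alpha> :: real and \<gamma> \<kappa> :: "'p::finite \<Rightarrow> real" and m0 :: "'p moments"
    and s :: "(real ^ 'p ^ 'p) \<times> 'p moments \<Rightarrow> real ^ 'p ^ 'p"
begin

lemma sym_pos_def_near: "\<forall>\<^sub>F m in nhds m0. sym_pos_def (cov_of m)"
proof -
  have "(cov_of \<longlongrightarrow> cov_of m0) (nhds m0)"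
  proof -
    have "isCont cov_of m0" using continuous_on_eq_continuous_at[OF open_UNIV] continuous_cov_of by blast
    then show ?thesis unfolding isCont_def tendsto_nhds_iff by blast
  qed
  then have "\<forall>\<^sub>F m in nhds m0. dist (cov_of m) (mat 1) < 1"
    unfolding cov_of_m0 by (rule tendstoD) simp
  then show ?thesis
    by eventually_elim (rule sym_pos_def_near_mat_1[OF transpose_cov_of])
qed

lemma whitener_m0: "whitener m0 = mat 1"
  using eventually_nhds_x_imp_x[OF sym_pos_def_near] by (simp add: whitener_def cov_of_m0 inv_sqrt_mat_1)

lemma whitener_tendsto: "(whitener \<longlongrightarrow> mat 1) (nhds m0)"
proof -
  obtain N where N: "open N" "m0 \<in> N" "\<And>m. m \<in> N \<Longrightarrow> sym_pos_def (cov_of m)"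
    using sym_pos_def_near unfolding eventually_nhds by blast
  have "continuous_on N (\<lambda>m. inv_sqrt (cov_of m))"
    by (rule continuous_on_compose2[OF continuous_on_inv_sqrt])
      (use N(3) in \<open>auto intro: continuous_on_subset[OF continuous_cov_of]\<close>)
  then have "continuous_on N whitener"
    by (rule continuous_on_eq) (simp add: whitener_def N(3))
  then have "isCont whitener m0" using N by (simp add: continuous_on_eq_continuous_at)
  then show ?thesis by (simp add: isCont_def whitener_m0 tendsto_nhds_iff)
qed

text \<open>Maximizers at distance at least \<open>e\<close> from every signed permutation, paired
  with their parameters, form a closed set; its projection along the compact orthogonal group is
  closed and misses the population point. So near that point a maximizer is \<open>e\<close>-close
  to some signed permutation. Undoing that permutation gives a maximizer \<open>e\<close>-close to
  the identity, and the closest one is no farther away.\<close>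

lemma s_near:
  assumes "0 < e"
  shows "\<forall>\<^sub>F \<theta> in nhds (mat 1, m0). dist (s \<theta>) (mat 1) < e"
proof -
  define P :: "(real ^ 'p ^ 'p) set" where
    "P = {\<chi> k. c k *\<^sub>R axis (\<pi> k) (1::real) | c \<pi>. bij \<pi> \<and> (\<forall>k. c k * c k = 1)}"
  let ?K = "Collect (orthogonal_matrix :: real ^ 'p ^ 'p \<Rightarrow> bool)"
  let ?T = "(\<Inter>V\<in>?K. {p :: (real ^ 'p ^ 'p) \<times> (real ^ 'p ^ 'p) \<times> 'p moments.
      objective \<alpha> (snd (snd p)) (V ** fst (snd p)) \<le> objective \<alpha> (snd (snd p)) (fst p ** fst (snd p))}) \<inter>
      (\<Inter>Q\<in>P. {p. e \<le> dist (fst p) Q})"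
  have cont: "continuous_on UNIV (\<lambda>p. objective \<alpha> (snd (snd p)) (g p ** fst (snd p)))"
    if "continuous_on UNIV g" for g :: "(real ^ 'p ^ 'p) \<times> (real ^ 'p ^ 'p) \<times> 'p moments \<Rightarrow> real ^ 'p ^ 'p"
  proof -
    have "continuous_on UNIV (\<lambda>p. case (snd p, g p) of (\<theta>, U) \<Rightarrow> objective \<alpha> (snd \<theta>) (U ** fst \<theta>))"
      by (rule continuous_on_compose2[OF continuous_objective]) (auto intro!: continuous_intros that)
    then show ?thesis by simp
  qed
  have "closed ?T"
    by (intro closed_Int closed_INT ballI closed_Collect_le cont continuous_intros)
  from closed_compact_projection[OF compact_orthogonal_matrices this]
  have cl: "closed {\<theta>. \<exists>U. U \<in> ?K \<and> (U, \<theta>) \<in> ?T}" (is "closed ?B") .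
  have "(mat 1, m0) \<notin> ?B"
  proof
    assume "(mat 1, m0) \<in> ?B"
    then obtain U where U: "orthogonal_matrix U" "\<And>Q. Q \<in> P \<Longrightarrow> e \<le> dist U Q"
      and max: "\<And>V. orthogonal_matrix V \<Longrightarrow> objective \<alpha> m0 (V ** mat 1) \<le> objective \<alpha> m0 (U ** mat 1)" by auto
    have "objective \<alpha> m0 (mat 1) \<le> objective \<alpha> m0 U" using max[OF orthogonal_matrix_id] by simp
    then obtain \<pi> c where "bij \<pi>" "\<And>k. c k * c k = 1" "\<And>k. U $ k = c k *\<^sub>R axis (\<pi> k) (1::real)"
      using population_maximizer[OF U(1)] by blast
    then have "U \<in> P" unfolding P_def by (intro CollectI exI[of _ c] exI[of _ \<pi>]) (simp add: vec_eq_iff)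
    then show False using U(2)[of U] \<open>0 < e\<close> by simp
  qed
  then have "\<forall>\<^sub>F \<theta> in nhds (mat 1, m0). \<theta> \<in> - ?B"
    using cl by (intro eventually_nhds_in_open) auto
  then show ?thesis
  proof eventually_elim
    case (elim \<theta>)
    have "(s \<theta>, \<theta>) \<notin> ?T" using elim s_orthogonal[of \<theta>] by blast
    then obtain Q where "Q \<in> P" "dist (s \<theta>) Q < e"
      using s_max[of _ \<theta>] by (auto simp: not_le)
    then obtain c \<pi> where Q: "Q = (\<chi> k. c k *\<^sub>R axis (\<pi> k) 1)" "bij \<pi>" "\<And>k. c k * c k = 1"
      unfolding P_def by blast
    \<comment> \<open>The inverse permutation, with the signs permuted along, carries
      \<open>Q\<close> to the identity. It acts isometrically and preserves the objective.\<close>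
    define \<sigma> where "\<sigma> = inv \<pi>"
    have \<sigma>: "bij \<sigma>" "\<pi> (\<sigma> j) = j" for j
      using Q(2) by (auto simp: \<sigma>_def bij_imp_bij_inv bij_is_surj surj_f_inv_f)
    let ?A = "signed_permute \<sigma> (\<lambda>j. c (\<sigma> j))"
    have "?A Q = mat 1"
      by (simp add: signed_permute_def Q(1) Q(3) \<sigma>(2) vec_eq_iff mat_def axis_def)
    then have "dist (?A (s \<theta>)) (mat 1) < e"
      using dist_signed_permute[OF \<sigma>(1), of "\<lambda>j. c (\<sigma> j)" "s \<theta>" Q] Q(3) \<open>dist (s \<theta>) Q < e\<close> by simp
    moreover have "dist (s \<theta>) (mat 1) \<le> dist (?A (s \<theta>)) (mat 1)"
    proof (rule s_closest)
      show "orthogonal_matrix (?A (s \<theta>))"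
        using s_orthogonal \<sigma>(1) Q(3) by (intro orthogonal_signed_permute) (auto simp: bij_def)
      fix V :: "real ^ 'p ^ 'p" assume "orthogonal_matrix V"
      then show "objective \<alpha> (snd \<theta>) (V ** fst \<theta>) \<le> objective \<alpha> (snd \<theta>) (?A (s \<theta>) ** fst \<theta>)"
        unfolding signed_permute_mult using \<sigma>(1) Q(3) s_max by (subst objective_signed_permute) auto
    qed
    ultimately show ?case by simp
  qed
qed

lemma estimate_tendsto: "(estimate \<longlongrightarrow> mat 1) (nhds m0)"
proof -
  have "((\<lambda>m. (whitener m, m)) \<longlongrightarrow> (mat 1, m0)) (nhds m0)"
    by (intro tendsto_Pair whitener_tendsto) (simp add: filterlim_ident)
  moreover have "(s \<longlongrightarrow> mat 1) (nhds (mat 1, m0))" by (rule tendstoI) (rule s_near)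
  ultimately have "((\<lambda>m. s (whitener m, m)) \<longlongrightarrow> mat 1) (nhds m0)"
    by (rule filterlim_compose[rotated])
  from tendsto_matrix_mult[OF this whitener_tendsto]
  have "((\<lambda>m. s (whitener m, m) ** whitener m) \<longlongrightarrow> mat 1) (nhds m0)" by simp
  moreover have "\<forall>\<^sub>F m in nhds m0. s (whitener m, m) ** whitener m = estimate m"
    using sym_pos_def_near by eventually_elim (simp add: estimate_def)
  ultimately show ?thesis by (rule Lim_transform_eventually)
qed

lemma estimate_m0: "estimate m0 = mat 1"
proof (rule ccontr)
  assume "estimate m0 \<noteq> mat 1"
  \<comment> \<open>The filter \<open>nhds m0\<close> contains the point \<open>m0\<close> itself,
    so the limit along it is also the value there.\<close>
  then have "\<forall>\<^sub>F m in nhds m0. dist (estimate m) (mat 1) < dist (estimate m0) (mat 1)"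
    by (intro tendstoD[OF estimate_tendsto]) simp
  from eventually_nhds_x_imp_x[OF this] show False by simp
qed

lemma isCont_estimate: "isCont estimate m0"
  using estimate_tendsto by (simp add: isCont_def estimate_m0 tendsto_nhds_iff)

section \<open>Differentials of the central moments\<close>

definition row_of :: "'p \<Rightarrow> real ^ ('p \<times> 'p) \<Rightarrow> real ^ 'p" where
  "row_of k x = (\<chi> a. x $ (k, a))"

lemma bounded_linear_row_of: "bounded_linear (row_of k)"
  by (rule bounded_linearI'[where 'a = "real ^ ('p \<times> 'p)"]) (auto simp: row_of_def vec_eq_iff)

lemma row_of_vectorize: "row_of k (vectorize W) = W $ k"
  by (simp add: row_of_def vectorize_def vec_eq_iff)

text \<open>Differentials of \<open>cm2\<close>, \<open>cm3\<close> and \<open>cm4\<close> at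
  \<open>m0\<close>. First moments vanish there, so every product containing two of them contributes
  nothing.\<close>

definition dcm2 :: "'p moments \<Rightarrow> 'p \<Rightarrow> 'p \<Rightarrow> real" where
  "dcm2 d a b = (raw2 d a b + raw2 d b a) / 2"
definition dcm3 :: "'p moments \<Rightarrow> 'p \<Rightarrow> 'p \<Rightarrow> 'p \<Rightarrow> real" where
  "dcm3 d a b c = raw3 d a b c - delta a b * raw1 d c - delta a c * raw1 d b - delta b c * raw1 d a"
definition dcm4 :: "'p moments \<Rightarrow> 'p \<Rightarrow> 'p \<Rightarrow> 'p \<Rightarrow> 'p \<Rightarrow> real" where
  "dcm4 d a b c e = raw4 d a b c e - raw3 m0 a b c * raw1 d e - raw3 m0 a b e * raw1 d c
    - raw3 m0 a c e * raw1 d b - raw3 m0 b c e * raw1 d a"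

lemma cm_has_derivative:
  fixes x :: "real ^ ('p \<times> 'p)"
  shows "((\<lambda>p. cm2 (snd p) a b) has_derivative (\<lambda>h. dcm2 (snd h) a b)) (at (x, m0))"
    "((\<lambda>p. cm3 (snd p) a b c) has_derivative (\<lambda>h. dcm3 (snd h) a b c)) (at (x, m0))"
    "((\<lambda>p. cm4 (snd p) a b c e) has_derivative (\<lambda>h. dcm4 (snd h) a b c e)) (at (x, m0))"
  unfolding cm2_def cm3_def cm4_def dcm2_def dcm3_def dcm4_def
  by (auto intro!: derivative_eq_intros simp: m0_1 m0_2 algebra_simps)

end

section \<open>Linearization of the estimating equations\<close>

lemma sum_axis: "(\<Sum>a\<in>UNIV. f a * axis i 1 $ a) = f i" for f :: "'p::finite \<Rightarrow> real"
  unfolding axis_nth_if by (rule sum_delta_mult)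

context population
begin

lemma cm3_axis:
  "ml3 (cm3 m0) (axis i 1) v w = \<gamma> i * v $ i * w $ i"
  "ml3 (cm3 m0) u (axis i 1) w = \<gamma> i * u $ i * w $ i"
  "ml3 (cm3 m0) u v (axis i 1) = \<gamma> i * u $ i * v $ i"
  using sum_axis[of "\<lambda>a. \<gamma> a * v $ a * w $ a" i] sum_axis[of "\<lambda>a. \<gamma> a * u $ a * w $ a" i]
    sum_axis[of "\<lambda>a. \<gamma> a * u $ a * v $ a" i]
  by (simp_all add: cm3_m0 mult_ac)

lemma cm4_axis:
  assumes "\<alpha> \<noteq> 1"
  shows "ml4 (cm4 m0) (axis i 1) v w x = \<kappa> i * v $ i * w $ i * x $ i + v $ i * (w \<bullet> x) + w $ i * (v \<bullet> x) + x $ i * (v \<bullet> w)"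
    "ml4 (cm4 m0) u (axis i 1) w x = \<kappa> i * u $ i * w $ i * x $ i + u $ i * (w \<bullet> x) + (u \<bullet> w) * x $ i + (u \<bullet> x) * w $ i"
  using sum_axis[of "\<lambda>a. \<kappa> a * v $ a * w $ a * x $ a" i] sum_axis[of "\<lambda>a. \<kappa> a * u $ a * w $ a * x $ a" i]
  by (simp_all add: cm4_m0[OF assms] mult_ac inner_axis inner_axis')

end

context estimator
begin

definition x0 :: "real ^ ('p \<times> 'p)" where "x0 = vectorize (mat 1)"

lemma row_of_x0: "row_of k x0 = axis k 1"
  by (simp add: x0_def row_of_vectorize) (simp add: mat_def axis_def vec_eq_iff)

lemma row_has_derivative: "((\<lambda>p. row_of k (fst p)) has_derivative (\<lambda>h. row_of k (fst h))) (at (x0, m0))"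
  by (rule bounded_linear.has_derivative[OF bounded_linear_row_of]) (auto intro!: derivative_eq_intros)

lemma row_of_nth: "row_of k x $ a = x $ (k, a)"
  by (simp add: row_of_def)

text \<open>The part of the linearization of \<open>dq3\<close> at rows \<open>k\<close> and
  \<open>l\<close> that comes from perturbing the moments with the rows held fixed.\<close>

definition t3 :: "'p \<Rightarrow> 'p \<Rightarrow> 'p moments \<Rightarrow> real" where
  "t3 k l d = dcm3 d l k k + dcm3 d k l k + dcm3 d k k l"
definition t4 :: "'p \<Rightarrow> 'p \<Rightarrow> 'p moments \<Rightarrow> real" where
  "t4 k l d = dcm4 d l k k k + dcm4 d k l k k + dcm4 d k k l k + dcm4 d k k k l"

lemmas ml2_at = ml2_has_derivative[where x = "(x0, m0)", simplified, OF cm_has_derivative(1)]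
lemmas ml3_at = ml3_has_derivative[where x = "(x0, m0)", simplified, OF cm_has_derivative(2)]
lemmas ml4_at = ml4_has_derivative[where x = "(x0, m0)", simplified, OF cm_has_derivative(3)]

lemma cov_has_derivative:
  "((\<lambda>p. ml2 (cm2 (snd p)) (row_of k (fst p)) (row_of l (fst p))) has_derivative
    (\<lambda>h. dcm2 (snd h) k l + fst h $ (k, l) + fst h $ (l, k))) (at (x0, m0))"
  by (rule has_derivative_eq_rhs, rule ml2_at[OF row_has_derivative row_has_derivative])
    (simp add: row_of_x0 multilinear_axis cm2_m0 ml2_delta inner_axis inner_axis' row_of_nth)

lemma dq3_has_derivative:
  assumes "k \<noteq> l"
  shows "((\<lambda>p. dq3 (cm3 (snd p)) (row_of k (fst p)) (row_of l (fst p))) has_derivative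
    (\<lambda>h. t3 k l (snd h) + 3 * \<gamma> k * fst h $ (l, k))) (at (x0, m0))"
  unfolding dq3_def
  by (rule has_derivative_eq_rhs,
      (rule has_derivative_add ml3_at[OF row_has_derivative row_has_derivative row_has_derivative])+)
    (use assms in \<open>simp add: row_of_x0 multilinear_axis cm3_axis row_of_nth t3_def axis_nth_if algebra_simps\<close>)

text \<open>Besides the diagonal term, \<open>dq4\<close> contains 12 times
  \<open>(w \<bullet> w) * (w \<bullet> v)\<close> from the pairings. Varying either row changes
  that inner product, so both transposed entries appear, unlike in the cubic case.\<close>

lemma dq4_has_derivative:
  assumes "k \<noteq> l" "\<alpha> \<noteq> 1"
  shows "((\<lambda>p. dq4 (cm4 (snd p)) (row_of k (fst p)) (row_of l (fst p))) has_derivative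
    (\<lambda>h. t4 k l (snd h) + 12 * fst h $ (k, l) + 4 * (\<kappa> k + 3) * fst h $ (l, k))) (at (x0, m0))"
  unfolding dq4_def
  by (rule has_derivative_eq_rhs,
      (rule has_derivative_add ml4_at[OF row_has_derivative row_has_derivative row_has_derivative row_has_derivative])+)
    (use assms in \<open>simp add: row_of_x0 multilinear_axis cm4_axis row_of_nth t4_def axis_nth_if inner_axis inner_axis' algebra_simps\<close>)

text \<open>At the identity \<open>dq3\<close> and \<open>dq4\<close> vanish for different rows, so
  in the product rule the derivative \<open>D\<close> of the other factor drops out and only its
  existence matters.\<close>

lemma grad_has_derivative:
  assumes "k \<noteq> l"
  shows "((\<lambda>p. grad \<alpha> (snd p) (row_of k (fst p)) (row_of l (fst p))) has_derivative
    (\<lambda>h. \<alpha> * (\<gamma> k * (t3 k l (snd h) + 3 * \<gamma> k * fst h $ (l, k)))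
      + (1 - \<alpha>) * (\<kappa> k * (t4 k l (snd h) + 12 * fst h $ (k, l) + 4 * (\<kappa> k + 3) * fst h $ (l, k))))) (at (x0, m0))"
  unfolding grad_def
proof (rule has_derivative_add)
  obtain D where D: "((\<lambda>p. ml3 (cm3 (snd p)) (row_of k (fst p)) (row_of k (fst p)) (row_of k (fst p))) has_derivative D) (at (x0, m0))"
    by (rule that, rule ml3_has_derivative, rule cm_has_derivative, (rule row_has_derivative)+)
  have 0: "dq3 (cm3 m0) (axis k 1) (axis l 1) = 0" "ml3 (cm3 m0) (axis k 1) (axis k 1) (axis k 1) = \<gamma> k"
    using assms by (simp_all add: dq3_def cm3_axis axis_nth_if)
  show "((\<lambda>p. \<alpha> * (ml3 (cm3 (snd p)) (row_of k (fst p)) (row_of k (fst p)) (row_of k (fst p))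
      * dq3 (cm3 (snd p)) (row_of k (fst p)) (row_of l (fst p)))) has_derivative
      (\<lambda>h. \<alpha> * (\<gamma> k * (t3 k l (snd h) + 3 * \<gamma> k * fst h $ (l, k))))) (at (x0, m0))"
    by (rule has_derivative_eq_rhs, rule has_derivative_mult_right, rule has_derivative_mult[OF D dq3_has_derivative[OF assms]])
      (simp add: row_of_x0 0)
  show "((\<lambda>p. (1 - \<alpha>) * ((ml4 (cm4 (snd p)) (row_of k (fst p)) (row_of k (fst p)) (row_of k (fst p)) (row_of k (fst p)) - 3)
      * dq4 (cm4 (snd p)) (row_of k (fst p)) (row_of l (fst p)))) has_derivative
      (\<lambda>h. (1 - \<alpha>) * (\<kappa> k * (t4 k l (snd h) + 12 * fst h $ (k, l) + 4 * (\<kappa> k + 3) * fst h $ (l, k))))) (at (x0, m0))"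
  proof (cases "\<alpha> = 1")
    case False
    obtain D where D: "((\<lambda>p. ml4 (cm4 (snd p)) (row_of k (fst p)) (row_of k (fst p)) (row_of k (fst p)) (row_of k (fst p)) - 3)
        has_derivative D) (at (x0, m0))"
      by (rule that, rule has_derivative_diff, rule ml4_has_derivative, rule cm_has_derivative,
          (rule row_has_derivative)+, rule has_derivative_const)
    have 0: "dq4 (cm4 m0) (axis k 1) (axis l 1) = 0" "ml4 (cm4 m0) (axis k 1) (axis k 1) (axis k 1) (axis k 1) - 3 = \<kappa> k"
      using assms False by (simp_all add: dq4_def cm4_axis axis_nth_if inner_axis_axis)
    show ?thesis
      by (rule has_derivative_eq_rhs, rule has_derivative_mult_right, rule has_derivative_mult[OF D dq4_has_derivative[OF assms False]])
        (simp add: row_of_x0 0)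
  qed simp
qed

text \<open>The coefficient of the entry (l,k) in the linearized difference of the two gradients.
  The linearized whitening equation contains (k,l) and (l,k) with coefficient 1 each; after
  subtraction, \<open>- denom k l\<close> is what is left at (k,l).\<close>

definition coupling :: "'p \<Rightarrow> 'p \<Rightarrow> real" where
  "coupling k l = 3 * \<alpha> * (\<gamma> k)\<^sup>2 + 4 * (1 - \<alpha>) * (\<kappa> k * (\<kappa> k + 3) - 3 * \<kappa> l)"

definition denom :: "'p \<Rightarrow> 'p \<Rightarrow> real" where
  "denom k l = 3 * \<alpha> * ((\<gamma> k)\<^sup>2 + (\<gamma> l)\<^sup>2) + 4 * (1 - \<alpha>) * ((\<kappa> k)\<^sup>2 + (\<kappa> l)\<^sup>2)"

text \<open>Adding the multiple \<open>coupling k l\<close> of the whitening equation cancels the dependence of the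
  linearization on the transposed entry \<open>(l, k)\<close>.\<close>

definition estimating_eqn :: "'p \<times> 'p \<Rightarrow> (real ^ ('p \<times> 'p)) \<times> 'p moments \<Rightarrow> real" where
  "estimating_eqn i p = (let k = fst i; l = snd i; S = ml2 (cm2 (snd p)) (row_of k (fst p)) (row_of l (fst p)) in
     if k = l then S - 1
     else grad \<alpha> (snd p) (row_of k (fst p)) (row_of l (fst p)) - grad \<alpha> (snd p) (row_of l (fst p)) (row_of k (fst p))
       - coupling k l * S)"

text \<open>The diagonal value is 2 because the linearized whitening equation for
  \<open>k = l\<close> counts the entry (k,k) twice.\<close>

definition slope :: "'p \<times> 'p \<Rightarrow> real" where
  "slope i = (if fst i = snd i then 2 else - denom (fst i) (snd i))"

definition drive :: "'p \<times> 'p \<Rightarrow> 'p moments \<Rightarrow> real" where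
  "drive i d = (let k = fst i; l = snd i in if k = l then dcm2 d k k
     else \<alpha> * (\<gamma> k * t3 k l d) + (1 - \<alpha>) * (\<kappa> k * t4 k l d)
       - (\<alpha> * (\<gamma> l * t3 l k d) + (1 - \<alpha>) * (\<kappa> l * t4 l k d)) - coupling k l * dcm2 d k l)"

lemma denom_pos: "k \<noteq> l \<Longrightarrow> 0 < denom k l"
proof -
  assume "k \<noteq> l"
  have "0 \<le> \<alpha> * ((\<gamma> k)\<^sup>2 + (\<gamma> l)\<^sup>2)" "0 \<le> (1 - \<alpha>) * ((\<kappa> k)\<^sup>2 + (\<kappa> l)\<^sup>2)" using alpha by auto
  then show ?thesis using nondegenerate[OF \<open>k \<noteq> l\<close>] unfolding denom_def mult.assoc by linarith
qed

lemma estimating_eqn_has_derivative: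
  "(estimating_eqn i has_derivative (\<lambda>h. slope i * fst h $ i + drive i (snd h))) (at (x0, m0))"
proof -
  obtain k l where i: "i = (k, l)" by (cases i)
  show ?thesis
  proof (cases "k = l")
    case True
    have "((\<lambda>p. ml2 (cm2 (snd p)) (row_of k (fst p)) (row_of k (fst p)) - 1) has_derivative
        (\<lambda>h. dcm2 (snd h) k k + fst h $ (k, k) + fst h $ (k, k) - 0)) (at (x0, m0))"
      by (intro has_derivative_diff cov_has_derivative has_derivative_const)
    then show ?thesis
      unfolding i estimating_eqn_def Let_def slope_def drive_def using True
      by (auto elim!: has_derivative_eq_rhs)
  next
    case False
    from has_derivative_diff[OF has_derivative_diff[OF grad_has_derivative[OF False] grad_has_derivative[OF False[symmetric]]]
        has_derivative_mult_right[OF cov_has_derivative[of k l], of "coupling k l"]]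
    have "(estimating_eqn i has_derivative (\<lambda>h. \<alpha> * (\<gamma> k * (t3 k l (snd h) + 3 * \<gamma> k * fst h $ (l, k)))
      + (1 - \<alpha>) * (\<kappa> k * (t4 k l (snd h) + 12 * fst h $ (k, l) + 4 * (\<kappa> k + 3) * fst h $ (l, k)))
      - (\<alpha> * (\<gamma> l * (t3 l k (snd h) + 3 * \<gamma> l * fst h $ (k, l)))
      + (1 - \<alpha>) * (\<kappa> l * (t4 l k (snd h) + 12 * fst h $ (l, k) + 4 * (\<kappa> l + 3) * fst h $ (k, l))))
      - coupling k l * (dcm2 (snd h) k l + fst h $ (k, l) + fst h $ (l, k)))) (at (x0, m0))"
      unfolding estimating_eqn_def i Let_def using False by simp
    then show ?thesis
    proof (rule has_derivative_eq_rhs)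
      show "(\<lambda>h. \<alpha> * (\<gamma> k * (t3 k l (snd h) + 3 * \<gamma> k * fst h $ (l, k)))
      + (1 - \<alpha>) * (\<kappa> k * (t4 k l (snd h) + 12 * fst h $ (k, l) + 4 * (\<kappa> k + 3) * fst h $ (l, k)))
      - (\<alpha> * (\<gamma> l * (t3 l k (snd h) + 3 * \<gamma> l * fst h $ (k, l)))
      + (1 - \<alpha>) * (\<kappa> l * (t4 l k (snd h) + 12 * fst h $ (l, k) + 4 * (\<kappa> l + 3) * fst h $ (k, l))))
      - coupling k l * (dcm2 (snd h) k l + fst h $ (k, l) + fst h $ (l, k)))
        = (\<lambda>h. slope i * fst h $ i + drive i (snd h))"
      proof
        fix h :: "(real ^ ('p \<times> 'p)) \<times> 'p moments"
        \<comment> \<open>With variables in place of the moment terms and of the entries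
          \<open>u\<close> at (k,l) and \<open>v\<close> at (l,k) this is a polynomial identity, in
          which \<open>v\<close> cancels by the choice of \<open>coupling\<close>.\<close>
        have "\<alpha> * (\<gamma> k * (A + 3 * \<gamma> k * v)) + (1 - \<alpha>) * (\<kappa> k * (B + 12 * u + 4 * (\<kappa> k + 3) * v))
          - (\<alpha> * (\<gamma> l * (A' + 3 * \<gamma> l * u)) + (1 - \<alpha>) * (\<kappa> l * (B' + 12 * v + 4 * (\<kappa> l + 3) * u)))
          - coupling k l * (S + u + v)
          = - denom k l * u + (\<alpha> * (\<gamma> k * A) + (1 - \<alpha>) * (\<kappa> k * B) - (\<alpha> * (\<gamma> l * A') + (1 - \<alpha>) * (\<kappa> l * B')) - coupling k l * S)"
          for A B A' B' S u v
          unfolding coupling_def denom_def power2_eq_square by algebra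
        from this[of "t3 k l (snd h)" "fst h $ (l, k)" "t4 k l (snd h)" "fst h $ (k, l)" "t3 l k (snd h)" "t4 l k (snd h)" "dcm2 (snd h) k l"]
        show "\<alpha> * (\<gamma> k * (t3 k l (snd h) + 3 * \<gamma> k * fst h $ (l, k)))
      + (1 - \<alpha>) * (\<kappa> k * (t4 k l (snd h) + 12 * fst h $ (k, l) + 4 * (\<kappa> k + 3) * fst h $ (l, k)))
      - (\<alpha> * (\<gamma> l * (t3 l k (snd h) + 3 * \<gamma> l * fst h $ (k, l)))
      + (1 - \<alpha>) * (\<kappa> l * (t4 l k (snd h) + 12 * fst h $ (l, k) + 4 * (\<kappa> l + 3) * fst h $ (k, l))))
      - coupling k l * (dcm2 (snd h) k l + fst h $ (k, l) + fst h $ (l, k)) = slope i * fst h $ i + drive i (snd h)"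
          using False by (simp add: slope_def drive_def i)
      qed
    qed
  qed
qed

lemma estimating_eqn_estimate: "sym_pos_def (cov_of m) \<Longrightarrow> estimating_eqn i (vectorize (estimate m), m) = 0"
proof -
  assume m: "sym_pos_def (cov_of m)"
  obtain k l where i: "i = (k, l)" by (cases i)
  have "ml2 (cm2 m) (estimate m $ k) (estimate m $ l) = (if k = l then 1 else 0)"
    using estimate_whitens[OF m] ml2_matrix[of "estimate m" "cm2 m" k l] by (simp add: cov_of_def mat_def)
  then show ?thesis
    using estimate_grad[OF m, of k l] by (simp add: estimating_eqn_def i row_of_vectorize)
qed

theorem estimate_has_derivative:
  "((\<lambda>m. vectorize (estimate m)) has_derivative (\<lambda>d. \<chi> i. - drive i d / slope i)) (at m0)"
proof (rule implicit_derivative[where G = estimating_eqn])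
  show "(estimating_eqn i has_derivative (\<lambda>h. slope i * fst h $ i + drive i (snd h))) (at (vectorize (estimate m0), m0))" for i
    using estimating_eqn_has_derivative[of i] by (simp add: estimate_m0 x0_def)
  show "slope i \<noteq> 0" for i using denom_pos[of "fst i" "snd i"] by (auto simp: slope_def)
  have "continuous_on UNIV (vectorize :: real ^ 'p ^ 'p \<Rightarrow> _)"
    unfolding vectorize_def[abs_def] by (intro continuous_on_vec_lambda continuous_intros)
  then have "isCont (vectorize :: real ^ 'p ^ 'p \<Rightarrow> _) (estimate m0)"
    using continuous_on_eq_continuous_at[OF open_UNIV] by blast
  then show "isCont (\<lambda>m. vectorize (estimate m)) m0" by (rule isCont_o2[OF isCont_estimate])
  show "\<forall>\<^sub>F m in nhds m0. \<forall>i. estimating_eqn i (vectorize (estimate m), m) = 0"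
    using sym_pos_def_near by eventually_elim (simp add: estimating_eqn_estimate)
qed

end

section \<open>Sample moments\<close>

text \<open>For \<open>\<alpha> = 1\<close> fourth moments have weight zero in the objective; suppressing them here makes sixth
  moments suffice for square integrability.\<close>

definition monomials :: "real \<Rightarrow> real ^ 'p \<Rightarrow> 'p::finite moments" where
  "monomials \<alpha> x = (x, \<chi> a b. x $ a * x $ b, \<chi> a b c. x $ a * x $ b * x $ c,
     \<chi> a b c d. if \<alpha> = 1 then 0 else x $ a * x $ b * x $ c * x $ d)"

lemma raw_monomials:
  "raw1 (monomials \<alpha> x) a = x $ a" "raw2 (monomials \<alpha> x) a b = x $ a * x $ b"
  "raw3 (monomials \<alpha> x) a b c = x $ a * x $ b * x $ c"
  "raw4 (monomials \<alpha> x) a b c d = (if \<alpha> = 1 then 0 else x $ a * x $ b * x $ c * x $ d)"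
  by (simp_all add: monomials_def raw1_def raw2_def raw3_def raw4_def)

lemma monomials_measurable [measurable]: "monomials \<alpha> \<in> borel_measurable borel"
proof -
  have "continuous_on UNIV (monomials \<alpha>)"
    unfolding monomials_def[abs_def]
    by (cases "\<alpha> = 1") (auto intro!: continuous_on_Pair continuous_on_vec_lambda continuous_intros)
  then show ?thesis by (rule borel_measurable_continuous_onI)
qed

definition sample_moments :: "real \<Rightarrow> nat \<Rightarrow> (nat \<Rightarrow> real ^ 'p) \<Rightarrow> 'p::finite moments" where
  "sample_moments \<alpha> n x = (1 / real n) *\<^sub>R (\<Sum>i<n. monomials \<alpha> (x i))"

section \<open>Sample averages and the empirical objective\<close>

definition avg :: "nat \<Rightarrow> (nat \<Rightarrow> real) \<Rightarrow> real" where
  "avg n f = (1 / real n) * (\<Sum>i<n. f i)"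

lemma avg_linear:
  "avg n (\<lambda>i. f i + g i) = avg n f + avg n g" "avg n (\<lambda>i. f i - g i) = avg n f - avg n g"
  "avg n (\<lambda>i. c * f i) = c * avg n f"
  by (simp_all add: avg_def sum.distrib sum_subtractf sum_distrib_left[symmetric] distrib_left right_diff_distrib)

lemma avg_const: "n > 0 \<Longrightarrow> avg n (\<lambda>i. c) = c"
  by (simp add: avg_def)

lemma avg_sum: "avg n (\<lambda>i. \<Sum>a\<in>A. f a i) = (\<Sum>a\<in>A. avg n (f a))"
  unfolding avg_def by (subst sum.swap) (simp add: sum_distrib_left)

lemma avg_mult_right: "avg n (\<lambda>i. f i * c) = avg n f * c"
  by (simp add: avg_def sum_distrib_right)

lemma raw_sample_moments:
  "raw1 (sample_moments \<alpha> n x) a = avg n (\<lambda>i. x i $ a)"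
  "raw2 (sample_moments \<alpha> n x) a b = avg n (\<lambda>i. x i $ a * x i $ b)"
  "raw3 (sample_moments \<alpha> n x) a b c = avg n (\<lambda>i. x i $ a * x i $ b * x i $ c)"
  "\<alpha> \<noteq> 1 \<Longrightarrow> raw4 (sample_moments \<alpha> n x) a b c d = avg n (\<lambda>i. x i $ a * x i $ b * x i $ c * x i $ d)"
proof -
  have *: "f (sample_moments \<alpha> n x) = avg n (\<lambda>i. f (monomials \<alpha> (x i)))" if "bounded_linear f" for f :: "'a moments \<Rightarrow> real"
  proof -
    interpret bounded_linear f by fact
    show ?thesis by (simp add: sample_moments_def avg_def scaleR sum)
  qed
  show "raw1 (sample_moments \<alpha> n x) a = avg n (\<lambda>i. x i $ a)"
    using *[OF bounded_linear_raw1] by (simp add: raw_monomials)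
  show "raw2 (sample_moments \<alpha> n x) a b = avg n (\<lambda>i. x i $ a * x i $ b)"
    using *[OF bounded_linear_raw2] by (simp add: raw_monomials)
  show "raw3 (sample_moments \<alpha> n x) a b c = avg n (\<lambda>i. x i $ a * x i $ b * x i $ c)"
    using *[OF bounded_linear_raw3] by (simp add: raw_monomials)
  show "raw4 (sample_moments \<alpha> n x) a b c d = avg n (\<lambda>i. x i $ a * x i $ b * x i $ c * x i $ d)" if "\<alpha> \<noteq> 1"
    using *[OF bounded_linear_raw4] that by (simp add: raw_monomials)
qed

lemma sample_mean_avg: "sample_mean n x $ a = avg n (\<lambda>i. x i $ a)"
  by (simp add: sample_mean_def avg_def)

lemma central_moments:
  fixes x :: "nat \<Rightarrow> real ^ 'p::finite"
  assumes n: "n > 0"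
  defines "d \<equiv> \<lambda>i. x i - sample_mean n x"
  shows "cm2 (sample_moments \<alpha> n x) a b = avg n (\<lambda>i. d i $ a * d i $ b)"
    "cm3 (sample_moments \<alpha> n x) a b c = avg n (\<lambda>i. d i $ a * d i $ b * d i $ c)"
    "\<alpha> \<noteq> 1 \<Longrightarrow> cm4 (sample_moments \<alpha> n x) a b c e = avg n (\<lambda>i. d i $ a * d i $ b * d i $ c * d i $ e)"
proof -
  define A where "A a = avg n (\<lambda>i. x i $ a)" for a
  have d: "d i $ a = x i $ a - A a" for i a by (simp add: d_def sample_mean_avg A_def)
  have "avg n (\<lambda>i. d i $ a * d i $ b) = avg n (\<lambda>i. x i $ a * x i $ b - A b * x i $ a - A a * x i $ b + A a * A b)"
    unfolding d by (simp add: algebra_simps)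
  also have "\<dots> = avg n (\<lambda>i. x i $ a * x i $ b) - A a * A b"
    unfolding avg_linear avg_const[OF n] by (simp add: A_def)
  finally show "cm2 (sample_moments \<alpha> n x) a b = avg n (\<lambda>i. d i $ a * d i $ b)"
    by (simp add: cm2_def raw_sample_moments A_def mult.commute)
  have "avg n (\<lambda>i. d i $ a * d i $ b * d i $ c) = avg n (\<lambda>i. x i $ a * x i $ b * x i $ c
      - A c * (x i $ a * x i $ b) - A b * (x i $ a * x i $ c) - A a * (x i $ b * x i $ c)
      + (A a * A b) * x i $ c + (A a * A c) * x i $ b + (A b * A c) * x i $ a - A a * A b * A c)"
    unfolding d by (simp add: algebra_simps)
  also have "\<dots> = avg n (\<lambda>i. x i $ a * x i $ b * x i $ c) - A c * avg n (\<lambda>i. x i $ a * x i $ b)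
      - A b * avg n (\<lambda>i. x i $ a * x i $ c) - A a * avg n (\<lambda>i. x i $ b * x i $ c) + 2 * A a * A b * A c"
    unfolding avg_linear avg_const[OF n] by (simp add: A_def)
  finally show "cm3 (sample_moments \<alpha> n x) a b c = avg n (\<lambda>i. d i $ a * d i $ b * d i $ c)"
    by (simp add: cm3_def raw_sample_moments A_def mult.commute)
  assume \<alpha>: "\<alpha> \<noteq> 1"
  have "avg n (\<lambda>i. d i $ a * d i $ b * d i $ c * d i $ e) = avg n (\<lambda>i. x i $ a * x i $ b * x i $ c * x i $ e
      - A e * (x i $ a * x i $ b * x i $ c) - A c * (x i $ a * x i $ b * x i $ e)
      - A b * (x i $ a * x i $ c * x i $ e) - A a * (x i $ b * x i $ c * x i $ e)
      + (A c * A e) * (x i $ a * x i $ b) + (A b * A e) * (x i $ a * x i $ c) + (A b * A c) * (x i $ a * x i $ e)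
      + (A a * A e) * (x i $ b * x i $ c) + (A a * A c) * (x i $ b * x i $ e) + (A a * A b) * (x i $ c * x i $ e)
      - (A a * A b * A c) * x i $ e - (A a * A b * A e) * x i $ c - (A a * A c * A e) * x i $ b - (A b * A c * A e) * x i $ a
      + A a * A b * A c * A e)"
    unfolding d by (rule arg_cong[of _ _ "avg n"], rule ext) algebra
  also have "\<dots> = cm4 (sample_moments \<alpha> n x) a b c e"
    unfolding avg_linear avg_const[OF n] cm4_def raw_sample_moments(1-3) raw_sample_moments(4)[OF \<alpha>] A_def[symmetric] by algebra
  finally show "cm4 (sample_moments \<alpha> n x) a b c e = avg n (\<lambda>i. d i $ a * d i $ b * d i $ c * d i $ e)" by simp
qed

lemma sample_cov_avg:
  "sample_cov n x $ a $ b = avg n (\<lambda>i. (x i - sample_mean n x) $ a * (x i - sample_mean n x) $ b)"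
  by (simp add: sample_cov_def avg_def)

lemma cov_of_sample_moments: "n > 0 \<Longrightarrow> cov_of (sample_moments \<alpha> n x) = sample_cov n x"
  by (simp add: vec_eq_iff cov_of_def central_moments(1) sample_cov_avg)

lemma inner_power3: "(w \<bullet> d) ^ 3 = (\<Sum>a\<in>UNIV. \<Sum>b\<in>UNIV. \<Sum>c\<in>UNIV. d $ a * d $ b * d $ c * w $ a * w $ b * w $ c)"
  for w :: "real ^ 'p::finite"
  by (simp add: power3_eq_cube inner_vec_def sum_product sum_distrib_left mult_ac)

lemma inner_power4: "(w \<bullet> d) ^ 4 = (\<Sum>a\<in>UNIV. \<Sum>b\<in>UNIV. \<Sum>c\<in>UNIV. \<Sum>e\<in>UNIV. d $ a * d $ b * d $ c * d $ e * w $ a * w $ b * w $ c * w $ e)"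
  for w :: "real ^ 'p::finite"
  by (simp add: power4_eq_xxxx inner_vec_def sum_product sum_distrib_left mult_ac)

lemma projection_moments:
  fixes x :: "nat \<Rightarrow> real ^ 'p::finite"
  assumes n: "n > 0"
  shows "avg n (\<lambda>i. (w \<bullet> (x i - sample_mean n x)) ^ 3) = ml3 (cm3 (sample_moments \<alpha> n x)) w w w"
    "\<alpha> \<noteq> 1 \<Longrightarrow> avg n (\<lambda>i. (w \<bullet> (x i - sample_mean n x)) ^ 4) = ml4 (cm4 (sample_moments \<alpha> n x)) w w w w"
proof -
  show "avg n (\<lambda>i. (w \<bullet> (x i - sample_mean n x)) ^ 3) = ml3 (cm3 (sample_moments \<alpha> n x)) w w w"
    unfolding inner_power3 ml3_def by (simp only: central_moments(2)[OF n] avg_sum avg_mult_right)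
  assume \<alpha>: "\<alpha> \<noteq> 1"
  show "avg n (\<lambda>i. (w \<bullet> (x i - sample_mean n x)) ^ 4) = ml4 (cm4 (sample_moments \<alpha> n x)) w w w w"
    unfolding inner_power4 ml4_def by (simp only: central_moments(3)[OF n \<alpha>] avg_sum avg_mult_right)
qed

text \<open>The whitener is moved from the data to the rows of \<open>U\<close>, and powers of
  projections expand into the central moment tensors. The equality also covers \<alpha> = 1, where
  the suppressed fourth moments carry the factor zero.\<close>

lemma spp_objective_eq:
  fixes x :: "nat \<Rightarrow> real ^ 'p::finite"
  assumes n: "n > 0"
  shows "spp_objective \<alpha> n (whitened n x) U = objective \<alpha> (sample_moments \<alpha> n x) (U ** inv_sqrt (sample_cov n x))"
proof -
  let ?R = "inv_sqrt (sample_cov n x)"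
  have dot: "U $ k \<bullet> whitened n x i = (U ** ?R) $ k \<bullet> (x i - sample_mean n x)" for k i
    unfolding whitened_def by (metis matrix_vector_mul_assoc matrix_vector_mul_component)
  have 4: "(1 - \<alpha>) * (\<Sum>k\<in>UNIV. (avg n (\<lambda>i. (U $ k \<bullet> whitened n x i) ^ 4) - 3)\<^sup>2)
      = (1 - \<alpha>) * (\<Sum>k\<in>UNIV. (ml4 (cm4 (sample_moments \<alpha> n x)) ((U ** ?R) $ k) ((U ** ?R) $ k) ((U ** ?R) $ k) ((U ** ?R) $ k) - 3)\<^sup>2)"
    by (cases "\<alpha> = 1") (simp_all add: dot projection_moments(2)[OF n])
  have "spp_objective \<alpha> n (whitened n x) U = \<alpha> * (\<Sum>k\<in>UNIV. (avg n (\<lambda>i. (U $ k \<bullet> whitened n x i) ^ 3))\<^sup>2)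
      + (1 - \<alpha>) * (\<Sum>k\<in>UNIV. (avg n (\<lambda>i. (U $ k \<bullet> whitened n x i) ^ 4) - 3)\<^sup>2)"
    by (simp add: spp_objective_def avg_def)
  then show ?thesis
    unfolding 4 unfolding dot projection_moments(1)[OF n, where \<alpha> = \<alpha>]
    by (simp add: objective_def row_obj_def sum.distrib sum_distrib_left)
qed

lemma sample_cov_sym_pos_def:
  fixes x :: "nat \<Rightarrow> real ^ 'p::finite"
  assumes "invertible (sample_cov n x)"
  shows "n > 0" "sym_pos_def (sample_cov n x)"
proof -
  show "n > 0"
  proof (rule ccontr)
    assume "\<not> n > 0"
    \<comment> \<open>With \<open>n = 0\<close> all sums are empty, so the covariance is zero and
      not invertible.\<close>
    then have "sample_cov n x = mat 0" by (simp add: sample_cov_def mat_def vec_eq_iff)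
    moreover have "\<not> invertible (mat 0 :: real ^ 'p ^ 'p)"
      by (auto simp: invertible_def matrix_matrix_mult_def mat_def vec_eq_iff)
    ultimately show False using assms by simp
  qed
  have "0 \<le> v \<bullet> (sample_cov n x *v v)" for v
  proof -
    have "v \<bullet> (sample_cov n x *v v) = avg n (\<lambda>i. (v \<bullet> (x i - sample_mean n x))\<^sup>2)"
    proof -
      have "(v \<bullet> d)\<^sup>2 = (\<Sum>a\<in>UNIV. \<Sum>b\<in>UNIV. (d $ a * d $ b) * (v $ a * v $ b))" for d
        by (simp add: power2_eq_square inner_vec_def sum_product mult_ac)
      then show ?thesis
        unfolding quad_form_sum sample_cov_avg by (simp only: avg_sum avg_mult_right) (simp only: mult.commute)
    qed
    also have "\<dots> \<ge> 0" by (simp add: avg_def sum_nonneg)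
    finally show ?thesis .
  qed
  then have "psd (sample_cov n x)"
    by (simp add: psd_def transpose_def vec_eq_iff sample_cov_def mult.commute)
  then show "sym_pos_def (sample_cov n x)" using assms by (simp add: sym_pos_def_iff)
qed

lemma (in closest_maximizer) estimate_spp_solution:
  assumes "invertible (sample_cov n x)"
  shows "spp_solution \<alpha> n x (estimate (sample_moments \<alpha> n x))"
proof -
  note S = sample_cov_sym_pos_def[OF assms]
  let ?m = "sample_moments \<alpha> n x"
  have spd: "sym_pos_def (cov_of ?m)" using S by (simp add: cov_of_sample_moments)
  have w: "whitener ?m = inv_sqrt (sample_cov n x)" using spd by (simp add: whitener_def cov_of_sample_moments S(1))
  show ?thesis
    unfolding spp_solution_def
  proof (intro exI conjI)
    show "estimate ?m = s (whitener ?m, ?m) ** inv_sqrt (sample_cov n x)"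
      using estimate_eq[OF spd] by (simp add: cov_of_sample_moments S(1))
    show "is_arg_max (spp_objective \<alpha> n (whitened n x)) orthogonal_matrix (s (whitener ?m, ?m))"
      unfolding is_arg_max_def spp_objective_eq[OF S(1)] w[symmetric]
      using s_orthogonal s_max[of _ "(whitener ?m, ?m)"] by (auto simp: not_less)
  qed
qed

section \<open>Population moments\<close>

locale independent_components = prob_space N for N :: "'a measure" +
  fixes z :: "'a \<Rightarrow> real ^ 'p::finite"
  assumes z_measurable [measurable]: "z \<in> borel_measurable N"
    and indep_components: "indep_vars (\<lambda>_. borel) (\<lambda>k \<omega>. z \<omega> $ k) UNIV"
    and mean_zero: "expectation (\<lambda>\<omega>. z \<omega> $ k) = 0"
    and var_one: "variance (\<lambda>\<omega>. z \<omega> $ k) = 1"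
begin

lemma component_measurable [measurable]: "(\<lambda>\<omega>. z \<omega> $ k) \<in> borel_measurable N"
  using indep_components unfolding indep_vars_def2 by simp

lemma moment_small: "moment N z 0 k = 1" "moment N z (Suc 0) k = 0" "moment N z 2 k = 1"
  using mean_zero[of k] var_one[of k] by (simp_all add: moment_def prob_space)

lemma integrable_power:
  assumes "finite_moments N z r" "i \<le> r"
  shows "integrable N (\<lambda>\<omega>. (z \<omega> $ k) ^ i)"
proof (rule Bochner_Integration.integrable_bound)
  show "integrable N (\<lambda>\<omega>. 1 + \<bar>z \<omega> $ k\<bar> ^ r)"
    using assms(1) by (auto simp: finite_moments_def)
  have "\<bar>y\<bar> ^ i \<le> 1 + \<bar>y\<bar> ^ r" for y :: real
  proof (cases "\<bar>y\<bar> \<le> 1")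
    case True
    then have "\<bar>y\<bar> ^ i \<le> 1" by (simp add: power_le_one)
    then show ?thesis by (smt (verit) zero_le_power abs_ge_zero)
  next
    case False
    then have "\<bar>y\<bar> ^ i \<le> \<bar>y\<bar> ^ r" using assms(2) by (intro power_increasing) auto
    then show ?thesis by simp
  qed
  then show "AE \<omega> in N. norm ((z \<omega> $ k) ^ i) \<le> norm (1 + \<bar>z \<omega> $ k\<bar> ^ r)"
    by (auto intro!: AE_I2 simp: power_abs)
qed measurable

lemma monomial:
  assumes "\<And>j. integrable N (\<lambda>\<omega>. (z \<omega> $ j) ^ e j)"
  shows "integrable N (\<lambda>\<omega>. \<Prod>j\<in>UNIV. (z \<omega> $ j) ^ e j)"
    "expectation (\<lambda>\<omega>. \<Prod>j\<in>UNIV. (z \<omega> $ j) ^ e j) = (\<Prod>j\<in>UNIV. moment N z (e j) j)"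
proof -
  have "indep_vars (\<lambda>_. borel) (\<lambda>j \<omega>. (z \<omega> $ j) ^ e j) UNIV"
    by (rule indep_vars_compose2[OF indep_components, where Y = "\<lambda>j x. x ^ e j"]) measurable
  from indep_vars_integrable[OF finite this assms] indep_vars_lebesgue_integral[OF finite this assms]
  show "integrable N (\<lambda>\<omega>. \<Prod>j\<in>UNIV. (z \<omega> $ j) ^ e j)"
    "expectation (\<lambda>\<omega>. \<Prod>j\<in>UNIV. (z \<omega> $ j) ^ e j) = (\<Prod>j\<in>UNIV. moment N z (e j) j)"
    by (simp_all add: moment_def)
qed

text \<open>Grouping equal indices turns a mixed monomial into a product of powers of distinct
  components, to which independence applies whatever the pattern of coincidences.\<close>

lemma prod_list_count: "prod_list (map f xs) = (\<Prod>j\<in>UNIV. f j ^ count_list xs j)" for f :: "'p \<Rightarrow> real"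
proof (induction xs)
  case (Cons a xs)
  have "(\<Prod>j\<in>UNIV. f j ^ count_list (a # xs) j) = (\<Prod>j\<in>UNIV. (if j = a then f j else 1) * f j ^ count_list xs j)"
    by (intro prod.cong) auto
  also have "\<dots> = f a * (\<Prod>j\<in>UNIV. f j ^ count_list xs j)"
    by (simp add: prod.distrib)
  finally show ?case using Cons by simp
qed simp

lemma list_monomial:
  assumes "finite_moments N z r" "length xs \<le> r"
  shows "integrable N (\<lambda>\<omega>. prod_list (map (\<lambda>a. z \<omega> $ a) xs))"
    "expectation (\<lambda>\<omega>. prod_list (map (\<lambda>a. z \<omega> $ a) xs)) = (\<Prod>j\<in>set xs. moment N z (count_list xs j) j)"
proof -
  have int: "integrable N (\<lambda>\<omega>. (z \<omega> $ j) ^ count_list xs j)" for j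
    by (rule integrable_power[OF assms(1) order_trans[OF count_le_length assms(2)]])
  show "integrable N (\<lambda>\<omega>. prod_list (map (\<lambda>a. z \<omega> $ a) xs))"
    unfolding prod_list_count by (rule monomial(1)[OF int])
  have "expectation (\<lambda>\<omega>. prod_list (map (\<lambda>a. z \<omega> $ a) xs)) = (\<Prod>j\<in>UNIV. moment N z (count_list xs j) j)"
    unfolding prod_list_count by (rule monomial(2)[OF int])
  also have "\<dots> = (\<Prod>j\<in>set xs. moment N z (count_list xs j) j)"
    by (rule prod.mono_neutral_right) (auto simp: moment_small count_list_0_iff)
  finally show "expectation (\<lambda>\<omega>. prod_list (map (\<lambda>a. z \<omega> $ a) xs)) = (\<Prod>j\<in>set xs. moment N z (count_list xs j) j)" .
qed

lemma second_moments: "finite_moments N z r \<Longrightarrow> 2 \<le> r \<Longrightarrow> expectation (\<lambda>\<omega>. z \<omega> $ a * z \<omega> $ b) = delta a b"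
  using list_monomial(2)[of r "[a, b]"]
  by (cases "a = b") (simp_all add: moment_small delta_def eval_nat_numeral(2)[symmetric] numeral_2_eq_2[symmetric])

lemma third_moments:
  assumes "finite_moments N z r" "3 \<le> r"
  shows "expectation (\<lambda>\<omega>. z \<omega> $ a * z \<omega> $ b * z \<omega> $ c) = mgamma N z a * delta a b * delta a c"
proof -
  have 3: "Suc (Suc (Suc 0)) = 3" "Suc (Suc 0) = 2" by simp_all
  have "expectation (\<lambda>\<omega>. z \<omega> $ a * z \<omega> $ b * z \<omega> $ c) = (\<Prod>j\<in>set [a, b, c]. moment N z (count_list [a, b, c] j) j)"
    using list_monomial(2)[OF assms(1), of "[a, b, c]"] assms(2) by (simp add: mult.assoc)
  also have "\<dots> = mgamma N z a * delta a b * delta a c"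
    by (cases "a = b"; cases "a = c"; cases "b = c")
      (auto simp: moment_small delta_def mgamma_def insert_absorb 3)
  finally show ?thesis .
qed

text \<open>An index occurring exactly once contributes a mean and makes the product zero. Two
  distinct pairs give 1, and four equal indices give the kurtosis, which is \<kappa> plus the three
  pairings.\<close>

lemma fourth_moments:
  assumes "finite_moments N z r" "4 \<le> r"
  shows "expectation (\<lambda>\<omega>. z \<omega> $ a * z \<omega> $ b * z \<omega> $ c * z \<omega> $ d)
    = mkappa N z a * delta a b * delta a c * delta a d + delta a b * delta c d + delta a c * delta b d + delta a d * delta b c"
proof -
  have 4: "Suc (Suc (Suc (Suc 0))) = 4" "Suc (Suc (Suc 0)) = 3" "Suc (Suc 0) = 2" by simp_all
  have sets: "{x, y, x, y} = {x, y}" "{y, x, y} = {x, y}" for x y :: 'p by auto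
  have "expectation (\<lambda>\<omega>. z \<omega> $ a * z \<omega> $ b * z \<omega> $ c * z \<omega> $ d)
      = (\<Prod>j\<in>set [a, b, c, d]. moment N z (count_list [a, b, c, d] j) j)"
    using list_monomial(2)[OF assms(1), of "[a, b, c, d]"] assms(2) by (simp add: mult.assoc)
  also have "\<dots> = mkappa N z a * delta a b * delta a c * delta a d + delta a b * delta c d + delta a c * delta b d + delta a d * delta b c"
    by (cases "a = b"; cases "a = c"; cases "a = d"; cases "b = c"; cases "b = d"; cases "c = d")
      (auto simp: moment_small delta_def mkappa_def mbeta_def 4 sets)
  finally show ?thesis .
qed

definition "suitable \<alpha> \<longleftrightarrow> finite_moments N z 6 \<and> (\<alpha> \<noteq> (1::real) \<longrightarrow> finite_moments N z 8)"

lemma monomials_square_integrable: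
  assumes "suitable \<alpha>"
  shows "integrable N (\<lambda>\<omega>. (norm (monomials \<alpha> (z \<omega>)))\<^sup>2)"
proof -
  have fm6: "finite_moments N z 6" using assms by (simp add: suitable_def)
  have i1: "integrable N (\<lambda>\<omega>. z \<omega> $ a * z \<omega> $ a)" for a
    using list_monomial(1)[OF fm6, of "[a, a]"] by simp
  have i2: "integrable N (\<lambda>\<omega>. z \<omega> $ a * z \<omega> $ b * (z \<omega> $ a * z \<omega> $ b))" for a b
    using list_monomial(1)[OF fm6, of "[a, b, a, b]"] by (simp add: mult_ac)
  have i3: "integrable N (\<lambda>\<omega>. z \<omega> $ a * z \<omega> $ b * z \<omega> $ c * (z \<omega> $ a * z \<omega> $ b * z \<omega> $ c))" for a b c
    using list_monomial(1)[OF fm6, of "[a, b, c, a, b, c]"] by (simp add: mult_ac)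
  have i4: "integrable N (\<lambda>\<omega>. (if \<alpha> = 1 then 0 else z \<omega> $ a * z \<omega> $ b * z \<omega> $ c * z \<omega> $ d) *
      (if \<alpha> = 1 then 0 else z \<omega> $ a * z \<omega> $ b * z \<omega> $ c * z \<omega> $ d))" for a b c d
  proof (cases "\<alpha> = 1")
    case False
    then have "finite_moments N z 8" using assms by (simp add: suitable_def)
    from list_monomial(1)[OF this, of "[a, b, c, d, a, b, c, d]"] False show ?thesis by (simp add: mult_ac)
  qed simp
  show ?thesis
    unfolding power2_norm_eq_inner monomials_def inner_prod_def inner_vec_def fst_conv snd_conv vec_lambda_beta inner_real_def
    by (intro Bochner_Integration.integrable_add Bochner_Integration.integrable_sum i1 i2 i3 i4)
qed

lemma monomials_integrable: "suitable \<alpha> \<Longrightarrow> integrable N (\<lambda>\<omega>. monomials \<alpha> (z \<omega>))"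
  using square_integrable_imp_integrable[of "\<lambda>\<omega>. norm (monomials \<alpha> (z \<omega>))"] monomials_square_integrable[of \<alpha>]
  by (simp add: integrable_norm_iff)

definition population_moments :: "real \<Rightarrow> 'p moments" where "population_moments \<alpha> = (\<integral>\<omega>. monomials \<alpha> (z \<omega>) \<partial>N)"

lemma raw_population_moments:
  assumes "suitable \<alpha>"
  shows "raw1 (population_moments \<alpha>) a = 0" "raw2 (population_moments \<alpha>) a b = delta a b" "raw3 (population_moments \<alpha>) a b c = mgamma N z a * delta a b * delta a c"
    "\<alpha> \<noteq> 1 \<Longrightarrow> raw4 (population_moments \<alpha>) a b c d = mkappa N z a * delta a b * delta a c * delta a d
      + delta a b * delta c d + delta a c * delta b d + delta a d * delta b c"
proof -
  have fm6: "finite_moments N z 6" using assms by (simp add: suitable_def)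
  have *: "f (population_moments \<alpha>) = expectation (\<lambda>\<omega>. f (monomials \<alpha> (z \<omega>)))" if "bounded_linear f" for f :: "'p moments \<Rightarrow> real"
    unfolding population_moments_def using integral_bounded_linear[OF that monomials_integrable[OF assms]] by simp
  show "raw1 (population_moments \<alpha>) a = 0" using *[OF bounded_linear_raw1] mean_zero by (simp add: raw_monomials)
  show "raw2 (population_moments \<alpha>) a b = delta a b" using *[OF bounded_linear_raw2] second_moments[OF fm6] by (simp add: raw_monomials)
  show "raw3 (population_moments \<alpha>) a b c = mgamma N z a * delta a b * delta a c"
    using *[OF bounded_linear_raw3] third_moments[OF fm6] by (simp add: raw_monomials)
  show "raw4 (population_moments \<alpha>) a b c d = mkappa N z a * delta a b * delta a c * delta a d
      + delta a b * delta c d + delta a c * delta b d + delta a d * delta b c" if "\<alpha> \<noteq> 1"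
    using *[OF bounded_linear_raw4] fourth_moments[OF fm6] that by (simp add: raw_monomials)
qed

section \<open>Second moments of cubic expressions in two components\<close>

lemma product_expectation:
  fixes f g :: "real \<Rightarrow> real"
  assumes "k \<noteq> l" and [measurable]: "f \<in> borel_measurable borel" "g \<in> borel_measurable borel"
    and "integrable N (\<lambda>\<omega>. f (z \<omega> $ k))" "integrable N (\<lambda>\<omega>. g (z \<omega> $ l))"
  shows "integrable N (\<lambda>\<omega>. f (z \<omega> $ k) * g (z \<omega> $ l))"
    "expectation (\<lambda>\<omega>. f (z \<omega> $ k) * g (z \<omega> $ l)) = expectation (\<lambda>\<omega>. f (z \<omega> $ k)) * expectation (\<lambda>\<omega>. g (z \<omega> $ l))"
proof -
  have i: "indep_vars (\<lambda>_. borel) (\<lambda>j \<omega>. (if j = k then f else g) (z \<omega> $ j)) {k, l}"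
    by (rule indep_vars_compose2[OF indep_vars_subset[OF indep_components]]) auto
  have j: "integrable N (\<lambda>\<omega>. (if j = k then f else g) (z \<omega> $ j))" if "j \<in> {k, l}" for j
    using that assms by auto
  have "integrable N (\<lambda>\<omega>. \<Prod>j\<in>{k, l}. (if j = k then f else g) (z \<omega> $ j))"
    "expectation (\<lambda>\<omega>. \<Prod>j\<in>{k, l}. (if j = k then f else g) (z \<omega> $ j))
      = (\<Prod>j\<in>{k, l}. expectation (\<lambda>\<omega>. (if j = k then f else g) (z \<omega> $ j)))"
    by (rule indep_vars_integrable[OF _ i j] indep_vars_lebesgue_integral[OF _ i j]; simp)+
  then show "integrable N (\<lambda>\<omega>. f (z \<omega> $ k) * g (z \<omega> $ l))"
    "expectation (\<lambda>\<omega>. f (z \<omega> $ k) * g (z \<omega> $ l)) = expectation (\<lambda>\<omega>. f (z \<omega> $ k)) * expectation (\<lambda>\<omega>. g (z \<omega> $ l))"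
    using assms(1) by simp_all
qed

lemma polynomial_expectation:
  assumes "finite_moments N z 6"
  shows "integrable N (\<lambda>\<omega>. \<Sum>i\<le>6. c i * (z \<omega> $ k) ^ i)"
    "expectation (\<lambda>\<omega>. \<Sum>i\<le>6. c i * (z \<omega> $ k) ^ i) = (\<Sum>i\<le>6. c i * moment N z i k)"
proof -
  have int: "integrable N (\<lambda>\<omega>. c i * (z \<omega> $ k) ^ i)" if "i \<in> {..6}" for i
    using integrable_power[OF assms, of i k] that by simp
  show "integrable N (\<lambda>\<omega>. \<Sum>i\<le>6. c i * (z \<omega> $ k) ^ i)"
    using int by (rule Bochner_Integration.integrable_sum)
  show "expectation (\<lambda>\<omega>. \<Sum>i\<le>6. c i * (z \<omega> $ k) ^ i) = (\<Sum>i\<le>6. c i * moment N z i k)"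
    using int by (subst Bochner_Integration.integral_sum) (auto simp: moment_def)
qed

lemma cubic_expectation:
  fixes a b c d :: real
  defines "p \<equiv> \<lambda>x. a + b * x + c * x\<^sup>2 + d * x ^ 3"
  assumes fm: "finite_moments N z 6"
  shows "integrable N (\<lambda>\<omega>. (p (z \<omega> $ k))\<^sup>2)"
    "expectation (\<lambda>\<omega>. (p (z \<omega> $ k))\<^sup>2) = a\<^sup>2 + b\<^sup>2 + 2 * a * c + (2 * a * d + 2 * b * c) * moment N z 3 k
       + (2 * b * d + c\<^sup>2) * moment N z 4 k + 2 * c * d * moment N z 5 k + d\<^sup>2 * moment N z 6 k"
    "integrable N (\<lambda>\<omega>. p (z \<omega> $ k) * z \<omega> $ k)"
    "expectation (\<lambda>\<omega>. p (z \<omega> $ k) * z \<omega> $ k) = b + c * moment N z 3 k + d * moment N z 4 k"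
proof -
  \<comment> \<open>Coefficients by degree of the square of \<open>p\<close>, and in
    \<open>c2\<close> of \<open>p x * x\<close>; both have degree at most 6, so sixth moments
    suffice.\<close>
  define c1 where "c1 = (\<lambda>i::nat. [a\<^sup>2, 2 * a * b, b\<^sup>2 + 2 * a * c, 2 * a * d + 2 * b * c, 2 * b * d + c\<^sup>2, 2 * c * d, d\<^sup>2] ! i)"
  define c2 where "c2 = (\<lambda>i::nat. [0, a, b, c, d, 0, 0] ! i)"
  have six: "{..6::nat} = {0, 1, 2, 3, 4, 5, 6}" by auto
  have 1: "(p x)\<^sup>2 = (\<Sum>i\<le>6. c1 i * x ^ i)" for x
    by (simp add: p_def c1_def six eval_nat_numeral algebra_simps)
  have 2: "p x * x = (\<Sum>i\<le>6. c2 i * x ^ i)" for x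
    by (simp add: p_def c2_def six eval_nat_numeral algebra_simps)
  show "integrable N (\<lambda>\<omega>. (p (z \<omega> $ k))\<^sup>2)" "integrable N (\<lambda>\<omega>. p (z \<omega> $ k) * z \<omega> $ k)"
    unfolding 1 2 by (rule polynomial_expectation(1)[OF fm])+
  have m: "moment N z 0 k = 1" "moment N z 1 k = 0" "moment N z 2 k = 1" using moment_small by simp_all
  note m' = m moment_small(2)
  show "expectation (\<lambda>\<omega>. p (z \<omega> $ k) * z \<omega> $ k) = b + c * moment N z 3 k + d * moment N z 4 k"
    unfolding 2 polynomial_expectation(2)[OF fm] by (simp add: six m' c2_def)
  show "expectation (\<lambda>\<omega>. (p (z \<omega> $ k))\<^sup>2) = a\<^sup>2 + b\<^sup>2 + 2 * a * c + (2 * a * d + 2 * b * c) * moment N z 3 k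
       + (2 * b * d + c\<^sup>2) * moment N z 4 k + 2 * c * d * moment N z 5 k + d\<^sup>2 * moment N z 6 k"
    unfolding 1 polynomial_expectation(2)[OF fm] by (simp add: six m' c1_def)
qed

text \<open>Expanding the square, the mixed term factors by independence into the means of
  \<open>p(z_k) z_k\<close> and \<open>q(z_l) z_l\<close>; the first is zero by assumption. In the
  squares the other component contributes its variance 1.\<close>

lemma cross_variance:
  fixes a b c d a' b' c' d' :: real
  defines "p \<equiv> \<lambda>x. a + b * x + c * x\<^sup>2 + d * x ^ 3" and "q \<equiv> \<lambda>x. a' + b' * x + c' * x\<^sup>2 + d' * x ^ 3"
  assumes fm: "finite_moments N z 6" and "k \<noteq> l" and zero: "b + c * moment N z 3 k + d * moment N z 4 k = 0"
  shows "expectation (\<lambda>\<omega>. (p (z \<omega> $ k) * z \<omega> $ l - q (z \<omega> $ l) * z \<omega> $ k)\<^sup>2)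
    = expectation (\<lambda>\<omega>. (p (z \<omega> $ k))\<^sup>2) + expectation (\<lambda>\<omega>. (q (z \<omega> $ l))\<^sup>2)"
proof -
  have P: "integrable N (\<lambda>\<omega>. (p (z \<omega> $ k))\<^sup>2)" "integrable N (\<lambda>\<omega>. p (z \<omega> $ k) * z \<omega> $ k)"
    "expectation (\<lambda>\<omega>. p (z \<omega> $ k) * z \<omega> $ k) = 0"
    and Q: "integrable N (\<lambda>\<omega>. (q (z \<omega> $ l))\<^sup>2)" "integrable N (\<lambda>\<omega>. q (z \<omega> $ l) * z \<omega> $ l)"
    unfolding p_def q_def zero[symmetric] by (rule cubic_expectation[OF fm])+
  have [measurable]: "p \<in> borel_measurable borel" "q \<in> borel_measurable borel" by (simp_all add: p_def q_def)
  have sq: "integrable N (\<lambda>\<omega>. (z \<omega> $ j)\<^sup>2)" "expectation (\<lambda>\<omega>. (z \<omega> $ j)\<^sup>2) = 1" for j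
    using integrable_power[OF fm, of 2 j] moment_small(3)[of j] by (simp_all add: moment_def)
  note A = product_expectation[OF \<open>k \<noteq> l\<close>, of "\<lambda>x. (p x)\<^sup>2" "\<lambda>x. x\<^sup>2", OF _ _ P(1) sq(1)]
  note B = product_expectation[OF \<open>k \<noteq> l\<close>, of "\<lambda>x. x\<^sup>2" "\<lambda>x. (q x)\<^sup>2", OF _ _ sq(1) Q(1)]
  note C = product_expectation[OF \<open>k \<noteq> l\<close>, of "\<lambda>x. p x * x" "\<lambda>x. q x * x", OF _ _ P(2) Q(2)]
  have eq: "(\<lambda>\<omega>. (p (z \<omega> $ k) * z \<omega> $ l - q (z \<omega> $ l) * z \<omega> $ k)\<^sup>2)
      = (\<lambda>\<omega>. (p (z \<omega> $ k))\<^sup>2 * (z \<omega> $ l)\<^sup>2 + (z \<omega> $ k)\<^sup>2 * (q (z \<omega> $ l))\<^sup>2 - 2 * ((p (z \<omega> $ k) * z \<omega> $ k) * (q (z \<omega> $ l) * z \<omega> $ l)))"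
    by (rule ext) (simp add: power2_eq_square algebra_simps)
  have C0: "expectation (\<lambda>\<omega>. p (z \<omega> $ k) * z \<omega> $ k * (q (z \<omega> $ l) * z \<omega> $ l)) = 0"
    using C(2) P(3) by simp
  have "expectation (\<lambda>\<omega>. (p (z \<omega> $ k) * z \<omega> $ l - q (z \<omega> $ l) * z \<omega> $ k)\<^sup>2)
      = expectation (\<lambda>\<omega>. (p (z \<omega> $ k))\<^sup>2 * (z \<omega> $ l)\<^sup>2) + expectation (\<lambda>\<omega>. (z \<omega> $ k)\<^sup>2 * (q (z \<omega> $ l))\<^sup>2)
        - 2 * expectation (\<lambda>\<omega>. p (z \<omega> $ k) * z \<omega> $ k * (q (z \<omega> $ l) * z \<omega> $ l))"
    unfolding eq using A(1) B(1) C(1) by simp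
  then show ?thesis unfolding C0 using A(2) B(2) by (simp add: sq)
qed

end

section \<open>Asymptotic normality\<close>

lemma raw_diff:
  "raw1 (m - m') a = raw1 m a - raw1 m' a" "raw2 (m - m') a b = raw2 m a b - raw2 m' a b"
  "raw3 (m - m') a b c = raw3 m a b c - raw3 m' a b c" "raw4 (m - m') a b c d = raw4 m a b c d - raw4 m' a b c d"
  by (simp_all add: raw1_def raw2_def raw3_def raw4_def)

context estimator
begin

lemma drive_diagonal: "drive (k, k) (monomials \<alpha> x - m0) = (x $ k)\<^sup>2 - 1"
  by (simp add: drive_def dcm2_def raw_diff raw_monomials m0_2 delta_def power2_eq_square)

text \<open>The term of \<open>coupling\<close> in \<open>x $ k * x $ l\<close> is divided between
  the two brackets: its \<gamma>_k and \<kappa>_k parts make the first bracket uncorrelated with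
  \<open>x $ k\<close>, and its part in \<kappa>_l becomes the linear coefficient
  \<open>- 3 * B l\<close> of the second.\<close>

lemma drive_off_diagonal:
  assumes "k \<noteq> l"
  defines "A \<equiv> \<lambda>j. 3 * \<alpha> * \<gamma> j" and "B \<equiv> \<lambda>j. 4 * (1 - \<alpha>) * \<kappa> j"
  shows "drive (k, l) (monomials \<alpha> x - m0) =
    ((- A k - B k * \<gamma> k) + (- A k * \<gamma> k - B k * (\<kappa> k + 3)) * x $ k + A k * (x $ k)\<^sup>2 + B k * (x $ k) ^ 3) * x $ l
    - ((- A l - B l * \<gamma> l) + (- 3 * B l) * x $ l + A l * (x $ l)\<^sup>2 + B l * (x $ l) ^ 3) * x $ k"
proof -
  have t3: "t3 i j (monomials \<alpha> x - m0) = 3 * (x $ i * x $ i * x $ j - x $ j)" if "i \<noteq> j" for i j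
    using that by (simp add: t3_def dcm3_def raw_diff raw_monomials m0_1 m0_3 delta_def)
  have t4: "(1 - \<alpha>) * (\<kappa> i * t4 i j (monomials \<alpha> x - m0)) = (1 - \<alpha>) * (\<kappa> i * (4 * (x $ i * x $ i * x $ i * x $ j - \<gamma> i * x $ j)))"
    if "i \<noteq> j" for i j
    using that by (cases "\<alpha> = 1")
      (simp_all add: t4_def dcm4_def raw_diff raw_monomials m0_1 m0_3 m0_4 delta_def)
  have c2: "dcm2 (monomials \<alpha> x - m0) k l = x $ k * x $ l"
    using assms(1) by (simp add: dcm2_def raw_diff raw_monomials m0_2 delta_def)
  have "drive (k, l) (monomials \<alpha> x - m0)
      = \<alpha> * (\<gamma> k * (3 * (x $ k * x $ k * x $ l - x $ l))) + (1 - \<alpha>) * (\<kappa> k * (4 * (x $ k * x $ k * x $ k * x $ l - \<gamma> k * x $ l)))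
        - (\<alpha> * (\<gamma> l * (3 * (x $ l * x $ l * x $ k - x $ k))) + (1 - \<alpha>) * (\<kappa> l * (4 * (x $ l * x $ l * x $ l * x $ k - \<gamma> l * x $ k))))
        - coupling k l * (x $ k * x $ l)"
    using assms(1)
    by (simp only: drive_def Let_def fst_conv snd_conv if_False t3[OF assms(1)] t3[OF assms(1)[symmetric]]
      t4[OF assms(1)] t4[OF assms(1)[symmetric]] c2)
  then show ?thesis
    by (simp add: coupling_def A_def B_def power2_eq_square power3_eq_cube algebra_simps)
qed

lemma bounded_linear_linearization: "bounded_linear (\<lambda>d. \<chi> i. - drive i d / slope i)"
  using estimate_has_derivative by (rule has_derivative_bounded_linear)

end

lemma borel_measurable_matrix_mult:
  fixes f g :: "'a \<Rightarrow> real ^ 'n ^ 'n"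
  assumes "f \<in> borel_measurable M" "g \<in> borel_measurable M"
  shows "(\<lambda>x. f x ** g x) \<in> borel_measurable M"
proof -
  have "continuous_on UNIV (\<lambda>p. fst p ** snd p :: real ^ 'n ^ 'n)"
    unfolding matrix_matrix_mult_def by (intro continuous_on_vec_lambda continuous_intros)
  from borel_measurable_continuous_onI[OF this] borel_measurable_Pair[OF assms]
  have "(\<lambda>x. (\<lambda>p. fst p ** snd p) (f x, g x)) \<in> borel_measurable M" by (rule measurable_compose[rotated])
  then show ?thesis by simp
qed

lemma borel_measurable_cov_of: "cov_of \<in> borel_measurable borel"
  by (rule borel_measurable_continuous_onI[OF continuous_cov_of])

lemma borel_measurable_whitener: "whitener \<in> borel_measurable borel"
  using measurable_compose[OF borel_measurable_cov_of borel_measurable_inv_sqrt]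
  by (simp add: whitener_def[abs_def])

lemma (in closest_maximizer) borel_measurable_estimate:
  assumes "s \<in> borel_measurable borel"
  shows "estimate \<in> borel_measurable borel"
proof -
  have "(\<lambda>m. s (whitener m, m) ** whitener m) \<in> borel_measurable borel"
    by (intro borel_measurable_matrix_mult measurable_compose[OF _ assms] borel_measurable_Pair borel_measurable_whitener) auto
  moreover have "{m. sym_pos_def (cov_of m)} \<in> sets borel"
    using measurable_sets[OF borel_measurable_cov_of borel_sym_pos_def] by (simp add: vimage_def)
  ultimately show ?thesis
    unfolding estimate_def[abs_def] by (intro measurable_If) (auto simp: pred_def)
qed

lemma vectorize_diff: "vectorize (A - B) = vectorize A - vectorize B"
  by (simp add: vectorize_def vec_eq_iff)

lemma borel_measurable_vectorize: "vectorize \<in> borel_measurable borel"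
  unfolding vectorize_def[abs_def]
  by (intro borel_measurable_continuous_onI continuous_on_vec_lambda continuous_intros)

text \<open>An index lies in the set of \<open>card\<close> exactly when its weight
  \<open>?w\<close> is zero: a zero coefficient \<alpha> or 1 - \<alpha> removes the condition on
  \<gamma> or \<kappa>. Two distinct indices of weight zero would violate the cardinality
  bound.\<close>

lemma (in independent_components) population_at_population_moments:
  assumes "suitable \<alpha>" "0 \<le> \<alpha>" "\<alpha> \<le> 1"
    and card: "card {k. (\<alpha> = 0 \<or> mgamma N z k = 0) \<and> (\<alpha> = 1 \<or> mkappa N z k = 0)} \<le> 1"
  shows "population \<alpha> (mgamma N z) (mkappa N z) (population_moments \<alpha>)"
proof
  fix k l :: 'p assume "k \<noteq> l"
  let ?w = "\<lambda>j. \<alpha> * (mgamma N z j)\<^sup>2 + (1 - \<alpha>) * (mkappa N z j)\<^sup>2"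
  have nonneg: "0 \<le> ?w j" for j using assms by simp
  have "0 < ?w k \<or> 0 < ?w l"
  proof (rule ccontr)
    assume "\<not> (0 < ?w k \<or> 0 < ?w l)"
    then have "?w j = 0" if "j \<in> {k, l}" for j using nonneg[of j] that by auto
    moreover have "?w j = 0 \<longleftrightarrow> \<alpha> * (mgamma N z j)\<^sup>2 = 0 \<and> (1 - \<alpha>) * (mkappa N z j)\<^sup>2 = 0" for j
      using assms by (intro add_nonneg_eq_0_iff) auto
    ultimately have "{k, l} \<subseteq> {k. (\<alpha> = 0 \<or> mgamma N z k = 0) \<and> (\<alpha> = 1 \<or> mkappa N z k = 0)}" by auto
    from card_mono[OF _ this] card \<open>k \<noteq> l\<close> show False by simp
  qed
  then show "0 < \<alpha> * ((mgamma N z k)\<^sup>2 + (mgamma N z l)\<^sup>2) + (1 - \<alpha>) * ((mkappa N z k)\<^sup>2 + (mkappa N z l)\<^sup>2)"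
    using nonneg[of k] nonneg[of l] by (auto simp: algebra_simps)
qed (use assms raw_population_moments in auto)

definition asymptotic_variance :: "'a measure \<Rightarrow> ('a \<Rightarrow> real ^ 'p) \<Rightarrow> real \<Rightarrow> 'p \<Rightarrow> 'p \<Rightarrow> real" where
  "asymptotic_variance N z \<alpha> k l = (if k = l then (mkappa N z k + 2) / 4
       else (9 * \<alpha>\<^sup>2 * zeta11 N z k l + 16 * (1 - \<alpha>)\<^sup>2 * zeta22 N z k l + 24 * \<alpha> * (1 - \<alpha>) * zeta12 N z k l)
         / (3 * \<alpha> * ((mgamma N z k)\<^sup>2 + (mgamma N z l)\<^sup>2) + 4 * (1 - \<alpha>) * ((mkappa N z k)\<^sup>2 + (mkappa N z l)\<^sup>2))\<^sup>2)"

text \<open>The two brackets of the off-diagonal term contribute separately. The one for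
  \<open>k\<close> is a pure regression residual. The one for \<open>l\<close> is the residual plus
  \<open>A l * \<gamma> l + B l * \<kappa> l\<close> times \<open>z $ l\<close>, writing \<gamma>
  and \<kappa> for the cumulants; the square of that coefficient is the sum of the last terms of the
  three zetas with their weights.\<close>

lemma (in independent_components) drive_second_moment:
  assumes fm: "finite_moments N z 6" and E: "estimator \<alpha> (mgamma N z) (mkappa N z) (population_moments \<alpha>) s"
  shows "expectation (\<lambda>\<omega>. (- estimator.drive \<alpha> (mgamma N z) (mkappa N z) (population_moments \<alpha>) (k, l) (monomials \<alpha> (z \<omega>) - population_moments \<alpha>)
      / estimator.slope \<alpha> (mgamma N z) (mkappa N z) (k, l))\<^sup>2)
    = asymptotic_variance N z \<alpha> k l"
proof -
  interpret E: estimator \<alpha> "mgamma N z" "mkappa N z" "population_moments \<alpha>" s by fact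
  have pull: "expectation (\<lambda>\<omega>. (- f \<omega> / c)\<^sup>2) = expectation (\<lambda>\<omega>. (f \<omega>)\<^sup>2) / c\<^sup>2" for f and c :: real
    by (simp add: power_divide)
  have k4: "moment N z 4 j = mkappa N z j + 3" for j by (simp add: mkappa_def mbeta_def)
  have m3: "moment N z 3 j = mgamma N z j" for j by (simp add: mgamma_def)
  show ?thesis
  proof (cases "k = l")
    case True
    have "expectation (\<lambda>\<omega>. ((z \<omega> $ k)\<^sup>2 - 1)\<^sup>2) = mkappa N z k + 2"
      using cubic_expectation(2)[OF fm, where a = "-1" and b = 0 and c = 1 and d = 0 and k = k]
      by (simp add: k4)
    then show ?thesis
      unfolding pull using True by (simp add: E.drive_diagonal E.slope_def asymptotic_variance_def)
  next
    case False
    define A where "A j = 3 * \<alpha> * mgamma N z j" for j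
    define B where "B j = 4 * (1 - \<alpha>) * mkappa N z j" for j
    define a where "a j = - A j - B j * mgamma N z j" for j
    define b where "b = - A k * mgamma N z k - B k * (mkappa N z k + 3)"
    have zero: "b + A k * moment N z 3 k + B k * moment N z 4 k = 0"
      by (simp add: b_def m3 k4 algebra_simps)
    have "expectation (\<lambda>\<omega>. (E.drive (k, l) (monomials \<alpha> (z \<omega>) - population_moments \<alpha>))\<^sup>2)
        = expectation (\<lambda>\<omega>. (a k + b * z \<omega> $ k + A k * (z \<omega> $ k)\<^sup>2 + B k * (z \<omega> $ k) ^ 3)\<^sup>2)
          + expectation (\<lambda>\<omega>. (a l + (- 3 * B l) * z \<omega> $ l + A l * (z \<omega> $ l)\<^sup>2 + B l * (z \<omega> $ l) ^ 3)\<^sup>2)"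
      unfolding cross_variance[OF fm False zero, symmetric]
      using E.drive_off_diagonal[OF False] by (simp add: a_def b_def A_def B_def)
    also have "\<dots> = 9 * \<alpha>\<^sup>2 * zeta11 N z k l + 16 * (1 - \<alpha>)\<^sup>2 * zeta22 N z k l + 24 * \<alpha> * (1 - \<alpha>) * zeta12 N z k l"
    proof -
      have m: "moment N z 5 j = meta N z j + mgamma N z j" "moment N z 6 j = momega N z j + (mgamma N z j)\<^sup>2"
        "mnu N z j = mkappa N z j + 2" "mbeta N z j = mkappa N z j + 3" for j
        by (simp_all add: meta_def momega_def mnu_def mkappa_def mbeta_def mgamma_def)
      show ?thesis
        unfolding cubic_expectation(2)[OF fm] m3 k4 zeta11_def zeta22_def zeta12_def m
        unfolding a_def b_def A_def B_def power2_eq_square power4_eq_xxxx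
        by algebra
    qed
    finally have num: "expectation (\<lambda>\<omega>. (E.drive (k, l) (monomials \<alpha> (z \<omega>) - population_moments \<alpha>))\<^sup>2)
        = 9 * \<alpha>\<^sup>2 * zeta11 N z k l + 16 * (1 - \<alpha>)\<^sup>2 * zeta22 N z k l + 24 * \<alpha> * (1 - \<alpha>) * zeta12 N z k l" .
    have "(E.slope (k, l))\<^sup>2 = (E.denom k l)\<^sup>2" using False by (simp add: E.slope_def)
    then show ?thesis
      unfolding pull num E.denom_def asymptotic_variance_def using False by (simp only: if_False)
  qed
qed

lemma expectation_transfer:
  fixes f :: "'c::topological_space \<Rightarrow> 'd::euclidean_space"
  assumes "distr M borel X = distr N borel Y" "X \<in> borel_measurable M" "Y \<in> borel_measurable N" "f \<in> borel_measurable borel"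
  shows "(\<integral>\<omega>. f (X \<omega>) \<partial>M) = (\<integral>\<omega>. f (Y \<omega>) \<partial>N)"
proof -
  have "(\<integral>\<omega>. f (X \<omega>) \<partial>M) = integral\<^sup>L (distr M borel X) f"
    using assms by (intro integral_distr[symmetric]) auto
  also have "\<dots> = (\<integral>\<omega>. f (Y \<omega>) \<partial>N)"
    unfolding assms(1) using assms by (intro integral_distr) auto
  finally show ?thesis .
qed

theorem spp_asymptotic_normality_core:
  fixes N :: "'a measure" and z :: "'a \<Rightarrow> real ^ 'p"
    and M :: "'b measure" and Z :: "nat \<Rightarrow> 'b \<Rightarrow> real ^ 'p"
  assumes N: "independent_components N z"
    and M: "prob_space M" "prob_space.indep_vars M (\<lambda>_. borel) Z UNIV"
    and law: "\<And>i. distr M borel (Z i) = distr N borel z"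
    and \<alpha>: "0 \<le> \<alpha>" "\<alpha> \<le> 1"
    and fm: "finite_moments N z 6" "\<alpha> \<noteq> 1 \<Longrightarrow> finite_moments N z 8"
    and card: "card {k. (\<alpha> = 0 \<or> mgamma N z k = 0) \<and> (\<alpha> = 1 \<or> mkappa N z k = 0)} \<le> 1"
  shows "spp_asymptotic_normality M Z \<alpha> (asymptotic_variance N z \<alpha>)"
proof -
  interpret N: independent_components N z by (rule N)
  interpret M: prob_space M by (rule M(1))
  have suit: "N.suitable \<alpha>" using fm by (simp add: N.suitable_def)
  have Z_meas[measurable]: "Z i \<in> borel_measurable M" for i
    using M(2) unfolding M.indep_vars_def2 by simp
  let ?F = "\<lambda>\<theta> U. objective \<alpha> (snd \<theta>) (U ** fst \<theta>)"
  \<comment> \<open>The parameter \<theta> pairs a whitener with moments, so \<open>s\<close> is one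
    Borel function on the whole product space, independent of \<open>n\<close> and of the
    sample.\<close>
  obtain s :: "(real ^ 'p ^ 'p) \<times> 'p moments \<Rightarrow> real ^ 'p ^ 'p" where s: "s \<in> borel_measurable borel"
    "\<And>\<theta>. s \<theta> \<in> Collect orthogonal_matrix"
    "\<And>\<theta> V. V \<in> Collect orthogonal_matrix \<Longrightarrow> ?F \<theta> V \<le> ?F \<theta> (s \<theta>)"
    "\<And>\<theta> U. \<lbrakk>U \<in> Collect orthogonal_matrix; \<And>V. V \<in> Collect orthogonal_matrix \<Longrightarrow> ?F \<theta> V \<le> ?F \<theta> U\<rbrakk>
      \<Longrightarrow> dist (s \<theta>) (mat 1) \<le> dist U (mat 1)"
    by (rule measurable_argmax_closest[OF compact_orthogonal_matrices _ continuous_objective, of \<alpha> "mat 1"])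
      (use orthogonal_matrix_id in blast)+
  have E: "estimator \<alpha> (mgamma N z) (mkappa N z) (N.population_moments \<alpha>) s"
    unfolding estimator_def closest_maximizer_def
    using N.population_at_population_moments[OF suit \<alpha> card] s by auto
  interpret E: estimator \<alpha> "mgamma N z" "mkappa N z" "N.population_moments \<alpha>" s by (rule E)

  interpret I: iid_vectors M "\<lambda>i \<omega>. monomials \<alpha> (Z i \<omega>)"
  proof
    show "M.indep_vars (\<lambda>_. borel) (\<lambda>i \<omega>. monomials \<alpha> (Z i \<omega>)) UNIV"
      by (rule M.indep_vars_compose2[OF M(2)]) (rule monomials_measurable)
    have d: "distr M borel (\<lambda>\<omega>. monomials \<alpha> (Z i \<omega>)) = distr (distr N borel z) borel (monomials \<alpha>)" for i
      unfolding law[of i, symmetric] by (subst distr_distr) (auto simp: comp_def)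
    show "distr M borel (\<lambda>\<omega>. monomials \<alpha> (Z i \<omega>)) = distr M borel (\<lambda>\<omega>. monomials \<alpha> (Z 0 \<omega>))" for i
      by (simp only: d)
    have "integrable (distr N borel z) (\<lambda>x. (norm (monomials \<alpha> x))\<^sup>2)"
      using N.monomials_square_integrable[OF suit] by (subst integrable_distr_eq) auto
    then show "integrable M (\<lambda>\<omega>. (norm (monomials \<alpha> (Z 0 \<omega>)))\<^sup>2)"
      unfolding law[of 0, symmetric] by (subst (asm) integrable_distr_eq) auto
  qed
  have mu: "I.mu = N.population_moments \<alpha>"
    unfolding I.mu_def N.population_moments_def by (rule expectation_transfer[OF law Z_meas N.z_measurable monomials_measurable])
  have mean: "I.mean n \<omega> = sample_moments \<alpha> n (\<lambda>i. Z i \<omega>)" for n \<omega>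
    by (simp add: I.mean_def sample_moments_def)
  define T where "T d = (\<chi> i. - E.drive i d / E.slope i)" for d
  have der: "((\<lambda>m. vectorize (E.estimate m)) has_derivative T) (at I.mu)"
    using E.estimate_has_derivative unfolding mu T_def[abs_def] .
  have estimate_meas: "E.estimate \<in> borel_measurable borel" by (rule E.borel_measurable_estimate[OF s(1)])
  then have "(\<lambda>m. vectorize (E.estimate m)) \<in> borel_measurable borel"
    by (rule measurable_compose[OF _ borel_measurable_vectorize])
  then obtain L :: "(real ^ ('p \<times> 'p)) measure" where L:
    "converges_in_distribution M (\<lambda>n \<omega>. sqrt (real n) *\<^sub>R (vectorize (E.estimate (I.mean n \<omega>)) - vectorize (E.estimate I.mu))) L"
    "multivariate_normal 0 L"
    "\<And>i. prob_space.variance L (\<lambda>x. x $ i) = M.expectation (\<lambda>\<omega>. (T (monomials \<alpha> (Z 0 \<omega>) - I.mu) $ i)\<^sup>2)"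
    by (rule I.delta_method[OF _ der]) blast
  have var: "prob_space.variance L (\<lambda>x. x $ (k, l)) = asymptotic_variance N z \<alpha> k l" for k l
  proof -
    have "bounded_linear (\<lambda>d. T d $ (k, l))"
      using E.bounded_linear_linearization unfolding T_def[abs_def, symmetric] by (rule bounded_linear_compose[OF bounded_linear_vec_nth])
    then have [measurable]: "(\<lambda>d. T d $ (k, l)) \<in> borel_measurable borel"
      by (intro borel_measurable_continuous_onI linear_continuous_on)
    have "(\<lambda>x. (T (monomials \<alpha> x - N.population_moments \<alpha>) $ (k, l))\<^sup>2) \<in> borel_measurable borel"
      by measurable
    from expectation_transfer[OF law[of 0] Z_meas N.z_measurable this]
    have "M.expectation (\<lambda>\<omega>. (T (monomials \<alpha> (Z 0 \<omega>) - I.mu) $ (k, l))\<^sup>2)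
        = N.expectation (\<lambda>\<omega>. (T (monomials \<alpha> (z \<omega>) - N.population_moments \<alpha>) $ (k, l))\<^sup>2)"
      by (simp only: mu)
    also have "\<dots> = N.expectation (\<lambda>\<omega>. (- E.drive (k, l) (monomials \<alpha> (z \<omega>) - N.population_moments \<alpha>) / E.slope (k, l))\<^sup>2)"
      by (simp add: T_def)
    finally show ?thesis
      unfolding L(3) N.drive_second_moment[OF fm(1) E] .
  qed
  show ?thesis
    unfolding spp_asymptotic_normality_def
  proof (intro exI conjI allI ballI impI)
    let ?W = "\<lambda>n \<omega>. E.estimate (sample_moments \<alpha> n (\<lambda>i. Z i \<omega>))"
    show "?W n \<in> borel_measurable M" for n
      using measurable_compose[OF I.mean_measurable estimate_meas, of n] by (simp add: mean)
    show "spp_solution \<alpha> n (\<lambda>i. Z i \<omega>) (?W n \<omega>)" if "invertible (sample_cov n (\<lambda>i. Z i \<omega>))" for n \<omega>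
      using that by (rule E.estimate_spp_solution)
    show "converges_in_prob M ?W (mat 1)"
      using I.delta_consistent[OF estimate_meas] E.isCont_estimate by (simp add: mean mu E.estimate_m0)
    show "converges_in_distribution M (\<lambda>n \<omega>. sqrt (real n) *\<^sub>R vectorize (?W n \<omega> - mat 1)) L"
      using L(1) by (simp add: mean mu E.estimate_m0 vectorize_diff)
    show "multivariate_normal 0 L" by (rule L(2))
    show "prob_space.variance L (\<lambda>x. x $ (k, l)) = asymptotic_variance N z \<alpha> k l" for k l
      by (rule var)
  qed
qed

text \<open>All three parts are instances of one result with a common degeneracy set. For 0 <
  \<alpha> < 1 a component is degenerate when \<gamma> and \<kappa> both vanish; at an endpoint only
  one of them enters the objective, so the set is larger and the cardinality bound is imposed on
  that set.\<close>

theorem corollary4p2p1: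
  fixes N :: "'a measure" and z :: "'a \<Rightarrow> real ^ 'p"
    and M :: "'b measure" and Z :: "nat \<Rightarrow> 'b \<Rightarrow> real ^ 'p"
  assumes "prob_space N"
    and "z \<in> borel_measurable N"
    and "prob_space.indep_vars N (\<lambda>_. borel) (\<lambda>k \<omega>. z \<omega> $ k) UNIV"
    and "\<And>k. integrable N (\<lambda>\<omega>. z \<omega> $ k)"
    and "\<And>k. prob_space.expectation N (\<lambda>\<omega>. z \<omega> $ k) = 0"
    and "\<And>k. prob_space.variance N (\<lambda>\<omega>. z \<omega> $ k) = 1"
    and "prob_space M"
    and "prob_space.indep_vars M (\<lambda>_. borel) Z UNIV"
    and "\<And>i. distr M borel (Z i) = distr N borel z"
  shows
    "(finite_moments N z 6 \<and> card {k. mgamma N z k = 0} \<le> 1 \<longrightarrow>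
        spp_asymptotic_normality M Z 1
          (\<lambda>k l. if k = l then (mkappa N z k + 2) / 4
                 else zeta11 N z k l / ((mgamma N z k)\<^sup>2 + (mgamma N z l)\<^sup>2)\<^sup>2))
   \<and> (finite_moments N z 8 \<and> card {k. mkappa N z k = 0} \<le> 1 \<longrightarrow>
        spp_asymptotic_normality M Z 0
          (\<lambda>k l. if k = l then (mkappa N z k + 2) / 4
                 else zeta22 N z k l / ((mkappa N z k)\<^sup>2 + (mkappa N z l)\<^sup>2)\<^sup>2))
   \<and> (finite_moments N z 8 \<and> card {k. mgamma N z k = 0 \<and> mkappa N z k = 0} \<le> 1 \<longrightarrow>
        (\<forall>\<alpha>\<in>{0..1}.
           (\<alpha> = 1 \<longrightarrow> card {k. mgamma N z k = 0} \<le> 1) \<and>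
           (\<alpha> = 0 \<longrightarrow> card {k. mkappa N z k = 0} \<le> 1) \<longrightarrow>
           spp_asymptotic_normality M Z \<alpha>
             (\<lambda>k l. if k = l then (mkappa N z k + 2) / 4
                    else (9 * \<alpha>\<^sup>2 * zeta11 N z k l + 16 * (1 - \<alpha>)\<^sup>2 * zeta22 N z k l
                          + 24 * \<alpha> * (1 - \<alpha>) * zeta12 N z k l)
                       / (3 * \<alpha> * ((mgamma N z k)\<^sup>2 + (mgamma N z l)\<^sup>2)
                          + 4 * (1 - \<alpha>) * ((mkappa N z k)\<^sup>2 + (mkappa N z l)\<^sup>2))\<^sup>2)))"
proof -
  have N: "independent_components N z"
    unfolding independent_components_def independent_components_axioms_def using assms by auto
  interpret N: independent_components N z by (rule N)
  have 86: "finite_moments N z 6" if "finite_moments N z 8"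
    unfolding finite_moments_def
  proof
    fix k
    \<comment> \<open>For the even exponent 6 the absolute value makes no difference.\<close>
    have "integrable N (\<lambda>\<omega>. (z \<omega> $ k) ^ 6)" by (rule N.integrable_power[OF that]) simp
    then show "integrable N (\<lambda>\<omega>. \<bar>z \<omega> $ k\<bar> ^ 6)"
      by (rule Bochner_Integration.integrable_bound) (auto simp: power_abs)
  qed
  note core = spp_asymptotic_normality_core[OF N assms(7-9)]
  show ?thesis
  proof (intro conjI impI ballI; elim conjE)
    assume "finite_moments N z 6" "card {k. mgamma N z k = 0} \<le> 1"
    then have "spp_asymptotic_normality M Z 1 (asymptotic_variance N z 1)"
      by (intro core) auto
    moreover have "asymptotic_variance N z 1 = (\<lambda>k l. if k = l then (mkappa N z k + 2) / 4
                 else zeta11 N z k l / ((mgamma N z k)\<^sup>2 + (mgamma N z l)\<^sup>2)\<^sup>2)"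
      \<comment> \<open>At \<alpha> = 1 the factor 9 cancels against the square of 3 in the
        denominator; at \<alpha> = 0 below, 16 cancels against the square of 4.\<close>
      by (intro ext) (simp add: asymptotic_variance_def power_mult_distrib del: distrib_left_numeral)
    ultimately show "spp_asymptotic_normality M Z 1 (\<lambda>k l. if k = l then (mkappa N z k + 2) / 4
                 else zeta11 N z k l / ((mgamma N z k)\<^sup>2 + (mgamma N z l)\<^sup>2)\<^sup>2)" by simp
  next
    assume "finite_moments N z 8" "card {k. mkappa N z k = 0} \<le> 1"
    then have "spp_asymptotic_normality M Z 0 (asymptotic_variance N z 0)"
      using 86 by (intro core) auto
    moreover have "asymptotic_variance N z 0 = (\<lambda>k l. if k = l then (mkappa N z k + 2) / 4
                 else zeta22 N z k l / ((mkappa N z k)\<^sup>2 + (mkappa N z l)\<^sup>2)\<^sup>2)"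
      by (intro ext) (simp add: asymptotic_variance_def power_mult_distrib del: distrib_left_numeral)
    ultimately show "spp_asymptotic_normality M Z 0 (\<lambda>k l. if k = l then (mkappa N z k + 2) / 4
                 else zeta22 N z k l / ((mkappa N z k)\<^sup>2 + (mkappa N z l)\<^sup>2)\<^sup>2)" by simp
  next
    fix \<alpha> :: real
    assume a: "\<alpha> \<in> {0..1}" "\<alpha> = 1 \<longrightarrow> card {k. mgamma N z k = 0} \<le> 1" "\<alpha> = 0 \<longrightarrow> card {k. mkappa N z k = 0} \<le> 1"
      and fm: "finite_moments N z 8" and card: "card {k. mgamma N z k = 0 \<and> mkappa N z k = 0} \<le> 1"
    show "spp_asymptotic_normality M Z \<alpha>
             (\<lambda>k l. if k = l then (mkappa N z k + 2) / 4
                    else (9 * \<alpha>\<^sup>2 * zeta11 N z k l + 16 * (1 - \<alpha>)\<^sup>2 * zeta22 N z k l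
                          + 24 * \<alpha> * (1 - \<alpha>) * zeta12 N z k l)
                       / (3 * \<alpha> * ((mgamma N z k)\<^sup>2 + (mgamma N z l)\<^sup>2)
                          + 4 * (1 - \<alpha>) * ((mkappa N z k)\<^sup>2 + (mkappa N z l)\<^sup>2))\<^sup>2)"
    proof (rule core[unfolded asymptotic_variance_def[abs_def]])
      show "card {k. (\<alpha> = 0 \<or> mgamma N z k = 0) \<and> (\<alpha> = 1 \<or> mkappa N z k = 0)} \<le> 1"
        using a card by (cases "\<alpha> = 0"; cases "\<alpha> = 1") auto
    qed (use a fm 86 in auto)
  qed
qed

end
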